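(* Let $X_1,X_2,\dots$ be i.i.d. with $\mathbf{E}X_1=-a<0$ and $\mathrm{Var}(X_1)<\infty$. Assume $\overline F(x)\sim e^{-g(x)}x^{-2}$ as $x\to\infty$, where $g:(0,\infty)\to\mathbb{R}$ is continuously differentiable, nondecreasing for all sufficiently large $x$, and such that $x\mapsto g(x)/x$ is nonincreasing on $(0,\infty)$ with $g(x)/x\to0$. Then: (i) there exists a constant $C>0$ such that for all sufficiently large $x$, \[ \mathbf{P}(A_\tau>x)\le Cx^{1/4}\exp\left\{-g(\sqrt{2ax})\sqrt{1-\frac{2Cg(\sqrt{2ax})}{a\sqrt{2ax}}}\right\}; \] (ii) for every $\varepsilon>0$ there exists $C>0$ such that \[ \liminf_{x\to\infty}\frac{\mathbf{P}(A_\tau>x)}{\overline F(\sqrt{2ax}+Cx^{1/4+\varepsilon})}\ge\mathbf{E}\tau; \] (iii) if moreover there is $\gamma_0\in(0,1)$ such that $x\mapsto g(x)/x^{\gamma_0}$ is nonincreasing on $(0,\infty)$ with $g(x)/x^{\gamma_0}\to0$, then \[ \lim_{x\to\infty}\frac{\ln\mathbf{P}(A_\tau>x)}{\ln\overline F(\sqrt{2ax})}=1. \]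
   Context: $S_0=0$, $S_n=X_1+\dots+X_n$, $\overline F(x)=\mathbf{P}(X_1>x)$, $\tau=\min\{n\ge1:S_n\le0\}$, $A_\tau=\sum_{k=0}^{\tau-1}S_k$. *)

theory Defs
  imports "HOL-Probability.Probability" "HOL-Library.Landau_Symbols"
begin

definition rw_S :: "(nat \<Rightarrow> 'a \<Rightarrow> real) \<Rightarrow> nat \<Rightarrow> 'a \<Rightarrow> real" where
  "rw_S X n \<omega> = (\<Sum>k\<in>{1..n}. X k \<omega>)"

definition Fbar :: "'a measure \<Rightarrow> (nat \<Rightarrow> 'a \<Rightarrow> real) \<Rightarrow> real \<Rightarrow> real" where
  "Fbar M X x = measure M {\<omega> \<in> space M. X 1 \<omega> > x}"

definition rw_tau :: "(nat \<Rightarrow> 'a \<Rightarrow> real) \<Rightarrow> 'a \<Rightarrow> nat" where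
  "rw_tau X \<omega> = (LEAST n. 1 \<le> n \<and> rw_S X n \<omega> \<le> 0)"

text \<open>A_tau = S_0 + ... + S_(tau-1); set to 0 on the (null) event tau = infinity.\<close>
definition rw_A :: "(nat \<Rightarrow> 'a \<Rightarrow> real) \<Rightarrow> 'a \<Rightarrow> real" where
  "rw_A X \<omega> = (if \<exists>n\<ge>1. rw_S X n \<omega> \<le> 0
                then (\<Sum>k<rw_tau X \<omega>. rw_S X k \<omega>) else 0)"

end

theory Submission
  imports Defs "HOL-Real_Asymp.Real_Asymp"
begin

text \<open>Put \<open>y = sqrt (2 * a * x)\<close>. A walk with drift \<open>- a\<close> that jumps to height \<open>y\<close> encloses the area
  \<open>y\<^sup>2 / (2 * a) = x\<close> before it returns to \<open>0\<close>, so a large area is essentially due to one step of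
  size \<open>y\<close>, and each of the \<open>\<tau>\<close> steps may be that one.

  For the upper bounds, a step beyond a level \<open>c\<close> before \<open>\<tau>\<close> has probability at most
  \<open>E \<tau> * Fbar c\<close>. If there is none, the area of an excursion of length \<open>n\<close>, divided by \<open>n\<close>, is a
  sum of the truncated steps with weights in \<open>[0, 1]\<close> and mean about \<open>- a * n / 2\<close>, and Chernoff's
  inequality with tilt \<open>l\<close> costs \<open>l * (x / n + a * n / 2) \<ge> l * y\<close>. Truncation at \<open>y\<close> admits
  \<open>l = (g y + ln y / 2) / y\<close>, because \<open>g t / t\<close> is nonincreasing, and this gives the first bound.
  If \<open>g t / t powr \<gamma>\<close> is nonincreasing with \<open>\<gamma> < 1\<close>, truncation at a small multiple of \<open>y\<close> admits
  an arbitrary multiple of that tilt, and a sum of larger steps, none of which exceeds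
  \<open>(1 - d) * y\<close>, passes that level only if two of them occur.

  For the lower bound, a first step beyond \<open>y\<close> plus a margin of larger order than \<open>x powr (1/4)\<close>
  suffices: by Kolmogorov's inequality the walk then stays close to its drift for the next \<open>y / a\<close>
  steps.\<close>

section \<open>Elementary inequalities\<close>

lemma exp_le_quadratic:
  fixes u :: real
  assumes "u \<le> 1"
  shows "exp u \<le> 1 + u + u\<^sup>2"
proof (cases "u \<ge> 0")
  case True
  then show ?thesis using assms exp_bound by blast
next
  case False
  define v where "v = - u"
  have "v > 0" using False by (simp add: v_def)
  then have "1 \<le> 1 + v ^ 3" by simp
  also have "\<dots> = (1 + v) * (1 - v + v\<^sup>2)"
    by (simp add: power2_eq_square power3_eq_cube algebra_simps)
  also have "\<dots> \<le> exp v * (1 - v + v\<^sup>2)"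
  proof (rule mult_right_mono)
    have "0 \<le> (1 - v)\<^sup>2 + v" using \<open>v > 0\<close> by (intro add_nonneg_nonneg) auto
    then show "0 \<le> 1 - v + v\<^sup>2" by (simp add: power2_eq_square algebra_simps)
  qed (rule exp_ge_add_one_self)
  finally have "exp (- v) \<le> 1 - v + v\<^sup>2"
    by (simp add: exp_minus field_simps)
  then show ?thesis by (simp add: v_def)
qed

lemma exp_mult_le_quadratic:
  fixes u L :: real
  assumes "0 \<le> u" "u \<le> 1" "0 \<le> L"
  shows "exp (u * L) \<le> 9 + u\<^sup>2 * exp L"
proof (cases "u * L \<le> 2")
  case True
  then have "exp (u * L) \<le> exp (1 + 1)" by simp
  also have "\<dots> = exp 1 * exp (1::real)" by (rule exp_add)
  also have "\<dots> \<le> 3 * 3" using exp_le by (intro mult_mono) auto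
  finally show ?thesis by (simp add: add_increasing2)
next
  case False
  define v where "v = u * L"
  have v_bounds: "2 < v" "v \<le> L" using False assms by (auto simp: v_def mult_left_le_one_le)
  have "u = v / L" using v_bounds by (simp add: v_def)
  have "L / v = 1 + (L - v) / v" using v_bounds by (simp add: field_simps)
  also have "(L - v) / v \<le> (L - v) / 2" using v_bounds by (intro divide_left_mono) auto
  also have "1 + (L - v) / 2 \<le> exp ((L - v) / 2)" by (rule exp_ge_add_one_self)
  finally have "(L / v)\<^sup>2 \<le> (exp ((L - v) / 2))\<^sup>2" using v_bounds by (intro power_mono) auto
  also have "\<dots> = exp (L - v)" by (simp flip: exp_double)
  finally have "exp v * (L / v)\<^sup>2 \<le> exp v * exp (L - v)" by (intro mult_left_mono) auto
  also have "\<dots> = exp L" by (simp flip: exp_add)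
  finally have "exp v \<le> u\<^sup>2 * exp L"
    unfolding \<open>u = v / L\<close> using v_bounds by (simp add: power_divide field_simps)
  then show ?thesis by (simp add: v_def add_increasing)
qed

lemma square_plus_two_le_exp:
  fixes d u :: real
  assumes "0 < d" "d \<le> 1" "0 \<le> u"
  shows "(u + 2)\<^sup>2 \<le> 4 / d\<^sup>2 * exp (d * u)"
proof -
  have "u + 2 \<le> 2 / d * (1 + d * u / 2)" using assms by (simp add: field_simps)
  also have "\<dots> \<le> 2 / d * exp (d * u / 2)"
    using assms by (intro mult_left_mono exp_ge_add_one_self) auto
  finally have "(u + 2)\<^sup>2 \<le> (2 / d * exp (d * u / 2))\<^sup>2" using assms by (intro power_mono) auto
  also have "\<dots> = 4 / d\<^sup>2 * exp (d * u)"
    by (simp add: power_mult_distrib power_divide flip: exp_double)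
  finally show ?thesis .
qed

lemma abs_le_square_div_plus:
  fixes z c :: real
  assumes "c > 0"
  shows "\<bar>z\<bar> \<le> z\<^sup>2 / (2 * c) + c / 2"
proof -
  have "0 \<le> (\<bar>z\<bar> - c)\<^sup>2 / (2 * c)" using assms by simp
  also have "\<dots> = z\<^sup>2 / (2 * c) + c / 2 - \<bar>z\<bar>"
    using assms by (simp add: field_simps power2_eq_square)
  finally show ?thesis by simp
qed

lemma mult_sqrt_le_square_mult:
  assumes "0 \<le> y"
  shows "l * sqrt y \<le> l\<^sup>2 * y + 1"
proof -
  have "l * sqrt y \<le> (l * sqrt y)\<^sup>2 + 1"
    using abs_le_square_div_plus[of 1 "l * sqrt y"] zero_le_power2[of "l * sqrt y"] by linarith
  then show ?thesis using assms by (simp add: power_mult_distrib)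
qed

lemma sqrt_one_minus_le: "u \<le> 2 \<Longrightarrow> sqrt (1 - u) \<le> 1 - u / 2"
  by (rule real_le_lsqrt) (simp_all add: power2_eq_square algebra_simps)

lemma exponent_le_sqrt_form:
  fixes u y a B C :: real
  assumes "0 \<le> u" "0 < y" "0 < a" "B * a \<le> C" "C * u \<le> a * y"
  shows "- u + B * (u\<^sup>2 / y) \<le> - (u * sqrt (1 - 2 * C * u / (a * y)))"
proof -
  have "sqrt (1 - 2 * C * u / (a * y)) \<le> 1 - 2 * C * u / (a * y) / 2"
    using assms by (intro sqrt_one_minus_le) (simp add: field_simps)
  then have "u * sqrt (1 - 2 * C * u / (a * y)) \<le> u * (1 - 2 * C * u / (a * y) / 2)"
    using \<open>0 \<le> u\<close> by (rule mult_left_mono)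
  also have "\<dots> = u - C / a * (u\<^sup>2 / y)"
    by (simp add: power2_eq_square algebra_simps)
  also have "\<dots> \<le> u - B * (u\<^sup>2 / y)"
    using assms by (intro diff_left_mono mult_right_mono) (auto simp: field_simps)
  finally show ?thesis by simp
qed

lemma exp_half_ln: "0 < y \<Longrightarrow> exp (ln y / 2) = sqrt y"
  by (simp add: powr_half_sqrt[symmetric] powr_def)

lemma exp_mult_half_ln_over_square_le:
  assumes "0 < t" "t \<le> b" "1 \<le> b"
  shows "exp (t / b * (ln b / 2)) / t\<^sup>2 \<le> 9 * (1 / t\<^sup>2) + sqrt b / b\<^sup>2"
proof -
  have "exp (t / b * (ln b / 2)) / t\<^sup>2 \<le> (9 + (t / b)\<^sup>2 * exp (ln b / 2)) / t\<^sup>2"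
    using assms by (intro divide_right_mono exp_mult_le_quadratic) auto
  also have "\<dots> = 9 * (1 / t\<^sup>2) + sqrt b / b\<^sup>2"
    using assms by (simp add: exp_half_ln field_simps)
  finally show ?thesis .
qed

lemma sum_inverse_squares_le: "(\<Sum>i<n. 1 / (real i + 1)\<^sup>2) \<le> 2"
proof -
  have "(\<Sum>i<n. 1 / (real i + 1)\<^sup>2) \<le> 2 - 1 / real n"
  proof (induction n)
    case (Suc n)
    show ?case
    proof (cases "n = 0")
      case False
      have "(real n + 1) * real n \<le> (real n + 1)\<^sup>2" by (simp add: power2_eq_square)
      then have "1 / (real n + 1)\<^sup>2 \<le> 1 / ((real n + 1) * real n)"
        using False by (intro divide_left_mono) auto
      also have "\<dots> = 1 / real n - 1 / (real n + 1)"
        using False by (simp add: field_simps)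
      finally show ?thesis using Suc.IH by (simp add: add.commute)
    qed simp
  qed simp
  also have "\<dots> \<le> 2" by simp
  finally show ?thesis .
qed

text \<open>The left Riemann sum of \<open>max 0 (H - a t)\<close> dominates its integral.\<close>
lemma triangle_area_le_sum:
  fixes H a :: real
  assumes "0 \<le> H" "0 < a"
  shows "H\<^sup>2 / (2 * a) \<le> (\<Sum>i\<le>nat \<lfloor>H / a\<rfloor>. H - a * real i)"
proof -
  define m where "m = nat \<lfloor>H / a\<rfloor>"
  define f where "f = real m + 1 - H / a"
  have "0 \<le> H / a" using assms by simp
  then have "real m \<le> H / a" "H / a < real m + 1" unfolding m_def by linarith+
  then have f_bounds: "0 \<le> f" "f \<le> 1" by (auto simp: f_def)
  have "H = a * (real m + 1 - f)" using \<open>0 < a\<close> by (simp add: f_def)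
  then have factors: "H + a * f = a * (real m + 1)" "H - a * real m / 2 = (H + a * (1 - f)) / 2"
    by (simp_all add: algebra_simps)
  have "(\<Sum>i\<le>n. H - a * real i) = (real n + 1) * (H - a * real n / 2)" for n
    by (induction n) (simp_all add: field_simps)
  then have "(\<Sum>i\<le>m. H - a * real i) = (real m + 1) * (H - a * real m / 2)" .
  also have "\<dots> = (H + a * f) * (H + a * (1 - f)) / (2 * a)"
    unfolding factors using \<open>0 < a\<close> by simp
  finally have "(\<Sum>i\<le>m. H - a * real i) = (H + a * f) * (H + a * (1 - f)) / (2 * a)" .
  moreover have "H * H \<le> (H + a * f) * (H + a * (1 - f))"
    using assms f_bounds by (intro mult_mono) auto
  ultimately show ?thesis
    using \<open>0 < a\<close> unfolding m_def[symmetric] by (simp add: divide_right_mono power2_eq_square)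
qed

lemma sum_power_card_ge_two:
  fixes q :: real
  assumes "finite A"
  shows "(\<Sum>S | S \<subseteq> A \<and> 2 \<le> card S. q ^ card S) = (1 + q) ^ card A - 1 - real (card A) * q"
proof -
  have "(1 + q) ^ card A = (\<Prod>i\<in>A. q + 1)" by (simp add: add.commute)
  also have "\<dots> = (\<Sum>S\<in>Pow A. q ^ card S)"
    using prod_add[OF assms, of "\<lambda>_. q" "\<lambda>_. 1"] by simp
  also have "Pow A = {S. S \<subseteq> A \<and> 2 \<le> card S} \<union> insert {} ((\<lambda>i. {i}) ` A)"
  proof -
    have "S = {} \<or> (\<exists>i\<in>A. S = {i})" if "S \<subseteq> A" "card S < 2" for S
    proof -
      have "finite S" using that(1) assms finite_subset by blast
      moreover have "card S = 0 \<or> card S = 1" using that(2) by linarith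
      ultimately show ?thesis using that(1) by (auto simp: card_1_singleton_iff)
    qed
    then show ?thesis by (auto simp: not_le[symmetric])
  qed
  also have "(\<Sum>S\<in>\<dots>. q ^ card S) = (\<Sum>S | S \<subseteq> A \<and> 2 \<le> card S. q ^ card S)
      + (\<Sum>S\<in>insert {} ((\<lambda>i. {i}) ` A). q ^ card S)"
    using assms by (intro sum.union_disjoint) auto
  also have "(\<Sum>S\<in>insert {} ((\<lambda>i. {i}) ` A). q ^ card S) = 1 + real (card A) * q"
    using assms by (subst sum.insert) (auto simp: sum.reindex)
  finally show ?thesis by simp
qed

lemma one_plus_power_le_quadratic:
  fixes q :: real
  assumes "0 \<le> q" "real n * q \<le> 1"
  shows "(1 + q) ^ n \<le> 1 + real n * q + (real n * q)\<^sup>2"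
proof -
  have "(1 + q) ^ n \<le> exp q ^ n" using assms by (intro power_mono) auto
  also have "\<dots> = exp (real n * q)" by (rule exp_of_nat_mult[symmetric])
  also have "\<dots> \<le> 1 + real n * q + (real n * q)\<^sup>2" using assms by (intro exp_bound) auto
  finally show ?thesis .
qed

section \<open>Independent families\<close>

definition coord_algebra :: "'a measure \<Rightarrow> ('i \<Rightarrow> 'a \<Rightarrow> real) \<Rightarrow> 'i set \<Rightarrow> 'a measure" where
  "coord_algebra M X I = vimage_algebra (space M) (\<lambda>\<omega>. \<lambda>i\<in>I. X i \<omega>) (PiM I (\<lambda>_. borel))"

lemma space_coord_algebra [simp]: "space (coord_algebra M X I) = space M"
  by (simp add: coord_algebra_def)

lemma measurable_coord_algebra_component:
  assumes "i \<in> I"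
  shows "X i \<in> borel_measurable (coord_algebra M X I)"
proof -
  have "(\<lambda>\<omega>. \<lambda>i\<in>I. X i \<omega>) \<in> measurable (coord_algebra M X I) (PiM I (\<lambda>_. borel))"
    unfolding coord_algebra_def by (intro measurable_vimage_algebra1) (auto simp: space_PiM)
  from measurable_compose[OF this measurable_component_singleton[OF assms]] assms show ?thesis
    by simp
qed

lemma sets_coord_algebra_subset:
  assumes [measurable]: "\<And>i. i \<in> I \<Longrightarrow> X i \<in> borel_measurable M"
  shows "sets (coord_algebra M X I) \<subseteq> sets M"
proof -
  have "(\<lambda>\<omega>. \<lambda>i\<in>I. X i \<omega>) \<in> measurable M (PiM I (\<lambda>_. borel))"
    by measurable
  then show ?thesis
    unfolding coord_algebra_def sets_vimage_algebra
    by (intro sets.sigma_sets_subset) (auto simp: measurable_sets)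
qed

lemma measurable_coord_algebraD:
  assumes "\<And>i. i \<in> I \<Longrightarrow> X i \<in> borel_measurable M" "F \<in> measurable (coord_algebra M X I) N"
  shows "F \<in> measurable M N"
  using sets_coord_algebra_subset[of I X M] assms by (auto simp: measurable_def)

lemma measurable_coord_algebra_mono:
  assumes "F \<in> measurable (coord_algebra M X I) N" "I \<subseteq> J"
  shows "F \<in> measurable (coord_algebra M X J) N"
proof (rule measurable_coord_algebraD)
  show "X i \<in> borel_measurable (coord_algebra M X J)" if "i \<in> I" for i
    using that assms(2) by (intro measurable_coord_algebra_component) auto
  show "F \<in> measurable (coord_algebra (coord_algebra M X J) X I) N"
    using assms(1) by (simp add: coord_algebra_def[of "coord_algebra M X J"]
          flip: coord_algebra_def)
qed

lemma sets_vimage_subset: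
  assumes "F \<in> measurable M N"
  shows "sigma_sets (space M) {F -` A \<inter> space M |A. A \<in> sets N} \<subseteq> sets M"
  by (rule sets.sigma_sets_subset) (use measurable_sets[OF assms] in \<open>auto simp del: vimage_Int\<close>)

context prob_space begin

lemma expectation_of_bool:
  assumes [measurable]: "Measurable.pred M P"
  shows "expectation (\<lambda>\<omega>. of_bool (P \<omega>) :: real) = \<P>(\<omega> in M. P \<omega>)"
proof -
  have "expectation (\<lambda>\<omega>. of_bool (P \<omega>) :: real) = expectation (indicator {\<omega> \<in> space M. P \<omega>})"
    by (intro Bochner_Integration.integral_cong) (auto simp: indicator_def)
  then show ?thesis by simp
qed

lemma integrable_of_bool_mult:
  fixes f :: "'a \<Rightarrow> real"
  assumes [measurable]: "Measurable.pred M P" and "integrable M f"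
  shows "integrable M (\<lambda>\<omega>. of_bool (P \<omega>) * f \<omega>)"
  by (rule Bochner_Integration.integrable_bound[OF \<open>integrable M f\<close>]) (use assms in auto)

lemma integrable_of_bool:
  "Measurable.pred M P \<Longrightarrow> integrable M (\<lambda>\<omega>. of_bool (P \<omega>) :: real)"
  using integrable_of_bool_mult[of P "\<lambda>_. 1"] by simp

lemma indep_vars_borel_measurable:
  "indep_vars (\<lambda>_. borel) X K \<Longrightarrow> i \<in> K \<Longrightarrow> X i \<in> borel_measurable M"
  by (simp add: indep_vars_def)

lemma indep_var_coord_algebra:
  assumes indep: "indep_vars (\<lambda>_. borel) X K" and blocks: "I \<inter> J = {}" "I \<subseteq> K" "J \<subseteq> K"
    and F_measurable: "F \<in> borel_measurable (coord_algebra M X I)"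
    and G_measurable: "G \<in> borel_measurable (coord_algebra M X J)"
  shows "indep_var borel F borel G"
proof -
  have "indep_var (PiM I (\<lambda>_. borel)) (\<lambda>\<omega>. restrict (\<lambda>i. X i \<omega>) I)
      (PiM J (\<lambda>_. borel)) (\<lambda>\<omega>. restrict (\<lambda>i. X i \<omega>) J)"
    by (rule indep_var_restrict[OF indep blocks])
  then have "indep_set (sets (coord_algebra M X I)) (sets (coord_algebra M X J))"
    unfolding indep_var_eq coord_algebra_def sets_vimage_algebra by (elim conjE)
  then have "indep_set (sigma_sets (space M) {F -` A \<inter> space M |A. A \<in> sets borel})
      (sigma_sets (space M) {G -` A \<inter> space M |A. A \<in> sets borel})"
    using sets_vimage_subset[OF F_measurable] sets_vimage_subset[OF G_measurable]
    unfolding indep_sets2_eq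
    by simp (meson subset_trans subsetD)
  moreover have "F \<in> borel_measurable M" "G \<in> borel_measurable M"
    by (rule measurable_coord_algebraD[OF _ F_measurable]
        measurable_coord_algebraD[OF _ G_measurable];
        use blocks in \<open>auto intro: indep_vars_borel_measurable[OF indep]\<close>)+
  ultimately show ?thesis by (simp add: indep_var_eq)
qed

lemma
  fixes F G :: "'a \<Rightarrow> real"
  assumes "indep_vars (\<lambda>_. borel) X K" "I \<inter> J = {}" "I \<subseteq> K" "J \<subseteq> K"
    and "F \<in> borel_measurable (coord_algebra M X I)" "G \<in> borel_measurable (coord_algebra M X J)"
    and "integrable M F" "integrable M G"
  shows expectation_mult_coord_algebra:
      "expectation (\<lambda>\<omega>. F \<omega> * G \<omega>) = expectation F * expectation G"
    and integrable_mult_coord_algebra: "integrable M (\<lambda>\<omega>. F \<omega> * G \<omega>)"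
  using indep_var_lebesgue_integral indep_var_integrable indep_var_coord_algebra[OF assms(1-6)]
    assms(7,8) by blast+

lemma prob_conj_coord_algebra:
  assumes indep: "indep_vars (\<lambda>_. borel) X K" and blocks: "I \<inter> J = {}" "I \<subseteq> K" "J \<subseteq> K"
    and P_measurable: "Measurable.pred (coord_algebra M X I) P"
    and Q_measurable: "Measurable.pred (coord_algebra M X J) Q"
  shows "\<P>(\<omega> in M. P \<omega> \<and> Q \<omega>) = \<P>(\<omega> in M. P \<omega>) * \<P>(\<omega> in M. Q \<omega>)"
proof -
  have [measurable]: "Measurable.pred M P" "Measurable.pred M Q"
    by (rule measurable_coord_algebraD[OF _ P_measurable]
        measurable_coord_algebraD[OF _ Q_measurable];
        use blocks in \<open>auto intro: indep_vars_borel_measurable[OF indep]\<close>)+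
  have "expectation (\<lambda>\<omega>. of_bool (P \<omega>) * of_bool (Q \<omega>) :: real) =
      expectation (\<lambda>\<omega>. of_bool (P \<omega>)) * expectation (\<lambda>\<omega>. of_bool (Q \<omega>))"
    using P_measurable Q_measurable
    by (intro expectation_mult_coord_algebra[OF indep blocks] integrable_of_bool) auto
  then show ?thesis by (simp add: expectation_of_bool flip: of_bool_conj)
qed

end

subsection \<open>Kolmogorov's maximal inequality\<close>

definition first_exceedance :: "(nat \<Rightarrow> 'a \<Rightarrow> real) \<Rightarrow> real \<Rightarrow> nat \<Rightarrow> nat \<Rightarrow> 'a \<Rightarrow> bool" where
  "first_exceedance Y w m k \<omega> \<longleftrightarrow>
    w \<le> \<bar>\<Sum>i\<in>{m<..k}. Y i \<omega>\<bar> \<and> (\<forall>j\<in>{m<..<k}. \<bar>\<Sum>i\<in>{m<..j}. Y i \<omega>\<bar> < w)"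

lemma first_exceedance_measurable:
  "Measurable.pred (coord_algebra M Y {m<..k}) (first_exceedance Y w m k)"
proof -
  have [measurable]: "(\<lambda>\<omega>. \<Sum>i\<in>{m<..j}. Y i \<omega>) \<in> borel_measurable (coord_algebra M Y {m<..k})"
    if "j \<le> k" for j
    using that by (intro borel_measurable_sum measurable_coord_algebra_component) auto
  show ?thesis unfolding first_exceedance_def by measurable
qed

lemma ex_first_exceedance:
  assumes "k \<in> {m<..n}" "w \<le> \<bar>\<Sum>i\<in>{m<..k}. Y i \<omega>\<bar>"
  shows "\<exists>k\<in>{m<..n}. first_exceedance Y w m k \<omega>"
proof -
  define k' where "k' = (LEAST k. m < k \<and> w \<le> \<bar>\<Sum>i\<in>{m<..k}. Y i \<omega>\<bar>)"
  have "m < k' \<and> w \<le> \<bar>\<Sum>i\<in>{m<..k'}. Y i \<omega>\<bar>"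
    unfolding k'_def by (rule LeastI[of _ k]) (use assms in auto)
  moreover have "k' \<le> k" unfolding k'_def by (rule Least_le) (use assms in auto)
  moreover have "\<bar>\<Sum>i\<in>{m<..j}. Y i \<omega>\<bar> < w" if "j \<in> {m<..<k'}" for j
    using not_less_Least[of j "\<lambda>k. m < k \<and> w \<le> \<bar>\<Sum>i\<in>{m<..k}. Y i \<omega>\<bar>"] that
    by (simp add: k'_def)
  ultimately show ?thesis
    using assms(1) by (intro bexI[of _ k']) (auto simp: first_exceedance_def)
qed

lemma sum_first_exceedance_le_1:
  "(\<Sum>k\<in>{m<..n}. of_bool (first_exceedance Y w m k \<omega>) :: real) \<le> 1"
proof (cases "\<exists>k\<in>{m<..n}. first_exceedance Y w m k \<omega>")
  case True
  then obtain k where first: "k \<in> {m<..n}" "first_exceedance Y w m k \<omega>" by blast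
  have "first_exceedance Y w m j \<omega> \<longleftrightarrow> j = k" if "j \<in> {m<..n}" for j
    using first that unfolding first_exceedance_def
    by (metis greaterThanAtMost_iff greaterThanLessThan_iff linorder_neqE_nat not_le)
  then have "(\<Sum>k\<in>{m<..n}. of_bool (first_exceedance Y w m k \<omega>) :: real)
      = (\<Sum>j\<in>{m<..n}. of_bool (j = k))"
    by (intro sum.cong refl) simp
  then show ?thesis using first by simp
qed simp

context prob_space begin

lemma
  fixes Y :: "'i \<Rightarrow> 'a \<Rightarrow> real"
  assumes "finite I" "indep_vars (\<lambda>_. borel) Y I"
    and "\<And>i. i \<in> I \<Longrightarrow> integrable M (\<lambda>\<omega>. (Y i \<omega>)\<^sup>2)" "\<And>i. i \<in> I \<Longrightarrow> expectation (Y i) = 0"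
  shows integrable_square_sum_indep: "integrable M (\<lambda>\<omega>. (\<Sum>i\<in>I. Y i \<omega>)\<^sup>2)" (is "?int I")
    and expectation_square_sum_indep:
      "expectation (\<lambda>\<omega>. (\<Sum>i\<in>I. Y i \<omega>)\<^sup>2) = (\<Sum>i\<in>I. expectation (\<lambda>\<omega>. (Y i \<omega>)\<^sup>2))" (is "?eq I")
proof -
  have "?int I \<and> ?eq I" using assms
  proof (induction I rule: finite_induct)
    case (insert k I)
    let ?S = "\<lambda>\<omega>. \<Sum>i\<in>I. Y i \<omega>"
    have hyp: "?int I" "?eq I"
      using insert.IH insert.prems by (auto intro: indep_vars_subset)
    have [measurable]: "Y i \<in> borel_measurable M" if "i \<in> insert k I" for i
      using insert.prems(1) that by (rule indep_vars_borel_measurable)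
    have "integrable M (Y k)" "integrable M ?S"
      by (rule square_integrable_imp_integrable; use insert.prems(2) hyp(1) in simp)+
    note cross = indep_vars_sum[OF insert.hyps insert.prems(1)] this
    have "integrable M (\<lambda>\<omega>. Y k \<omega> * ?S \<omega>)" "expectation (\<lambda>\<omega>. Y k \<omega> * ?S \<omega>) = 0"
      using indep_var_integrable[OF cross] indep_var_lebesgue_integral[OF cross] insert.prems(3)
      by simp_all
    then show ?case
      using insert.hyps hyp insert.prems(2) by (simp add: power2_sum mult.assoc)
  qed simp
  then show "?int I" "?eq I" by auto
qed

lemma expectation_square_le_add_indep:
  fixes S R :: "'a \<Rightarrow> real"
  assumes indep: "indep_vars (\<lambda>_. borel) X K" "I \<inter> J = {}" "I \<subseteq> K" "J \<subseteq> K"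
    and P_measurable: "Measurable.pred (coord_algebra M X I) P"
    and S_moments: "S \<in> borel_measurable (coord_algebra M X I)" "integrable M (\<lambda>\<omega>. (S \<omega>)\<^sup>2)"
    and R_moments: "R \<in> borel_measurable (coord_algebra M X J)" "integrable M (\<lambda>\<omega>. (R \<omega>)\<^sup>2)"
    and centred: "expectation R = 0"
  shows "expectation (\<lambda>\<omega>. of_bool (P \<omega>) * (S \<omega>)\<^sup>2)
      \<le> expectation (\<lambda>\<omega>. of_bool (P \<omega>) * (S \<omega> + R \<omega>)\<^sup>2)"
proof -
  have events [measurable]: "Measurable.pred M P" "S \<in> borel_measurable M" "R \<in> borel_measurable M"
    by (rule measurable_coord_algebraD[OF _ P_measurable]
        measurable_coord_algebraD[OF _ S_moments(1)]
        measurable_coord_algebraD[OF _ R_moments(1)];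
        use indep in \<open>auto intro: indep_vars_borel_measurable[OF indep(1)]\<close>)+
  have means: "integrable M S" "integrable M R"
    by (rule square_integrable_imp_integrable; use S_moments R_moments in simp)+
  have PS_measurable: "(\<lambda>\<omega>. of_bool (P \<omega>) * S \<omega>) \<in> borel_measurable (coord_algebra M X I)"
    using P_measurable S_moments(1) by measurable
  note cross = indep PS_measurable R_moments(1)
    integrable_of_bool_mult[OF events(1) means(1)] means(2)
  have cross_moments: "integrable M (\<lambda>\<omega>. of_bool (P \<omega>) * S \<omega> * R \<omega>)"
      "expectation (\<lambda>\<omega>. of_bool (P \<omega>) * S \<omega> * R \<omega>) = 0"
    using expectation_mult_coord_algebra[OF cross] integrable_mult_coord_algebra[OF cross] centred
    by simp_all
  note squares = integrable_of_bool_mult[OF events(1) S_moments(2)]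
    integrable_of_bool_mult[OF events(1) R_moments(2)]
  have "expectation (\<lambda>\<omega>. of_bool (P \<omega>) * (S \<omega>)\<^sup>2)
      \<le> expectation (\<lambda>\<omega>. of_bool (P \<omega>) * (S \<omega>)\<^sup>2) + expectation (\<lambda>\<omega>. of_bool (P \<omega>) * (R \<omega>)\<^sup>2)"
    by (simp add: Bochner_Integration.integral_nonneg)
  also have "\<dots> = expectation (\<lambda>\<omega>. of_bool (P \<omega>) * (S \<omega>)\<^sup>2
      + (2 * (of_bool (P \<omega>) * S \<omega> * R \<omega>) + of_bool (P \<omega>) * (R \<omega>)\<^sup>2))"
    using cross_moments squares by simp
  also have "(\<lambda>\<omega>. of_bool (P \<omega>) * (S \<omega>)\<^sup>2
      + (2 * (of_bool (P \<omega>) * S \<omega> * R \<omega>) + of_bool (P \<omega>) * (R \<omega>)\<^sup>2))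
      = (\<lambda>\<omega>. of_bool (P \<omega>) * (S \<omega> + R \<omega>)\<^sup>2)"
    by (simp add: fun_eq_iff power2_sum algebra_simps)
  finally show ?thesis .
qed

context
  fixes Y :: "nat \<Rightarrow> 'a \<Rightarrow> real" and m n :: nat
  assumes indep: "indep_vars (\<lambda>_. borel) Y {m<..n}"
    and square: "\<And>i. i \<in> {m<..n} \<Longrightarrow> integrable M (\<lambda>\<omega>. (Y i \<omega>)\<^sup>2)"
    and centred: "\<And>i. i \<in> {m<..n} \<Longrightarrow> expectation (Y i) = 0"
begin

lemma first_exceedance_measurable_M:
  "k \<in> {m<..n} \<Longrightarrow> Measurable.pred M (first_exceedance Y w m k)"
  by (rule measurable_coord_algebraD[OF _ first_exceedance_measurable])
    (use indep in \<open>auto intro: indep_vars_borel_measurable\<close>)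

lemma integrable_square_partial_sum: "I \<subseteq> {m<..n} \<Longrightarrow> integrable M (\<lambda>\<omega>. (\<Sum>i\<in>I. Y i \<omega>)\<^sup>2)"
  using square centred finite_subset[of I "{m<..n}"]
  by (intro integrable_square_sum_indep indep_vars_subset[OF indep]) auto

lemma prob_first_exceedance_le:
  assumes k_range: "k \<in> {m<..n}" and "w > 0"
  shows "w\<^sup>2 * \<P>(\<omega> in M. first_exceedance Y w m k \<omega>)
    \<le> expectation (\<lambda>\<omega>. of_bool (first_exceedance Y w m k \<omega>) * (\<Sum>i\<in>{m<..n}. Y i \<omega>)\<^sup>2)"
proof -
  note F_measurable = first_exceedance_measurable_M[OF k_range, of w]
  let ?F = "first_exceedance Y w m k"
  have [measurable]: "Y i \<in> borel_measurable M" if "i \<in> {m<..n}" for i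
    using indep that by (rule indep_vars_borel_measurable)
  have mean: "expectation (\<lambda>\<omega>. \<Sum>i\<in>{k<..n}. Y i \<omega>) = 0"
    using k_range centred square_integrable_imp_integrable[OF _ square]
    by (subst Bochner_Integration.integral_sum) auto
  have split: "(\<Sum>i\<in>{m<..n}. Y i \<omega>) = (\<Sum>i\<in>{m<..k}. Y i \<omega>) + (\<Sum>i\<in>{k<..n}. Y i \<omega>)" for \<omega>
    using k_range by (subst sum.union_disjoint[symmetric]) (auto intro!: sum.cong)
  have "w\<^sup>2 * \<P>(\<omega> in M. ?F \<omega>) = expectation (\<lambda>\<omega>. of_bool (?F \<omega>) * w\<^sup>2)"
    using F_measurable by (simp add: expectation_of_bool)
  also have "\<dots> \<le> expectation (\<lambda>\<omega>. of_bool (?F \<omega>) * (\<Sum>i\<in>{m<..k}. Y i \<omega>)\<^sup>2)"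
  proof (intro integral_mono integrable_of_bool_mult F_measurable integrable_square_partial_sum)
    show "of_bool (?F \<omega>) * w\<^sup>2 \<le> of_bool (?F \<omega>) * (\<Sum>i\<in>{m<..k}. Y i \<omega>)\<^sup>2" for \<omega>
      using \<open>w > 0\<close> by (auto simp: first_exceedance_def simp flip: abs_le_square_iff)
  qed (use k_range in auto)
  also have "\<dots> \<le> expectation (\<lambda>\<omega>. of_bool (?F \<omega>) * ((\<Sum>i\<in>{m<..k}. Y i \<omega>) + (\<Sum>i\<in>{k<..n}. Y i \<omega>))\<^sup>2)"
    using k_range
    by (intro expectation_square_le_add_indep[where I = "{m<..k}" and J = "{k<..n}", OF indep] mean
        first_exceedance_measurable integrable_square_partial_sum borel_measurable_sum
        measurable_coord_algebra_component) auto
  finally show ?thesis by (simp add: split)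
qed

theorem Kolmogorov_maximal_inequality:
  assumes "w > 0"
  shows "\<P>(\<omega> in M. \<exists>k\<in>{m<..n}. w \<le> \<bar>\<Sum>i\<in>{m<..k}. Y i \<omega>\<bar>)
    \<le> (\<Sum>i\<in>{m<..n}. expectation (\<lambda>\<omega>. (Y i \<omega>)\<^sup>2)) / w\<^sup>2"
proof -
  let ?F = "first_exceedance Y w m" and ?S = "\<lambda>\<omega>. \<Sum>i\<in>{m<..n}. Y i \<omega>"
  have [measurable]: "Y i \<in> borel_measurable M" "Measurable.pred M (?F i)" if "i \<in> {m<..n}" for i
    using indep_vars_borel_measurable[OF indep that] first_exceedance_measurable_M[OF that] by auto
  have integrable: "integrable M (\<lambda>\<omega>. of_bool (?F k \<omega>) * (?S \<omega>)\<^sup>2)" if "k \<in> {m<..n}" for k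
    using that by (intro integrable_of_bool_mult integrable_square_partial_sum) auto
  have "\<P>(\<omega> in M. \<exists>k\<in>{m<..n}. w \<le> \<bar>\<Sum>i\<in>{m<..k}. Y i \<omega>\<bar>)
      \<le> prob (\<Union>k\<in>{m<..n}. {\<omega> \<in> space M. ?F k \<omega>})"
    using ex_first_exceedance[of _ m n w Y] by (intro finite_measure_mono) (force, measurable)
  also have "\<dots> \<le> (\<Sum>k\<in>{m<..n}. \<P>(\<omega> in M. ?F k \<omega>))"
    by (intro finite_measure_subadditive_finite) auto
  finally have "w\<^sup>2 * \<P>(\<omega> in M. \<exists>k\<in>{m<..n}. w \<le> \<bar>\<Sum>i\<in>{m<..k}. Y i \<omega>\<bar>)
      \<le> (\<Sum>k\<in>{m<..n}. w\<^sup>2 * \<P>(\<omega> in M. ?F k \<omega>))"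
    unfolding sum_distrib_left[symmetric] by (intro mult_left_mono) auto
  also have "\<dots> \<le> (\<Sum>k\<in>{m<..n}. expectation (\<lambda>\<omega>. of_bool (?F k \<omega>) * (?S \<omega>)\<^sup>2))"
    using \<open>w > 0\<close> by (intro sum_mono prob_first_exceedance_le) auto
  also have "\<dots> = expectation (\<lambda>\<omega>. \<Sum>k\<in>{m<..n}. of_bool (?F k \<omega>) * (?S \<omega>)\<^sup>2)"
    by (rule Bochner_Integration.integral_sum[OF integrable, symmetric])
  also have "\<dots> \<le> expectation (\<lambda>\<omega>. (?S \<omega>)\<^sup>2)"
  proof (intro integral_mono Bochner_Integration.integrable_sum
        integrable integrable_square_partial_sum)
    show "(\<Sum>k\<in>{m<..n}. of_bool (?F k \<omega>) * (?S \<omega>)\<^sup>2) \<le> (?S \<omega>)\<^sup>2" for \<omega>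
      unfolding sum_distrib_right[symmetric]
      by (intro mult_left_le_one_le sum_nonneg sum_first_exceedance_le_1) auto
  qed auto
  also have "\<dots> = (\<Sum>i\<in>{m<..n}. expectation (\<lambda>\<omega>. (Y i \<omega>)\<^sup>2))"
    by (intro expectation_square_sum_indep indep square centred) auto
  finally show ?thesis using \<open>w > 0\<close> by (simp add: field_simps)
qed

end

end

subsection \<open>Exponential bounds for sums\<close>

text \<open>A sum of numbers \<open>z i \<le> c\<close> that exceeds \<open>c\<close> has at least two nonzero summands, and the product
  over the set of all nonzero summands is one of the terms on the right.\<close>
lemma exp_sum_le_sum_prod_card_ge_two:
  fixes z :: "'i \<Rightarrow> real"
  assumes "finite I" "0 \<le> c" "\<And>i. i \<in> I \<Longrightarrow> z i \<le> c" "(\<Sum>i\<in>I. z i) > c"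
  shows "exp (l * (\<Sum>i\<in>I. z i)) \<le> (\<Sum>S | S \<subseteq> I \<and> 2 \<le> card S. \<Prod>i\<in>S. exp (l * z i) * of_bool (z i \<noteq> 0))"
proof -
  define N where "N = {i \<in> I. z i \<noteq> 0}"
  have "finite N" "N \<subseteq> I" using \<open>finite I\<close> by (auto simp: N_def)
  have sum_N: "(\<Sum>i\<in>I. z i) = (\<Sum>i\<in>N. z i)"
    using \<open>finite I\<close> by (intro sum.mono_neutral_right) (auto simp: N_def)
  have "2 \<le> card N"
  proof (rule ccontr)
    assume "\<not> 2 \<le> card N"
    then have "card N = 0 \<or> card N = 1" by linarith
    then have "(\<Sum>i\<in>N. z i) \<le> c"
      using \<open>finite N\<close> \<open>N \<subseteq> I\<close> assms(2,3) by (auto simp: card_1_singleton_iff)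
    then show False using assms(4) sum_N by simp
  qed
  have "exp (l * (\<Sum>i\<in>I. z i)) = (\<Prod>i\<in>N. exp (l * z i) * of_bool (z i \<noteq> 0))"
    unfolding sum_N using \<open>finite N\<close> by (simp add: exp_sum sum_distrib_left N_def)
  also have "\<dots> \<le> (\<Sum>S | S \<subseteq> I \<and> 2 \<le> card S. \<Prod>i\<in>S. exp (l * z i) * of_bool (z i \<noteq> 0))"
    using \<open>2 \<le> card N\<close> \<open>N \<subseteq> I\<close> \<open>finite I\<close> by (intro member_le_sum) (auto intro!: prod_nonneg)
  finally show ?thesis .
qed

lemma of_bool_sum_gt_le_sum_prod_card_ge_two:
  fixes z :: "'i \<Rightarrow> real"
  assumes "finite I" "0 < l" "0 \<le> c" "\<And>i. i \<in> I \<Longrightarrow> z i \<le> c"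
  shows "of_bool (c < (\<Sum>i\<in>I. z i))
    \<le> exp (- l * c) * (\<Sum>S | S \<subseteq> I \<and> 2 \<le> card S. \<Prod>i\<in>S. exp (l * z i) * of_bool (z i \<noteq> 0))"
    (is "_ \<le> _ * ?sum")
proof (cases "c < (\<Sum>i\<in>I. z i)")
  case True
  then have "1 \<le> exp (- l * c) * exp (l * (\<Sum>i\<in>I. z i))"
    using \<open>0 < l\<close> by (simp flip: exp_add)
  also have "\<dots> \<le> exp (- l * c) * ?sum"
    using True assms by (intro mult_left_mono exp_sum_le_sum_prod_card_ge_two) auto
  finally show ?thesis using True by simp
next
  case False
  then show ?thesis by (auto intro!: mult_nonneg_nonneg sum_nonneg prod_nonneg)
qed

context prob_space begin

lemma prob_sum_gt_le_exp:
  fixes Y :: "'i \<Rightarrow> 'a \<Rightarrow> real"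
  assumes "finite I" and indep: "indep_vars (\<lambda>_. borel) Y I" and "0 < l"
    and integrable: "\<And>i. i \<in> I \<Longrightarrow> integrable M (\<lambda>\<omega>. exp (l * Y i \<omega>))"
    and mgf: "\<And>i. i \<in> I \<Longrightarrow> expectation (\<lambda>\<omega>. exp (l * Y i \<omega>)) \<le> exp (\<kappa> i)"
  shows "\<P>(\<omega> in M. (\<Sum>i\<in>I. Y i \<omega>) > z) \<le> exp (- l * z + (\<Sum>i\<in>I. \<kappa> i))"
proof -
  let ?S = "\<lambda>\<omega>. \<Sum>i\<in>I. Y i \<omega>"
  have exp_sum_eq: "exp (l * ?S \<omega>) = (\<Prod>i\<in>I. exp (l * Y i \<omega>))" for \<omega>
    using \<open>finite I\<close> by (simp add: exp_sum sum_distrib_left)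
  have [measurable]: "Y i \<in> borel_measurable M" if "i \<in> I" for i
    using indep that by (rule indep_vars_borel_measurable)
  have indep_exp: "indep_vars (\<lambda>_. borel) (\<lambda>i \<omega>. exp (l * Y i \<omega>)) I"
    by (rule indep_vars_compose2[OF indep]) auto
  have integrable_exp_sum: "integrable M (\<lambda>\<omega>. exp (l * ?S \<omega>))"
    unfolding exp_sum_eq by (rule indep_vars_integrable[OF \<open>finite I\<close> indep_exp integrable])
  then have set_integrable: "set_integrable M (space M) (\<lambda>\<omega>. exp (l * ?S \<omega>))"
    unfolding set_integrable_def by (intro integrable_mult_indicator) auto
  have "\<P>(\<omega> in M. ?S \<omega> > z) \<le> \<P>(\<omega> in M. ?S \<omega> \<ge> z)"
    by (intro finite_measure_mono) auto
  also have "\<dots> \<le> exp (- l * z) * expectation (\<lambda>\<omega>. exp (l * ?S \<omega>))"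
    using Chernoff_ineq_ge[OF \<open>0 < l\<close> set_integrable, of z]
    by (simp add: set_integral_space[OF integrable_exp_sum])
  also have "expectation (\<lambda>\<omega>. exp (l * ?S \<omega>)) = (\<Prod>i\<in>I. expectation (\<lambda>\<omega>. exp (l * Y i \<omega>)))"
    unfolding exp_sum_eq by (rule indep_vars_lebesgue_integral[OF \<open>finite I\<close> indep_exp integrable])
  also have "\<dots> \<le> (\<Prod>i\<in>I. exp (\<kappa> i))"
    by (intro prod_mono conjI mgf Bochner_Integration.integral_nonneg) auto
  also have "exp (- l * z) * \<dots> = exp (- l * z + (\<Sum>i\<in>I. \<kappa> i))"
    using exp_sum[OF \<open>finite I\<close>, of \<kappa>] by (simp only: exp_add)
  finally show ?thesis by simp
qed

lemma
  fixes e :: "'i \<Rightarrow> 'a \<Rightarrow> real"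
  assumes "finite I" and indep: "indep_vars (\<lambda>_. borel) e I"
    and nonneg: "\<And>i \<omega>. i \<in> I \<Longrightarrow> 0 \<le> e i \<omega>"
    and integrable: "\<And>i. i \<in> I \<Longrightarrow> integrable M (e i)"
    and moment: "\<And>i. i \<in> I \<Longrightarrow> expectation (e i) \<le> q"
    and "0 \<le> q" "real (card I) * q \<le> 1"
  shows integrable_sum_prod_card_ge_two:
      "integrable M (\<lambda>\<omega>. \<Sum>S | S \<subseteq> I \<and> 2 \<le> card S. \<Prod>i\<in>S. e i \<omega>)"
    and expectation_sum_prod_card_ge_two_le:
      "expectation (\<lambda>\<omega>. \<Sum>S | S \<subseteq> I \<and> 2 \<le> card S. \<Prod>i\<in>S. e i \<omega>) \<le> (real (card I) * q)\<^sup>2"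
proof -
  let ?Big = "{S. S \<subseteq> I \<and> 2 \<le> card S}"
  have prod: "integrable M (\<lambda>\<omega>. \<Prod>i\<in>S. e i \<omega>)" "expectation (\<lambda>\<omega>. \<Prod>i\<in>S. e i \<omega>) \<le> q ^ card S"
    if "S \<in> ?Big" for S
  proof -
    have "finite S" using that \<open>finite I\<close> by (auto intro: finite_subset)
    moreover have "indep_vars (\<lambda>_. borel) e S"
      using that by (auto intro: indep_vars_subset[OF indep])
    moreover have "integrable M (e i)" if "i \<in> S" for i using that \<open>S \<in> ?Big\<close> integrable by auto
    ultimately have S_indep: "finite S" "indep_vars (\<lambda>_. borel) e S"
      "\<And>i. i \<in> S \<Longrightarrow> integrable M (e i)"
      by auto
    show "integrable M (\<lambda>\<omega>. \<Prod>i\<in>S. e i \<omega>)" by (rule indep_vars_integrable[OF S_indep])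
    have "(\<Prod>i\<in>S. expectation (e i)) \<le> (\<Prod>i\<in>S. q)"
      using that moment nonneg
      by (intro prod_mono conjI Bochner_Integration.integral_nonneg) auto
    then show "expectation (\<lambda>\<omega>. \<Prod>i\<in>S. e i \<omega>) \<le> q ^ card S"
      using indep_vars_lebesgue_integral[OF S_indep] by simp
  qed
  show "integrable M (\<lambda>\<omega>. \<Sum>S\<in>?Big. \<Prod>i\<in>S. e i \<omega>)"
    by (intro Bochner_Integration.integrable_sum prod)
  have "expectation (\<lambda>\<omega>. \<Sum>S\<in>?Big. \<Prod>i\<in>S. e i \<omega>) = (\<Sum>S\<in>?Big. expectation (\<lambda>\<omega>. \<Prod>i\<in>S. e i \<omega>))"
    by (rule Bochner_Integration.integral_sum[OF prod(1)])
  also have "\<dots> \<le> (\<Sum>S\<in>?Big. q ^ card S)"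
    by (intro sum_mono prod)
  also have "\<dots> \<le> (real (card I) * q)\<^sup>2"
    using one_plus_power_le_quadratic[OF \<open>0 \<le> q\<close> \<open>real (card I) * q \<le> 1\<close>]
    by (simp add: sum_power_card_ge_two[OF \<open>finite I\<close>])
  finally show "expectation (\<lambda>\<omega>. \<Sum>S\<in>?Big. \<Prod>i\<in>S. e i \<omega>) \<le> (real (card I) * q)\<^sup>2" .
qed

lemma prob_sum_gt_le_quadratic:
  fixes Z :: "'i \<Rightarrow> 'a \<Rightarrow> real"
  assumes "finite I" and indep: "indep_vars (\<lambda>_. borel) Z I" and "0 < l" "0 \<le> c"
    and Z_le: "\<And>i \<omega>. i \<in> I \<Longrightarrow> Z i \<omega> \<le> c"
    and moment: "\<And>i. i \<in> I \<Longrightarrow> expectation (\<lambda>\<omega>. exp (l * Z i \<omega>) * of_bool (Z i \<omega> \<noteq> 0)) \<le> q"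
    and "0 \<le> q" "real (card I) * q \<le> 1"
  shows "\<P>(\<omega> in M. (\<Sum>i\<in>I. Z i \<omega>) > c) \<le> (real (card I) * q)\<^sup>2 * exp (- l * c)"
proof -
  define e where "e i \<omega> = exp (l * Z i \<omega>) * of_bool (Z i \<omega> \<noteq> 0)" for i \<omega>
  let ?sum = "\<lambda>\<omega>. \<Sum>S | S \<subseteq> I \<and> 2 \<le> card S. \<Prod>i\<in>S. e i \<omega>"
  have [measurable]: "Z i \<in> borel_measurable M" if "i \<in> I" for i
    using indep that by (rule indep_vars_borel_measurable)
  have "indep_vars (\<lambda>_. borel) e I"
    unfolding e_def by (rule indep_vars_compose2[OF indep]) auto
  moreover have "integrable M (e i)" if "i \<in> I" for i
    using that Z_le \<open>0 < l\<close> unfolding e_def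
    by (intro integrable_const_bound[where B = "exp (l * c)"]) auto
  moreover have "expectation (e i) \<le> q" if "i \<in> I" for i
    using moment[OF that] by (simp add: e_def[abs_def])
  moreover have "0 \<le> e i \<omega>" for i \<omega> by (simp add: e_def)
  ultimately have sum_moment: "integrable M ?sum" "expectation ?sum \<le> (real (card I) * q)\<^sup>2"
    using assms integrable_sum_prod_card_ge_two[of I e q]
      expectation_sum_prod_card_ge_two_le[of I e q]
    by simp_all
  have pointwise: "of_bool (c < (\<Sum>i\<in>I. Z i \<omega>)) \<le> exp (- l * c) * ?sum \<omega>" for \<omega>
    unfolding e_def using assms(1,3,4) Z_le by (rule of_bool_sum_gt_le_sum_prod_card_ge_two)
  have "\<P>(\<omega> in M. (\<Sum>i\<in>I. Z i \<omega>) > c) = expectation (\<lambda>\<omega>. of_bool ((\<Sum>i\<in>I. Z i \<omega>) > c))"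
    by (simp add: expectation_of_bool)
  also have "\<dots> \<le> expectation (\<lambda>\<omega>. exp (- l * c) * ?sum \<omega>)"
    by (intro integral_mono pointwise integrable_of_bool integrable_mult_right sum_moment) auto
  also have "\<dots> \<le> exp (- l * c) * (real (card I) * q)\<^sup>2"
    using sum_moment by simp
  finally show ?thesis by (simp add: mult.commute)
qed

end

subsection \<open>Truncated exponential moments\<close>

definition truncate_to :: "real set \<Rightarrow> real \<Rightarrow> real" where
  "truncate_to S z = z * indicator S z"

lemma truncate_to_measurable [measurable]: "S \<in> sets borel \<Longrightarrow> truncate_to S \<in> borel_measurable borel"
  unfolding truncate_to_def[abs_def]
  by (intro borel_measurable_times borel_measurable_indicator) auto

lemma truncate_to_in [simp]: "z \<in> S \<Longrightarrow> truncate_to S z = z"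
  by (simp add: truncate_to_def)

lemma truncate_to_notin [simp]: "z \<notin> S \<Longrightarrow> truncate_to S z = 0"
  by (simp add: truncate_to_def)

lemma truncate_to_nonneg: "S \<subseteq> {0..} \<Longrightarrow> 0 \<le> truncate_to S z"
  by (auto simp: truncate_to_def indicator_def)

lemma truncate_to_add: "z \<le> c \<Longrightarrow> truncate_to {..b} z + truncate_to {b<..c} z = z"
  by (auto simp: truncate_to_def indicator_def)

lemma exp_truncate_to_le:
  assumes "0 \<le> s" "s \<le> l" "0 < l" "0 \<le> b"
  shows "exp (s * truncate_to {..b} z)
      \<le> 1 + s * z + l\<^sup>2 * z\<^sup>2 + exp (l * z) * indicator {1 / l<..b} z"
proof -
  have square_le: "(s * z)\<^sup>2 \<le> l\<^sup>2 * z\<^sup>2"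
    using assms by (auto simp: power_mult_distrib intro!: mult_right_mono power_mono)
  consider (cut) "z > b" | (moderate) "z \<le> b" "z \<le> 1 / l" | (large) "z \<le> b" "1 / l < z"
    by linarith
  then show ?thesis
  proof cases
    case cut
    then show ?thesis using assms by simp
  next
    case moderate
    have "s * z \<le> 1"
    proof (cases "z \<ge> 0")
      case True
      then have "s * z \<le> l * z" using assms by (intro mult_right_mono) auto
      also have "\<dots> \<le> 1" using moderate assms by (simp add: field_simps)
      finally show ?thesis .
    next
      case False
      then show ?thesis using assms mult_nonneg_nonpos[of s z] by simp
    qed
    from exp_le_quadratic[OF this] moderate square_le show ?thesis by simp
  next
    case large
    have "0 < z" using large assms by (meson less_trans zero_less_divide_1_iff)
    have "exp (s * z) \<le> exp (l * z)" using assms \<open>0 < z\<close> by simp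
    moreover have "0 \<le> s * z" "0 \<le> l\<^sup>2 * z\<^sup>2" using assms \<open>0 < z\<close> by auto
    ultimately have "exp (s * z) \<le> 1 + s * z + l\<^sup>2 * z\<^sup>2 + exp (l * z)" by linarith
    then show ?thesis using large by simp
  qed
qed

context prob_space begin

definition exp_moment_on :: "real set \<Rightarrow> real \<Rightarrow> ('a \<Rightarrow> real) \<Rightarrow> real" where
  "exp_moment_on S l Y = expectation (\<lambda>\<omega>. exp (l * Y \<omega>) * indicator S (Y \<omega>))"

definition mgf_error :: "real \<Rightarrow> real \<Rightarrow> ('a \<Rightarrow> real) \<Rightarrow> real" where
  "mgf_error b l Y = l\<^sup>2 * expectation (\<lambda>\<omega>. (Y \<omega>)\<^sup>2) + exp_moment_on {1 / l<..b} l Y"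

lemma exp_moment_on_nonneg: "0 \<le> exp_moment_on S l Y"
  unfolding exp_moment_on_def by (intro Bochner_Integration.integral_nonneg) auto

lemma mgf_error_nonneg: "0 \<le> mgf_error b l Y"
  unfolding mgf_error_def
  by (intro add_nonneg_nonneg mult_nonneg_nonneg exp_moment_on_nonneg) auto

context
  fixes Y :: "'a \<Rightarrow> real"
  assumes Y_measurable [measurable]: "Y \<in> borel_measurable M"
begin

lemma integrable_exp_mult_indicator:
  assumes "0 \<le> l" and [measurable]: "S \<in> sets borel" and "S \<subseteq> {..b}"
  shows "integrable M (\<lambda>\<omega>. exp (l * Y \<omega>) * indicator S (Y \<omega>))"
  using assms
  by (intro integrable_const_bound[where B = "exp (l * b)"])
    (auto simp: indicator_def intro!: mult_left_mono AE_I2)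

lemma integrable_exp_truncate_to:
  assumes "0 \<le> s" "0 \<le> b"
  shows "integrable M (\<lambda>\<omega>. exp (s * truncate_to {..b} (Y \<omega>)))"
  using assms
  by (intro integrable_const_bound[where B = "exp (s * b)"])
    (auto simp: truncate_to_def indicator_def mult_left_mono)

lemma expectation_exp_truncate_to_le:
  assumes square: "integrable M (\<lambda>\<omega>. (Y \<omega>)\<^sup>2)" and "0 \<le> s" "s \<le> l" "0 < l" "0 \<le> b"
  shows "expectation (\<lambda>\<omega>. exp (s * truncate_to {..b} (Y \<omega>)))
      \<le> exp (s * expectation Y + mgf_error b l Y)"
proof -
  let ?bound = "\<lambda>\<omega>. 1 + s * Y \<omega> + l\<^sup>2 * (Y \<omega>)\<^sup>2 + exp (l * Y \<omega>) * indicator {1 / l<..b} (Y \<omega>)"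
  have integrable: "integrable M Y" "integrable M (\<lambda>\<omega>. exp (l * Y \<omega>) * indicator {1 / l<..b} (Y \<omega>))"
    using square_integrable_imp_integrable[OF Y_measurable square] \<open>0 < l\<close>
    by (auto intro!: integrable_exp_mult_indicator[where b = b])
  have "expectation (\<lambda>\<omega>. exp (s * truncate_to {..b} (Y \<omega>))) \<le> expectation ?bound"
    using assms integrable
    by (intro integral_mono integrable_exp_truncate_to exp_truncate_to_le) auto
  also have "\<dots> = 1 + (s * expectation Y + mgf_error b l Y)"
    using square integrable by (simp add: mgf_error_def exp_moment_on_def prob_space)
  also have "\<dots> \<le> exp (s * expectation Y + mgf_error b l Y)" by (rule exp_ge_add_one_self)
  finally show ?thesis .
qed

lemma exp_moment_on_le_sum:
  assumes "0 < l" "b \<le> c + real n / l"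
  shows "exp_moment_on {c<..b} l Y
    \<le> exp 1 * (\<Sum>i<n. exp (l * (c + real i / l)) * \<P>(\<omega> in M. Y \<omega> > c + real i / l))"
proof -
  let ?t = "\<lambda>i. c + real i / l"
  have pointwise: "exp (l * z) * indicator {c<..b} z
      \<le> (\<Sum>i<n. exp 1 * exp (l * ?t i) * of_bool (z > ?t i))" for z
  proof (cases "z \<in> {c<..b}")
    case True
    define i where "i = nat (\<lceil>l * (z - c)\<rceil> - 1)"
    have "0 < l * (z - c)" using True \<open>0 < l\<close> by simp
    then have i_bounds: "real i < l * (z - c)" "l * (z - c) \<le> real i + 1"
      unfolding i_def by linarith+
    have "l * (z - c) \<le> l * (real n / l)" using True assms by (intro mult_left_mono) auto
    then have "i < n" using i_bounds \<open>0 < l\<close> by simp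
    have "l * ?t i = l * c + real i" using \<open>0 < l\<close> by (simp add: distrib_left)
    then have "exp (l * z) \<le> exp (1 + l * ?t i)" using i_bounds by (simp add: algebra_simps)
    also have "\<dots> = exp 1 * exp (l * ?t i) * of_bool (z > ?t i)"
    proof -
      have "?t i < z" using i_bounds \<open>0 < l\<close> by (simp add: field_simps)
      then show ?thesis by (simp add: exp_add)
    qed
    also have "\<dots> \<le> (\<Sum>i<n. exp 1 * exp (l * ?t i) * of_bool (z > ?t i))"
      using \<open>i < n\<close> by (intro member_le_sum) auto
    finally show ?thesis using True by simp
  qed (auto intro!: sum_nonneg)
  have "exp_moment_on {c<..b} l Y
      \<le> expectation (\<lambda>\<omega>. \<Sum>i<n. exp 1 * exp (l * ?t i) * of_bool (Y \<omega> > ?t i))"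
    unfolding exp_moment_on_def using \<open>0 < l\<close>
    by (intro integral_mono pointwise integrable_exp_mult_indicator[where b = b]
        Bochner_Integration.integrable_sum integrable_mult_right integrable_of_bool) auto
  also have "\<dots> = exp 1 * (\<Sum>i<n. exp (l * ?t i) * \<P>(\<omega> in M. Y \<omega> > ?t i))"
    by (simp add: Bochner_Integration.integral_sum integrable_of_bool expectation_of_bool
        sum_distrib_left mult.assoc)
  finally show ?thesis .
qed

lemma exp_moment_on_le_const:
  assumes "0 < l" "c \<le> b" "0 \<le> r"
    and tail: "\<And>t. c \<le> t \<Longrightarrow> t \<le> b \<Longrightarrow> exp (l * t) * \<P>(\<omega> in M. Y \<omega> > t) \<le> r"
  shows "exp_moment_on {c<..b} l Y \<le> exp 1 * (l * (b - c) + 1) * r"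
proof -
  define n where "n = nat \<lceil>l * (b - c)\<rceil>"
  have "0 \<le> l * (b - c)" using assms by simp
  then have n_bounds: "real n \<le> l * (b - c) + 1" "l * (b - c) \<le> real n" unfolding n_def by linarith+
  have "exp_moment_on {c<..b} l Y
      \<le> exp 1 * (\<Sum>i<n. exp (l * (c + real i / l)) * \<P>(\<omega> in M. Y \<omega> > c + real i / l))"
    using n_bounds \<open>0 < l\<close> by (intro exp_moment_on_le_sum) (auto simp: field_simps)
  also have "\<dots> \<le> exp 1 * (\<Sum>i<n. r)"
  proof (intro mult_left_mono sum_mono tail)
    fix i assume "i \<in> {..<n}"
    then have "real i < l * (b - c)" unfolding n_def by simp linarith
    then show "c + real i / l \<le> b" using \<open>0 < l\<close> by (simp add: field_simps)
  qed (use \<open>0 < l\<close> in auto)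
  also have "\<dots> \<le> exp 1 * ((l * (b - c) + 1) * r)"
    using n_bounds \<open>0 \<le> r\<close> by (intro mult_left_mono) (auto intro: mult_right_mono)
  finally show ?thesis by (simp only: mult.assoc)
qed

text \<open>The factor \<open>b powr (t / (2 * b))\<close> is bounded for \<open>t\<close> up to order \<open>b / ln b\<close> and reaches \<open>sqrt b\<close>
  at \<open>t = b\<close>; the two terms of the bound come from these two regimes.\<close>
lemma exp_moment_on_le_tilted:
  assumes "0 < l" "1 \<le> b" "0 \<le> C"
    and tail: "\<And>t. 1 / l \<le> t \<Longrightarrow> t \<le> b \<Longrightarrow>
      exp (l * t) * \<P>(\<omega> in M. Y \<omega> > t) \<le> C * exp (t / b * (ln b / 2)) / t\<^sup>2"
  shows "exp_moment_on {1 / l<..b} l Y \<le> 18 * exp 1 * C * (l\<^sup>2 + l / sqrt b)"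
proof -
  define n where "n = nat \<lceil>l * b - 1\<rceil>"
  have "0 < l * b" using assms by simp
  then have n_bounds: "real n \<le> l * b" "l * b - 1 \<le> real n" unfolding n_def by linarith+
  have summand: "exp (l * (1 / l + real i / l)) * \<P>(\<omega> in M. Y \<omega> > 1 / l + real i / l)
      \<le> C * (9 * l\<^sup>2 * (1 / (real i + 1)\<^sup>2) + sqrt b / b\<^sup>2)" if "i < n" for i
  proof -
    define t where "t = 1 / l + real i / l"
    have t_eq: "t = (real i + 1) / l" by (simp add: t_def add_divide_distrib)
    have "real i < l * b - 1" using that unfolding n_def by linarith
    then have "0 < t" "1 / l \<le> t" "t \<le> b" using \<open>0 < l\<close> by (auto simp: t_eq field_simps)
    then have "exp (l * t) * \<P>(\<omega> in M. Y \<omega> > t) \<le> C * (exp (t / b * (ln b / 2)) / t\<^sup>2)"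
      using tail[of t] by simp
    also have "\<dots> \<le> C * (9 * (1 / t\<^sup>2) + sqrt b / b\<^sup>2)"
      using \<open>0 < t\<close> \<open>t \<le> b\<close> assms by (intro mult_left_mono exp_mult_half_ln_over_square_le) auto
    also have "1 / t\<^sup>2 = l\<^sup>2 * (1 / (real i + 1)\<^sup>2)"
      by (simp add: t_eq power_divide)
    finally show ?thesis by (simp add: t_def)
  qed
  have "exp_moment_on {1 / l<..b} l Y
      \<le> exp 1 * (\<Sum>i<n. C * (9 * l\<^sup>2 * (1 / (real i + 1)\<^sup>2) + sqrt b / b\<^sup>2))"
    using n_bounds \<open>0 < l\<close> summand
    by (intro order.trans[OF exp_moment_on_le_sum[where n = n]] mult_left_mono sum_mono)
      (auto simp: field_simps)
  also have "\<dots> = exp 1 * (C * (9 * l\<^sup>2 * (\<Sum>i<n. 1 / (real i + 1)\<^sup>2) + real n * (sqrt b / b\<^sup>2)))"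
    by (simp only: sum.distrib sum_constant card_lessThan flip: sum_distrib_left)
  also have "\<dots> \<le> exp 1 * (C * (9 * l\<^sup>2 * 2 + (l * b) * (sqrt b / b\<^sup>2)))"
    using n_bounds assms
    by (intro mult_left_mono add_mono mult_right_mono sum_inverse_squares_le) auto
  also have "(l * b) * (sqrt b / b\<^sup>2) = l / sqrt b"
    using \<open>1 \<le> b\<close> by (simp add: power2_eq_square field_simps)
  also have "exp 1 * (C * (9 * l\<^sup>2 * 2 + l / sqrt b))
      \<le> exp 1 * (C * (18 * l\<^sup>2 + 18 * (l / sqrt b)))"
    using mult_right_mono[of 1 18 "l / sqrt b"] assms by (intro mult_left_mono add_mono) auto
  finally show ?thesis by (simp add: algebra_simps)
qed

lemma mgf_error_le_tilted:
  assumes "0 < l" "0 < \<eta>" "0 < y" "1 \<le> \<eta> * y" "0 \<le> C"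
    and tail: "\<And>t. 1 / l \<le> t \<Longrightarrow> t \<le> \<eta> * y \<Longrightarrow>
      exp (l * t) * \<P>(\<omega> in M. Y \<omega> > t) \<le> C * exp (t / (\<eta> * y) * (ln (\<eta> * y) / 2)) / t\<^sup>2"
  shows "mgf_error (\<eta> * y) l Y
    \<le> (expectation (\<lambda>\<omega>. (Y \<omega>)\<^sup>2) + 18 * exp 1 * C * (1 + 1 / sqrt \<eta>)) * (l\<^sup>2 + l / sqrt y)"
    (is "_ \<le> (?m + ?k * (1 + ?s)) * (l\<^sup>2 + ?r)")
proof -
  have "exp_moment_on {1 / l<..\<eta> * y} l Y \<le> ?k * (l\<^sup>2 + l / sqrt (\<eta> * y))"
    by (rule exp_moment_on_le_tilted[OF assms(1,4,5) tail])
  also have "l / sqrt (\<eta> * y) = ?s * ?r" by (simp add: real_sqrt_mult)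
  finally have "mgf_error (\<eta> * y) l Y \<le> l\<^sup>2 * ?m + ?k * (l\<^sup>2 + ?s * ?r)"
    by (simp add: mgf_error_def)
  moreover have "0 \<le> ?m * ?r + ?k * ?r + ?k * ?s * l\<^sup>2"
    using assms by (intro add_nonneg_nonneg mult_nonneg_nonneg) auto
  moreover have "(m + k * (1 + s)) * (p + r)
      = p * m + k * (p + s * r) + (m * r + k * r + k * s * p)"
    for m k s p r :: real
    by (simp add: algebra_simps)
  ultimately show ?thesis by (simp only:)
qed

end

end

section \<open>Paths of the walk\<close>

definition positive_before :: "(nat \<Rightarrow> 'a \<Rightarrow> real) \<Rightarrow> nat \<Rightarrow> 'a \<Rightarrow> bool" where
  "positive_before X n \<omega> \<longleftrightarrow> (\<forall>i\<in>{1..<n}. rw_S X i \<omega> > 0)"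

definition hits_nonpositive :: "(nat \<Rightarrow> 'a \<Rightarrow> real) \<Rightarrow> 'a \<Rightarrow> bool" where
  "hits_nonpositive X \<omega> \<longleftrightarrow> (\<exists>n\<ge>1. rw_S X n \<omega> \<le> 0)"

lemma rw_S_0 [simp]: "rw_S X 0 \<omega> = 0"
  by (simp add: rw_S_def)

lemma rw_S_Suc: "rw_S X (Suc n) \<omega> = rw_S X n \<omega> + X (Suc n) \<omega>"
  by (simp add: rw_S_def)

lemma rw_S_eq_add: "k \<le> n \<Longrightarrow> rw_S X n \<omega> = rw_S X k \<omega> + (\<Sum>j\<in>{k<..n}. X j \<omega>)"
  unfolding rw_S_def by (subst sum.union_disjoint[symmetric]) (auto intro!: sum.cong)

lemma sum_rw_S: "(\<Sum>k<n. rw_S X k \<omega>) = (\<Sum>j\<in>{1..n}. (real n - real j) * X j \<omega>)"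
proof (induction n)
  case (Suc n)
  have "(\<Sum>k<Suc n. rw_S X k \<omega>) = (\<Sum>j\<in>{1..n}. (real n - real j) * X j \<omega>) + (\<Sum>j\<in>{1..n}. X j \<omega>)"
    using Suc by (simp add: rw_S_def)
  also have "\<dots> = (\<Sum>j\<in>{1..n}. (real (Suc n) - real j) * X j \<omega>)"
    unfolding sum.distrib[symmetric] by (intro sum.cong) (auto simp: algebra_simps)
  finally show ?case by simp
qed simp

lemma positive_before_Suc_0 [simp]: "positive_before X (Suc 0) \<omega>"
  by (simp add: positive_before_def)

lemma positive_before_rw_S_nonneg:
  "positive_before X n \<omega> \<Longrightarrow> i < n \<Longrightarrow> 0 \<le> rw_S X i \<omega>"
  by (cases "i = 0") (auto simp: positive_before_def intro: less_imp_le)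

lemma positive_before_iff_le_tau:
  assumes "hits_nonpositive X \<omega>"
  shows "positive_before X n \<omega> \<longleftrightarrow> n \<le> rw_tau X \<omega>"
proof -
  let ?hit = "\<lambda>n. 1 \<le> n \<and> rw_S X n \<omega> \<le> 0"
  have hit_tau: "?hit (rw_tau X \<omega>)"
    unfolding rw_tau_def
    by (rule LeastI_ex[of ?hit]) (use assms in \<open>simp add: hits_nonpositive_def\<close>)
  have tau_le: "rw_tau X \<omega> \<le> i" if "?hit i" for i
    unfolding rw_tau_def by (rule Least_le[of ?hit, OF that])
  show ?thesis
  proof
    assume "positive_before X n \<omega>"
    then show "n \<le> rw_tau X \<omega>"
      using hit_tau unfolding positive_before_def by (meson atLeastLessThan_iff not_le)
  next
    assume "n \<le> rw_tau X \<omega>"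
    then show "positive_before X n \<omega>"
      using tau_le unfolding positive_before_def by (fastforce simp: not_le[symmetric])
  qed
qed

lemma rw_A_eq: "hits_nonpositive X \<omega> \<Longrightarrow> rw_A X \<omega> = (\<Sum>k<rw_tau X \<omega>. rw_S X k \<omega>)"
  by (simp add: rw_A_def hits_nonpositive_def)

lemma rw_A_gt_hits: "rw_A X \<omega> > x \<Longrightarrow> 0 \<le> x \<Longrightarrow> hits_nonpositive X \<omega>"
  by (auto simp: rw_A_def hits_nonpositive_def split: if_splits)

lemma sum_rw_S_le_rw_A:
  assumes "hits_nonpositive X \<omega>" "positive_before X n \<omega>" "I \<subseteq> {..<n}"
  shows "(\<Sum>i\<in>I. rw_S X i \<omega>) \<le> rw_A X \<omega>"
proof -
  note le_tau = positive_before_iff_le_tau[OF assms(1)]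
  have "positive_before X (rw_tau X \<omega>) \<omega>" by (simp add: le_tau)
  moreover have "I \<subseteq> {..<rw_tau X \<omega>}" using assms(2,3) le_tau by auto
  ultimately show ?thesis
    unfolding rw_A_eq[OF assms(1)]
    by (intro sum_mono2) (auto intro: positive_before_rw_S_nonneg)
qed

definition stopped_sum :: "(nat \<Rightarrow> 'a \<Rightarrow> real) \<Rightarrow> (real \<Rightarrow> real) \<Rightarrow> nat \<Rightarrow> 'a \<Rightarrow> real" where
  "stopped_sum X f n \<omega> = (\<Sum>j\<in>{1..n}. of_bool (positive_before X j \<omega>) * f (X j \<omega>))"

text \<open>The walk is nonnegative until it stops, so its final value is at least that of its last step.\<close>
lemma stopped_sum_nonneg_or_ge_step:
  "0 \<le> stopped_sum X (\<lambda>z. z) n \<omega> \<or>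
    (\<exists>k\<in>{1..n}. positive_before X k \<omega> \<and> X k \<omega> \<le> stopped_sum X (\<lambda>z. z) n \<omega>)"
proof (induction n)
  case 0
  show ?case by (simp add: stopped_sum_def)
next
  case (Suc n)
  show ?case
  proof (cases "positive_before X (Suc n) \<omega>")
    case True
    then have "positive_before X j \<omega>" if "j \<in> {1..Suc n}" for j
      using that by (auto simp: positive_before_def)
    then have "stopped_sum X (\<lambda>z. z) (Suc n) \<omega> = rw_S X (Suc n) \<omega>"
      unfolding rw_S_def stopped_sum_def by (intro sum.cong refl) auto
    then have "X (Suc n) \<omega> \<le> stopped_sum X (\<lambda>z. z) (Suc n) \<omega>"
      using positive_before_rw_S_nonneg[OF True, of n] by (simp add: rw_S_Suc)
    then show ?thesis using True by (intro disjI2 bexI[of _ "Suc n"]) auto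
  next
    case False
    then have "stopped_sum X (\<lambda>z. z) (Suc n) \<omega> = stopped_sum X (\<lambda>z. z) n \<omega>"
      by (simp add: stopped_sum_def)
    then show ?thesis using Suc.IH by fastforce
  qed
qed

lemma stopped_sum_ge:
  assumes "c > 0"
  shows "- (c / 2 + stopped_sum X (\<lambda>z. z\<^sup>2) n \<omega> / (2 * c)) \<le> stopped_sum X (\<lambda>z. z) n \<omega>"
    (is "- (c / 2 + ?squares / (2 * c)) \<le> ?stopped")
proof -
  have "0 \<le> ?squares / (2 * c)"
    unfolding stopped_sum_def using assms by (intro divide_nonneg_pos sum_nonneg) auto
  consider (nonneg) "0 \<le> ?stopped"
    | (step) k where "k \<in> {1..n}" "positive_before X k \<omega>" "X k \<omega> \<le> ?stopped"
    using stopped_sum_nonneg_or_ge_step[where n = n and X = X and \<omega> = \<omega>] by blast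
  then show ?thesis
  proof cases
    case nonneg
    then show ?thesis using \<open>0 \<le> ?squares / (2 * c)\<close> assms by simp
  next
    case step
    have "(X k \<omega>)\<^sup>2 = of_bool (positive_before X k \<omega>) * (X k \<omega>)\<^sup>2" using step by simp
    also have "\<dots> \<le> ?squares"
      unfolding stopped_sum_def using step by (intro member_le_sum) auto
    finally have "(X k \<omega>)\<^sup>2 / (2 * c) \<le> ?squares / (2 * c)"
      using assms by (intro divide_right_mono) auto
    moreover have "- X k \<omega> \<le> (X k \<omega>)\<^sup>2 / (2 * c) + c / 2"
      using abs_le_square_div_plus[OF assms, of "X k \<omega>"] by linarith
    ultimately show ?thesis using step by linarith
  qed
qed

section \<open>Walks with independent identically distributed steps\<close>

locale iid_sequence = prob_space M for M :: "'a measure" +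
  fixes X :: "nat \<Rightarrow> 'a \<Rightarrow> real"
  assumes X_measurable [measurable]: "\<And>k. X k \<in> borel_measurable M"
    and X_indep: "indep_vars (\<lambda>_. borel) X {1..}"
    and X_ident: "\<And>k. k \<ge> 1 \<Longrightarrow> distr M borel (X k) = distr M borel (X 1)"
begin

lemma expectation_X_eq:
  fixes f :: "real \<Rightarrow> real"
  assumes "k \<ge> 1" and [measurable]: "f \<in> borel_measurable borel"
  shows "expectation (\<lambda>\<omega>. f (X k \<omega>)) = expectation (\<lambda>\<omega>. f (X 1 \<omega>))"
proof -
  have "expectation (\<lambda>\<omega>. f (X j \<omega>)) = integral\<^sup>L (distr M borel (X j)) f" for j
    by (rule integral_distr[symmetric]) measurable
  then show ?thesis by (simp only: X_ident[OF assms(1)])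
qed

lemma integrable_X_iff:
  fixes f :: "real \<Rightarrow> real"
  assumes "k \<ge> 1" and [measurable]: "f \<in> borel_measurable borel"
  shows "integrable M (\<lambda>\<omega>. f (X k \<omega>)) \<longleftrightarrow> integrable M (\<lambda>\<omega>. f (X 1 \<omega>))"
proof -
  have "integrable M (\<lambda>\<omega>. f (X j \<omega>)) = integrable (distr M borel (X j)) f" for j
    by (rule integrable_distr_eq[symmetric]) measurable
  then show ?thesis by (simp only: X_ident[OF assms(1)])
qed

lemma prob_X_gt: "k \<ge> 1 \<Longrightarrow> \<P>(\<omega> in M. X k \<omega> > b) = Fbar M X b"
  using expectation_X_eq[of k "\<lambda>z. of_bool (z > b)"]
  by (simp add: expectation_of_bool Fbar_def)

lemma Fbar_nonneg: "0 \<le> Fbar M X b"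
  by (simp add: Fbar_def)

lemma rw_S_measurable [measurable]: "rw_S X n \<in> borel_measurable M"
  unfolding rw_S_def by measurable

lemma rw_tau_measurable [measurable]: "rw_tau X \<in> measurable M (count_space UNIV)"
  unfolding rw_tau_def by measurable

lemma rw_A_measurable [measurable]: "rw_A X \<in> borel_measurable M"
proof -
  have [measurable]: "(\<lambda>\<omega>. \<Sum>k<rw_tau X \<omega>. rw_S X k \<omega>) \<in> borel_measurable M"
    by (rule measurable_compose_countable[where g = "rw_tau X"
          and f = "\<lambda>n \<omega>. \<Sum>k<n. rw_S X k \<omega>"]) measurable
  show ?thesis
    unfolding rw_A_def[abs_def] by measurable
qed

abbreviation area_tail :: "real \<Rightarrow> real" where
  "area_tail x \<equiv> \<P>(\<omega> in M. rw_A X \<omega> > x)"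

lemma positive_before_measurable_past:
  "Measurable.pred (coord_algebra M X {1..<n}) (positive_before X n)"
proof -
  have [measurable]: "rw_S X i \<in> borel_measurable (coord_algebra M X {1..<n})"
    if "i \<in> {1..<n}" for i
    unfolding rw_S_def using that
    by (intro borel_measurable_sum measurable_coord_algebra_component) auto
  show ?thesis
    unfolding positive_before_def by measurable
qed

lemma measurable_coord_algebra_X:
  "F \<in> measurable (coord_algebra M X I) N \<Longrightarrow> F \<in> measurable M N"
  by (rule measurable_coord_algebraD[OF X_measurable])

lemma positive_before_measurable [measurable]: "Measurable.pred M (positive_before X n)"
  by (rule measurable_coord_algebra_X[OF positive_before_measurable_past])

lemma
  fixes f :: "real \<Rightarrow> real"
  assumes "n \<ge> 1" and P_measurable: "Measurable.pred (coord_algebra M X {1..<n}) P"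
    and f_measurable [measurable]: "f \<in> borel_measurable borel"
    and integrable: "integrable M (\<lambda>\<omega>. f (X 1 \<omega>))"
  shows expectation_past_mult:
      "expectation (\<lambda>\<omega>. of_bool (P \<omega>) * f (X n \<omega>)) = \<P>(\<omega> in M. P \<omega>) * expectation (\<lambda>\<omega>. f (X 1 \<omega>))"
    and integrable_past_mult: "integrable M (\<lambda>\<omega>. of_bool (P \<omega>) * f (X n \<omega>))"
proof -
  have P_event: "Measurable.pred M P" by (rule measurable_coord_algebra_X[OF P_measurable])
  have "integrable M (\<lambda>\<omega>. f (X n \<omega>))"
    using integrable_X_iff[OF \<open>n \<ge> 1\<close> f_measurable] integrable by simp
  then show "integrable M (\<lambda>\<omega>. of_bool (P \<omega>) * f (X n \<omega>))"
    by (rule integrable_of_bool_mult[OF P_event])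
  have "(\<lambda>\<omega>. of_bool (P \<omega>) :: real) \<in> borel_measurable (coord_algebra M X {1..<n})"
    using P_measurable by measurable
  moreover have "(\<lambda>\<omega>. f (X n \<omega>)) \<in> borel_measurable (coord_algebra M X {n})"
    by (rule measurable_compose[OF measurable_coord_algebra_component f_measurable]) simp
  ultimately have "expectation (\<lambda>\<omega>. of_bool (P \<omega>) * f (X n \<omega>))
      = expectation (\<lambda>\<omega>. of_bool (P \<omega>)) * expectation (\<lambda>\<omega>. f (X n \<omega>))"
    using \<open>n \<ge> 1\<close> \<open>integrable M (\<lambda>\<omega>. f (X n \<omega>))\<close>
    by (intro expectation_mult_coord_algebra[OF X_indep] integrable_of_bool[OF P_event]) auto
  then show "expectation (\<lambda>\<omega>. of_bool (P \<omega>) * f (X n \<omega>))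
      = \<P>(\<omega> in M. P \<omega>) * expectation (\<lambda>\<omega>. f (X 1 \<omega>))"
    using expectation_X_eq[OF \<open>n \<ge> 1\<close> f_measurable] by (simp add: expectation_of_bool[OF P_event])
qed

definition survival :: "nat \<Rightarrow> real" where
  "survival n = \<P>(\<omega> in M. positive_before X n \<omega>)"

lemma survival_nonneg: "0 \<le> survival n"
  by (simp add: survival_def)

lemma survival_1: "survival 1 = 1"
  by (simp add: survival_def prob_space)

text \<open>Wald's identity: the sum of the survival probabilities is the mean of \<open>min n \<tau>\<close>.\<close>
lemma
  fixes f :: "real \<Rightarrow> real"
  assumes "f \<in> borel_measurable borel" "integrable M (\<lambda>\<omega>. f (X 1 \<omega>))"
  shows integrable_stopped_sum: "integrable M (stopped_sum X f n)"
    and expectation_stopped_sum: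
      "expectation (stopped_sum X f n) = (\<Sum>j\<in>{1..n}. survival j) * expectation (\<lambda>\<omega>. f (X 1 \<omega>))"
proof -
  note past = positive_before_measurable_past assms
  have integrable: "integrable M (\<lambda>\<omega>. of_bool (positive_before X j \<omega>) * f (X j \<omega>))"
    if "j \<in> {1..n}" for j
    using that by (intro integrable_past_mult[OF _ past]) auto
  then show "integrable M (stopped_sum X f n)"
    unfolding stopped_sum_def[abs_def] by (rule Bochner_Integration.integrable_sum)
  have "expectation (stopped_sum X f n)
      = (\<Sum>j\<in>{1..n}. expectation (\<lambda>\<omega>. of_bool (positive_before X j \<omega>) * f (X j \<omega>)))"
    unfolding stopped_sum_def[abs_def] by (rule Bochner_Integration.integral_sum[OF integrable])
  also have "\<dots> = (\<Sum>j\<in>{1..n}. survival j * expectation (\<lambda>\<omega>. f (X 1 \<omega>)))"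
    unfolding survival_def by (intro sum.cong refl expectation_past_mult[OF _ past]) auto
  finally show "expectation (stopped_sum X f n)
      = (\<Sum>j\<in>{1..n}. survival j) * expectation (\<lambda>\<omega>. f (X 1 \<omega>))"
    by (simp only: sum_distrib_right)
qed

lemma AE_hits_nonpositive:
  assumes "(\<lambda>n. survival (Suc n)) \<longlonglongrightarrow> 0"
  shows "AE \<omega> in M. hits_nonpositive X \<omega>"
proof -
  let ?never = "{\<omega> \<in> space M. \<not> hits_nonpositive X \<omega>}"
  have [measurable]: "Measurable.pred M (hits_nonpositive X)"
    unfolding hits_nonpositive_def by measurable
  have "positive_before X (Suc n) \<omega>" if "\<not> hits_nonpositive X \<omega>" for n \<omega>
    using that unfolding positive_before_def hits_nonpositive_def
    by (meson atLeastLessThan_iff not_le)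
  then have "prob ?never \<le> survival (Suc n)" for n
    unfolding survival_def by (intro finite_measure_mono) auto
  then have "prob ?never \<le> 0" by (intro LIMSEQ_le_const[OF assms]) auto
  then have "AE \<omega> in M. \<omega> \<notin> ?never"
    using measure_nonneg[of M ?never] by (subst prob_eq_0[symmetric]) auto
  with AE_space show ?thesis by eventually_elim auto
qed

lemma survival_sums_expectation_tau:
  assumes summable: "summable (\<lambda>n. survival (Suc n))"
  shows "(\<lambda>n. survival (Suc n)) sums expectation (\<lambda>\<omega>. real (rw_tau X \<omega>))"
proof -
  have hits: "AE \<omega> in M. hits_nonpositive X \<omega>"
    by (rule AE_hits_nonpositive[OF summable_LIMSEQ_zero[OF summable]])
  have emeasure_eq: "emeasure M {\<omega> \<in> space M. n < rw_tau X \<omega>} = ennreal (survival (Suc n))" for n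
    unfolding survival_def emeasure_eq_measure[symmetric]
  proof (rule emeasure_eq_AE)
    show "AE \<omega> in M. \<omega> \<in> {\<omega> \<in> space M. n < rw_tau X \<omega>}
        \<longleftrightarrow> \<omega> \<in> {\<omega> \<in> space M. positive_before X (Suc n) \<omega>}"
      using hits by eventually_elim (auto simp: positive_before_iff_le_tau)
  qed measurable
  have "(\<integral>\<^sup>+ \<omega>. ennreal (real (rw_tau X \<omega>)) \<partial>M) = (\<Sum>n. ennreal (survival (Suc n)))"
    using nn_integral_nat_function[OF rw_tau_measurable]
    by (simp add: emeasure_eq ennreal_of_nat_eq_real_of_nat)
  also have "\<dots> = ennreal (\<Sum>n. survival (Suc n))"
    by (intro suminf_ennreal2 survival_nonneg summable)
  finally have "expectation (\<lambda>\<omega>. real (rw_tau X \<omega>)) = (\<Sum>n. survival (Suc n))"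
    by (subst integral_eq_nn_integral) (auto simp: suminf_nonneg summable survival_nonneg)
  then show ?thesis using summable_sums[OF summable] by simp
qed

lemma prob_big_jump_before_hit_le:
  assumes summable: "summable (\<lambda>n. survival (Suc n))"
  shows "\<P>(\<omega> in M. \<exists>n\<ge>1. positive_before X n \<omega> \<and> X n \<omega> > b)
    \<le> expectation (\<lambda>\<omega>. real (rw_tau X \<omega>)) * Fbar M X b"
proof -
  let ?jump = "\<lambda>n. {\<omega> \<in> space M. positive_before X (Suc n) \<omega> \<and> X (Suc n) \<omega> > b}"
  have prob_jump: "prob (?jump n) = survival (Suc n) * Fbar M X b" for n
    unfolding survival_def prob_X_gt[of "Suc n" b, simplified, symmetric]
    by (intro prob_conj_coord_algebra[OF X_indep, where I = "{1..<Suc n}" and J = "{Suc n}"]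
        positive_before_measurable_past borel_measurable_pred_less
        measurable_coord_algebra_component) auto
  note sums = sums_mult2[OF survival_sums_expectation_tau[OF summable], of "Fbar M X b"]
  have "\<P>(\<omega> in M. \<exists>n\<ge>1. positive_before X n \<omega> \<and> X n \<omega> > b) \<le> prob (\<Union>n. ?jump n)"
  proof (intro finite_measure_mono subsetI)
    fix \<omega> assume "\<omega> \<in> {\<omega> \<in> space M. \<exists>n\<ge>1. positive_before X n \<omega> \<and> X n \<omega> > b}"
    then obtain n where "n \<ge> 1" "positive_before X n \<omega>" "X n \<omega> > b" "\<omega> \<in> space M" by auto
    then show "\<omega> \<in> (\<Union>n. ?jump n)" by (intro UN_I[of "n - 1"]) auto
  qed measurable
  also have "\<dots> \<le> (\<Sum>n. prob (?jump n))"
    using sums by (intro finite_measure_subadditive_countably) (auto simp: prob_jump sums_iff)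
  also have "\<dots> = expectation (\<lambda>\<omega>. real (rw_tau X \<omega>)) * Fbar M X b"
    using sums by (simp add: prob_jump sums_iff)
  finally show ?thesis .
qed

end

locale negative_drift_walk = iid_sequence M X for M :: "'a measure" and X +
  fixes a :: real
  assumes a_pos: "a > 0"
    and X_square_integrable: "integrable M (\<lambda>\<omega>. (X 1 \<omega>)\<^sup>2)"
    and X_mean: "expectation (X 1) = - a"
begin

definition second_moment :: real where
  "second_moment = expectation (\<lambda>\<omega>. (X 1 \<omega>)\<^sup>2)"

lemma integrable_X1: "integrable M (X 1)"
  by (rule square_integrable_imp_integrable[OF X_measurable X_square_integrable])

lemma second_moment_pos: "0 < second_moment"
proof -
  have "second_moment - a\<^sup>2 = variance (X 1)"
    using variance_eq[OF integrable_X1 X_square_integrable] X_mean by (simp add: second_moment_def)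
  then have "a\<^sup>2 \<le> second_moment" using variance_positive[of "X 1"] by linarith
  then show ?thesis using a_pos by (smt (verit) zero_less_power)
qed

lemma sum_survival_le: "(\<Sum>j\<in>{1..n}. survival j) \<le> second_moment / a\<^sup>2"
proof -
  let ?T = "\<Sum>j\<in>{1..n}. survival j"
  define c where "c = second_moment / a"
  have "c > 0" using second_moment_pos a_pos by (simp add: c_def)
  note Wald_X = integrable_stopped_sum[of "\<lambda>z. z" n] expectation_stopped_sum[of "\<lambda>z. z" n]
  note Wald_square = integrable_stopped_sum[of "\<lambda>z. z\<^sup>2" n] expectation_stopped_sum[of "\<lambda>z. z\<^sup>2" n]
  have "- (c / 2 + ?T * second_moment / (2 * c))
      = expectation (\<lambda>\<omega>. - (c / 2 + stopped_sum X (\<lambda>z. z\<^sup>2) n \<omega> / (2 * c)))"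
    using Wald_square X_square_integrable by (simp add: second_moment_def prob_space)
  also have "\<dots> \<le> expectation (stopped_sum X (\<lambda>z. z) n)"
    using Wald_X(1) Wald_square(1) integrable_X1 X_square_integrable
    by (intro integral_mono stopped_sum_ge \<open>c > 0\<close>) auto
  also have "\<dots> = - a * ?T"
    using Wald_X(2) integrable_X1 X_mean by simp
  finally have "a * ?T \<le> c / 2 + ?T * second_moment / (2 * c)" by simp
  also have "?T * second_moment / (2 * c) = a * ?T / 2"
    using second_moment_pos a_pos by (simp add: c_def)
  finally have "a * ?T \<le> c" by simp
  then show ?thesis
    using a_pos by (simp add: c_def field_simps power2_eq_square)
qed

definition mean_tau :: real where
  "mean_tau = expectation (\<lambda>\<omega>. real (rw_tau X \<omega>))"

lemma summable_survival: "summable (\<lambda>n. survival (Suc n))"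
proof (rule summableI_nonneg_bounded)
  show "(\<Sum>i<n. survival (Suc i)) \<le> second_moment / a\<^sup>2" for n
    using sum_survival_le[of n] by (simp add: sum.atLeast1_atMost_eq)
qed (rule survival_nonneg)

lemma AE_hits: "AE \<omega> in M. hits_nonpositive X \<omega>"
  by (rule AE_hits_nonpositive[OF summable_LIMSEQ_zero[OF summable_survival]])

lemma survival_sums: "(\<lambda>n. survival (Suc n)) sums mean_tau"
  unfolding mean_tau_def by (rule survival_sums_expectation_tau[OF summable_survival])

end

section \<open>Upper bound for the area\<close>

definition truncated_sum :: "(nat \<Rightarrow> 'a \<Rightarrow> real) \<Rightarrow> real set \<Rightarrow> nat \<Rightarrow> 'a \<Rightarrow> real" where
  "truncated_sum X S n \<omega> = (\<Sum>j\<in>{1..n}. truncate_to S (X j \<omega>))"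

definition truncated_area :: "(nat \<Rightarrow> 'a \<Rightarrow> real) \<Rightarrow> real set \<Rightarrow> nat \<Rightarrow> 'a \<Rightarrow> real" where
  "truncated_area X S n \<omega> = (\<Sum>j\<in>{1..n}. (real n - real j) * truncate_to S (X j \<omega>))"

lemma truncated_area_le:
  assumes "n \<le> n0" "S \<subseteq> {0..}"
  shows "truncated_area X S n \<omega> \<le> real n * truncated_sum X S n0 \<omega>"
proof -
  have "truncated_area X S n \<omega> \<le> (\<Sum>j\<in>{1..n}. real n * truncate_to S (X j \<omega>))"
    unfolding truncated_area_def
    by (intro sum_mono mult_right_mono truncate_to_nonneg assms) auto
  also have "\<dots> \<le> (\<Sum>j\<in>{1..n0}. real n * truncate_to S (X j \<omega>))"
    using assms by (intro sum_mono2 mult_nonneg_nonneg truncate_to_nonneg) auto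
  finally show ?thesis by (simp add: truncated_sum_def sum_distrib_left)
qed

lemma truncated_area_gt_of_short_excursion:
  assumes "x < rw_A X \<omega>" "hits_nonpositive X \<omega>" and tau: "rw_tau X \<omega> = n" "n \<le> n0"
    and le_c: "\<And>j. j \<in> {1..n} \<Longrightarrow> X j \<omega> \<le> c" and "0 \<le> b"
    and large_le: "truncated_sum X {b<..c} n0 \<omega> \<le> v"
  shows "x / real n - v < truncated_area X {..b} n \<omega> / real n"
proof -
  have "1 \<le> n" using positive_before_iff_le_tau[OF assms(2), of "Suc 0"] tau by simp
  have "x < (\<Sum>j\<in>{1..n}. (real n - real j) * X j \<omega>)"
    using assms(1) tau by (simp add: rw_A_eq[OF assms(2)] sum_rw_S)
  also have "\<dots> = truncated_area X {..b} n \<omega> + truncated_area X {b<..c} n \<omega>"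
    unfolding truncated_area_def sum.distrib[symmetric] distrib_left[symmetric]
    by (intro sum.cong refl) (use le_c in \<open>simp add: truncate_to_add\<close>)
  also have "truncated_area X {b<..c} n \<omega> \<le> real n * truncated_sum X {b<..c} n0 \<omega>"
    using tau \<open>0 \<le> b\<close> by (intro truncated_area_le) auto
  also have "real n * truncated_sum X {b<..c} n0 \<omega> \<le> real n * v"
    using large_le by (intro mult_left_mono) auto
  finally have "x / real n < (truncated_area X {..b} n \<omega> + real n * v) / real n"
    using \<open>1 \<le> n\<close> by (intro divide_strict_right_mono) auto
  then show ?thesis using \<open>1 \<le> n\<close> by (simp add: add_divide_distrib)
qed

lemma truncated_sum_gt_of_long_excursion:
  assumes "positive_before X (Suc n) \<omega>" "1 \<le> n" and le_c: "\<And>j. j \<in> {1..n} \<Longrightarrow> X j \<omega> \<le> c"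
    and large_le: "truncated_sum X {b<..c} n \<omega> \<le> v"
  shows "- v < truncated_sum X {..b} n \<omega>"
proof -
  have "0 < rw_S X n \<omega>" using assms(1,2) by (simp add: positive_before_def)
  also have "rw_S X n \<omega> = truncated_sum X {..b} n \<omega> + truncated_sum X {b<..c} n \<omega>"
    unfolding rw_S_def truncated_sum_def sum.distrib[symmetric]
    by (intro sum.cong refl) (use le_c in \<open>simp add: truncate_to_add\<close>)
  finally show ?thesis using large_le by simp
qed

lemma area_gt_cases:
  assumes "x < rw_A X \<omega>" "0 \<le> x" "1 \<le> n0" "0 \<le> b"
    and no_jump: "\<not> (\<exists>j\<ge>1. positive_before X j \<omega> \<and> X j \<omega> > c)"
    and large_le: "truncated_sum X {b<..c} n0 \<omega> \<le> v"
  shows "(\<exists>n\<in>{1..n0}. x / real n - v < truncated_area X {..b} n \<omega> / real n)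
    \<or> - v < truncated_sum X {..b} n0 \<omega>"
proof -
  have hits: "hits_nonpositive X \<omega>" by (rule rw_A_gt_hits[OF assms(1,2)])
  note le_tau = positive_before_iff_le_tau[OF hits]
  have le_c: "X j \<omega> \<le> c" if "j \<in> {1..rw_tau X \<omega>}" for j
    using no_jump that le_tau[of j] by (auto simp: not_less)
  show ?thesis
  proof (cases "rw_tau X \<omega> \<le> n0")
    case True
    have "rw_tau X \<omega> \<in> {1..n0}" using True le_tau[of "Suc 0"] by simp
    with truncated_area_gt_of_short_excursion[OF assms(1) hits refl True le_c \<open>0 \<le> b\<close> large_le]
    show ?thesis by blast
  next
    case False
    then have "positive_before X (Suc n0) \<omega>" by (simp add: le_tau)
    from truncated_sum_gt_of_long_excursion[OF this \<open>1 \<le> n0\<close> le_c large_le] False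
    show ?thesis by auto
  qed
qed

context iid_sequence begin

lemma truncated_sum_measurable [measurable]:
  assumes [measurable]: "S \<in> sets borel"
  shows "truncated_sum X S n \<in> borel_measurable M"
  unfolding truncated_sum_def by measurable

lemma truncated_area_measurable [measurable]:
  assumes [measurable]: "S \<in> sets borel"
  shows "truncated_area X S n \<in> borel_measurable M"
  unfolding truncated_area_def by measurable

lemma prob_truncated_sum_gt_le:
  assumes "0 \<le> b" "0 \<le> c" "0 < l" "real n * exp_moment_on {b<..c} l (X 1) \<le> 1"
  shows "\<P>(\<omega> in M. truncated_sum X {b<..c} n \<omega> > c)
    \<le> (real n * exp_moment_on {b<..c} l (X 1))\<^sup>2 * exp (- l * c)"
proof -
  let ?Z = "\<lambda>j \<omega>. truncate_to {b<..c} (X j \<omega>)"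
  have "indep_vars (\<lambda>_. borel) ?Z {1..n}"
    by (rule indep_vars_compose2[OF indep_vars_subset[OF X_indep]]) auto
  moreover have "expectation (\<lambda>\<omega>. exp (l * ?Z j \<omega>) * of_bool (?Z j \<omega> \<noteq> 0))
      \<le> exp_moment_on {b<..c} l (X 1)"
    if "j \<in> {1..n}" for j
  proof -
    have "exp (l * truncate_to {b<..c} z) * of_bool (truncate_to {b<..c} z \<noteq> 0)
        = exp (l * z) * indicator {b<..c} z" for z
      using \<open>0 \<le> b\<close> by (auto simp: truncate_to_def indicator_def)
    then show ?thesis
      using that expectation_X_eq[of j "\<lambda>z. exp (l * z) * indicator {b<..c} z"]
      by (simp add: exp_moment_on_def)
  qed
  moreover have "?Z j \<omega> \<le> c" for j \<omega>
    using \<open>0 \<le> c\<close> by (auto simp: truncate_to_def indicator_def)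
  ultimately show ?thesis
    using prob_sum_gt_le_quadratic[of "{1..n}" ?Z l c] assms exp_moment_on_nonneg
    by (simp add: truncated_sum_def)
qed

end

context negative_drift_walk begin

definition small_steps_bound :: "nat \<Rightarrow> real \<Rightarrow> real \<Rightarrow> real \<Rightarrow> real" where
  "small_steps_bound n b l u = exp (- l * u + a * l / 2 + real n * mgf_error b l (X 1))"

lemma prob_weighted_truncated_sum_gt_le:
  assumes w_bounds: "\<And>j. j \<in> {1..n} \<Longrightarrow> 0 \<le> w j \<and> w j \<le> 1" and "0 < l" "0 \<le> b"
  shows "\<P>(\<omega> in M. (\<Sum>j\<in>{1..n}. w j * truncate_to {..b} (X j \<omega>)) > z)
    \<le> exp (- l * z - a * l * (\<Sum>j\<in>{1..n}. w j) + real n * mgf_error b l (X 1))"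
proof -
  let ?Y = "\<lambda>j \<omega>. w j * truncate_to {..b} (X j \<omega>)"
  have "integrable M (\<lambda>\<omega>. exp (l * ?Y j \<omega>))"
    and "expectation (\<lambda>\<omega>. exp (l * ?Y j \<omega>)) \<le> exp (- a * (l * w j) + mgf_error b l (X 1))"
    if "j \<in> {1..n}" for j
  proof -
    have lw_bounds: "0 \<le> l * w j" "l * w j \<le> l"
      using w_bounds[OF that] \<open>0 < l\<close> by (auto intro: mult_left_le)
    show "integrable M (\<lambda>\<omega>. exp (l * ?Y j \<omega>))"
      using integrable_exp_truncate_to[OF X_measurable lw_bounds(1) \<open>0 \<le> b\<close>]
      by (simp add: mult.assoc)
    have "expectation (\<lambda>\<omega>. exp (l * ?Y j \<omega>))
        = expectation (\<lambda>\<omega>. exp (l * w j * truncate_to {..b} (X 1 \<omega>)))"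
      using that expectation_X_eq[of j "\<lambda>z. exp (l * w j * truncate_to {..b} z)"]
      by (simp add: mult.assoc)
    also have "\<dots> \<le> exp (l * w j * expectation (X 1) + mgf_error b l (X 1))"
      using lw_bounds \<open>0 < l\<close> \<open>0 \<le> b\<close>
      by (intro expectation_exp_truncate_to_le X_square_integrable) auto
    finally show "expectation (\<lambda>\<omega>. exp (l * ?Y j \<omega>)) \<le> exp (- a * (l * w j) + mgf_error b l (X 1))"
      using X_mean by (simp add: mult.commute)
  qed
  moreover have "indep_vars (\<lambda>_. borel) ?Y {1..n}"
    by (rule indep_vars_compose2[OF indep_vars_subset[OF X_indep]]) auto
  ultimately have "\<P>(\<omega> in M. (\<Sum>j\<in>{1..n}. ?Y j \<omega>) > z)
      \<le> exp (- l * z + (\<Sum>j\<in>{1..n}. - a * (l * w j) + mgf_error b l (X 1)))"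
    using \<open>0 < l\<close> by (intro prob_sum_gt_le_exp) auto
  also have "(\<Sum>j\<in>{1..n}. - a * (l * w j) + mgf_error b l (X 1))
      = - a * l * (\<Sum>j\<in>{1..n}. w j) + real n * mgf_error b l (X 1)"
    by (simp add: sum_subtractf sum_negf sum_distrib_left mult.assoc)
  finally show ?thesis by (simp add: algebra_simps)
qed

text \<open>The exponent of Chernoff's bound for an excursion of length \<open>n\<close> is
  \<open>- l * (y\<^sup>2 / (2 * a * n) + a * n / 2)\<close>, which is at most \<open>- l * y\<close> for every \<open>n\<close>.\<close>
lemma prob_short_excursion_le:
  assumes "0 < l" "0 \<le> b" and n_range: "n \<in> {1..n0}"
  shows "\<P>(\<omega> in M. truncated_area X {..b} n \<omega> / real n > y\<^sup>2 / (2 * a) / real n - v)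
    \<le> small_steps_bound n0 b l (y - v)"
proof -
  have "(\<Sum>j\<in>{1..n}. real n - real j) = real n * (real n - 1) / 2"
    by (induction n) (simp_all add: algebra_simps sum_subtractf)
  then have weights: "(\<Sum>j\<in>{1..n}. (real n - real j) / real n) = (real n - 1) / 2"
    using n_range by (simp add: sum_divide_distrib[symmetric])
  let ?z = "y\<^sup>2 / (2 * a) / real n"
  have "\<P>(\<omega> in M. truncated_area X {..b} n \<omega> / real n > ?z - v)
      \<le> exp (- l * (?z - v) - a * l * ((real n - 1) / 2) + real n * mgf_error b l (X 1))"
    unfolding weights[symmetric] truncated_area_def sum_divide_distrib
      times_divide_eq_left[symmetric]
    using assms by (intro prob_weighted_truncated_sum_gt_le) auto
  also have "\<dots> \<le> small_steps_bound n0 b l (y - v)"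
  proof -
    have "y \<le> ?z + a * real n / 2"
      using abs_le_square_div_plus[of "a * real n" y] a_pos n_range by simp
    then have "l * y \<le> l * (?z + a * real n / 2)"
      using \<open>0 < l\<close> by (intro mult_left_mono) auto
    moreover have "real n * mgf_error b l (X 1) \<le> real n0 * mgf_error b l (X 1)"
      using n_range mgf_error_nonneg by (intro mult_right_mono) auto
    ultimately show ?thesis
      by (simp add: small_steps_bound_def algebra_simps add_divide_distrib diff_divide_distrib)
  qed
  finally show ?thesis .
qed

lemma prob_long_excursion_le:
  assumes "0 < l" "0 \<le> b" "0 \<le> y" "2 * y / a \<le> real n0"
  shows "\<P>(\<omega> in M. truncated_sum X {..b} n0 \<omega> > - v)
    \<le> small_steps_bound n0 b l (y - v)"
proof -
  have "\<P>(\<omega> in M. truncated_sum X {..b} n0 \<omega> > - v)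
      \<le> exp (- l * (- v) - a * l * real n0 + real n0 * mgf_error b l (X 1))"
    using prob_weighted_truncated_sum_gt_le[of n0 "\<lambda>_. 1" l b "- v"] assms
    by (simp add: truncated_sum_def)
  also have "\<dots> \<le> small_steps_bound n0 b l (y - v)"
  proof -
    have "l * (2 * y) \<le> l * (a * real n0)"
      using assms a_pos by (intro mult_left_mono) (auto simp: field_simps)
    moreover have "0 \<le> l * y" "0 \<le> a * l / 2" using assms a_pos by auto
    ultimately have "- l * (- v) - a * l * real n0 \<le> - l * (y - v) + a * l / 2"
      by (simp add: algebra_simps)
    then show ?thesis by (simp add: small_steps_bound_def)
  qed
  finally show ?thesis .
qed

theorem prob_area_le:
  assumes "0 < l" "0 \<le> b" "0 < y" and n0_ge: "2 * y / a \<le> real n0"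
  shows "area_tail (y\<^sup>2 / (2 * a)) \<le> mean_tau * Fbar M X c
    + \<P>(\<omega> in M. truncated_sum X {b<..c} n0 \<omega> > v)
    + (real n0 + 1) * small_steps_bound n0 b l (y - v)"
proof -
  let ?x = "y\<^sup>2 / (2 * a)"
  let ?jump = "{\<omega> \<in> space M. \<exists>j\<ge>1. positive_before X j \<omega> \<and> X j \<omega> > c}"
  let ?large = "{\<omega> \<in> space M. truncated_sum X {b<..c} n0 \<omega> > v}"
  let ?short = "\<lambda>n. {\<omega> \<in> space M. truncated_area X {..b} n \<omega> / real n > ?x / real n - v}"
  let ?long = "{\<omega> \<in> space M. truncated_sum X {..b} n0 \<omega> > - v}"
  have "0 \<le> ?x" using a_pos by simp
  have "0 < real n0" using n0_ge \<open>0 < y\<close> a_pos by (smt (verit) divide_pos_pos)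
  then have "1 \<le> n0" by simp
  have "area_tail ?x \<le> prob (?jump \<union> (?large \<union> ((\<Union>n\<in>{1..n0}. ?short n) \<union> ?long)))"
  proof (intro finite_measure_mono subsetI)
    fix \<omega> assume area_gt: "\<omega> \<in> {\<omega> \<in> space M. rw_A X \<omega> > ?x}"
    show "\<omega> \<in> ?jump \<union> (?large \<union> ((\<Union>n\<in>{1..n0}. ?short n) \<union> ?long))"
      using area_gt_cases[of ?x X \<omega> n0 b c v] area_gt \<open>0 \<le> ?x\<close> \<open>1 \<le> n0\<close> \<open>0 \<le> b\<close>
      by (auto simp: not_less)
  qed measurable
  also have "\<dots> \<le> prob ?jump + (prob ?large + (prob (\<Union>n\<in>{1..n0}. ?short n) + prob ?long))"
    by (intro order.trans[OF measure_Un_le] add_left_mono add_right_mono order_refl) measurable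
  also have "prob (\<Union>n\<in>{1..n0}. ?short n) \<le> (\<Sum>n\<in>{1..n0}. prob (?short n))"
    by (intro finite_measure_subadditive_finite) auto
  also have "\<dots> \<le> (\<Sum>n\<in>{1..n0}. small_steps_bound n0 b l (y - v))"
    by (intro sum_mono prob_short_excursion_le assms)
  finally show ?thesis
    using prob_big_jump_before_hit_le[OF summable_survival, of c]
      prob_long_excursion_le[of l b y n0 v] assms
    by (simp add: mean_tau_def algebra_simps)
qed

end

section \<open>Lower bound for the area\<close>

definition stays_above_drift :: "(nat \<Rightarrow> 'a \<Rightarrow> real) \<Rightarrow> real \<Rightarrow> real \<Rightarrow> nat \<Rightarrow> nat \<Rightarrow> 'a \<Rightarrow> bool" where
  "stays_above_drift X a w k n \<omega> \<longleftrightarrow> (\<forall>i\<in>{k<..n}. - w \<le> (\<Sum>j\<in>{k<..i}. X j \<omega> + a))"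

definition no_jump_before :: "(nat \<Rightarrow> 'a \<Rightarrow> real) \<Rightarrow> real \<Rightarrow> nat \<Rightarrow> 'a \<Rightarrow> bool" where
  "no_jump_before X h k \<omega> \<longleftrightarrow> positive_before X k \<omega> \<and> (\<forall>j\<in>{1..<k}. X j \<omega> \<le> h)"

lemma rw_S_ge_of_stays_above_drift:
  assumes "stays_above_drift X a w k n \<omega>" "0 \<le> w" "k + i \<le> n"
  shows "rw_S X k \<omega> - w - a * real i \<le> rw_S X (k + i) \<omega>"
proof -
  have "- w \<le> (\<Sum>j\<in>{k<..k + i}. X j \<omega> + a)"
    using assms by (cases "i = 0") (auto simp: stays_above_drift_def)
  also have "\<dots> = (\<Sum>j\<in>{k<..k + i}. X j \<omega>) + a * real i" by (simp add: sum.distrib)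
  finally show ?thesis using rw_S_eq_add[of k "k + i" X \<omega>] by simp
qed

lemma area_gt_of_jump:
  assumes "0 < a" "hits_nonpositive X \<omega>" "k \<ge> 1" "positive_before X k \<omega>" "X k \<omega> > y + 2 * w"
    and "0 < y" "0 < w"
    and drift: "stays_above_drift X a w k (k + m) \<omega>" "m = nat \<lfloor>(y + w) / a\<rfloor>"
  shows "rw_A X \<omega> > y\<^sup>2 / (2 * a)"
proof -
  have "real m \<le> (y + w) / a" unfolding drift(2) using assms by simp
  have "0 \<le> rw_S X (k - 1) \<omega>"
    using positive_before_rw_S_nonneg[OF assms(4), of "k - 1"] \<open>k \<ge> 1\<close> by simp
  then have "rw_S X k \<omega> > y + 2 * w"
    using rw_S_Suc[of X "k - 1" \<omega>] assms(3,5) by simp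
  then have above_line: "rw_S X (k + i) \<omega> > y + w - a * real i" if "i \<le> m" for i
    using rw_S_ge_of_stays_above_drift[OF drift(1), of i] that \<open>0 < w\<close> by simp
  have "rw_S X i \<omega> > 0" if "i \<in> {k..k + m}" for i
  proof -
    have "i - k \<le> m" "k + (i - k) = i" using that by auto
    then have "a * real (i - k) \<le> a * ((y + w) / a)"
      using \<open>real m \<le> (y + w) / a\<close> \<open>0 < a\<close> by (intro mult_left_mono) auto
    then have "a * real (i - k) \<le> y + w" using \<open>0 < a\<close> by simp
    then show ?thesis using above_line[OF \<open>i - k \<le> m\<close>] \<open>k + (i - k) = i\<close> by simp
  qed
  then have positive: "positive_before X (Suc (k + m)) \<omega>"
    using assms(4) unfolding positive_before_def
    by (metis atLeastAtMost_iff atLeastLessThan_iff less_Suc_eq_le not_le)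
  have "y\<^sup>2 / (2 * a) < (y + w)\<^sup>2 / (2 * a)"
    using assms by (intro divide_strict_right_mono power_strict_mono) auto
  also have "\<dots> \<le> (\<Sum>i\<le>m. y + w - a * real i)"
    unfolding drift(2) using assms by (intro triangle_area_le_sum) auto
  also have "\<dots> \<le> (\<Sum>i\<le>m. rw_S X (k + i) \<omega>)"
    by (intro sum_mono order.strict_implies_order[OF above_line]) auto
  also have "\<dots> = (\<Sum>i\<in>(+) k ` {..m}. rw_S X i \<omega>)"
    by (simp add: sum.reindex inj_on_def del: image_add_atMost)
  also have "\<dots> \<le> rw_A X \<omega>"
    by (intro sum_rw_S_le_rw_A[OF assms(2) positive]) auto
  finally show ?thesis .
qed

context iid_sequence begin

lemma no_jump_before_measurable_past:
  "Measurable.pred (coord_algebra M X {1..<k}) (no_jump_before X h k)"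
proof -
  have [measurable]: "X j \<in> borel_measurable (coord_algebra M X {1..<k})" if "j \<in> {1..<k}" for j
    by (rule measurable_coord_algebra_component[OF that])
  note [measurable] = positive_before_measurable_past[of k]
  show ?thesis unfolding no_jump_before_def by measurable
qed

lemma no_jump_before_measurable [measurable]: "Measurable.pred M (no_jump_before X h k)"
  by (rule measurable_coord_algebra_X[OF no_jump_before_measurable_past])

lemma stays_above_drift_measurable_future:
  "Measurable.pred (coord_algebra M X {k<..n}) (stays_above_drift X a w k n)"
proof -
  have [measurable]: "(\<lambda>\<omega>. \<Sum>j\<in>{k<..i}. X j \<omega> + a) \<in> borel_measurable (coord_algebra M X {k<..n})"
    if "i \<in> {k<..n}" for i
    using that by (intro borel_measurable_sum borel_measurable_add borel_measurable_const
        measurable_coord_algebra_component) auto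
  show ?thesis unfolding stays_above_drift_def by measurable
qed

lemma stays_above_drift_measurable [measurable]: "Measurable.pred M (stays_above_drift X a w k n)"
  by (rule measurable_coord_algebra_X[OF stays_above_drift_measurable_future])

lemma prob_no_jump_before_ge:
  "survival k - real k * Fbar M X h \<le> \<P>(\<omega> in M. no_jump_before X h k \<omega>)"
proof -
  have "survival k
      \<le> prob ({\<omega> \<in> space M. no_jump_before X h k \<omega>} \<union> (\<Union>j\<in>{1..<k}. {\<omega> \<in> space M. X j \<omega> > h}))"
    unfolding survival_def by (intro finite_measure_mono) (auto simp: no_jump_before_def not_le)
  also have "\<dots> \<le> \<P>(\<omega> in M. no_jump_before X h k \<omega>) + prob (\<Union>j\<in>{1..<k}. {\<omega> \<in> space M. X j \<omega> > h})"
    by (intro measure_Un_le) measurable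
  also have "prob (\<Union>j\<in>{1..<k}. {\<omega> \<in> space M. X j \<omega> > h}) \<le> (\<Sum>j\<in>{1..<k}. \<P>(\<omega> in M. X j \<omega> > h))"
    by (intro finite_measure_subadditive_finite) auto
  also have "\<dots> = real (k - 1) * Fbar M X h"
    by (simp add: prob_X_gt)
  also have "\<dots> \<le> real k * Fbar M X h"
    by (intro mult_right_mono Fbar_nonneg) auto
  finally show ?thesis by simp
qed

lemma prob_first_jump_eq:
  assumes "k \<ge> 1"
  shows "\<P>(\<omega> in M. no_jump_before X h k \<omega> \<and> X k \<omega> > h \<and> stays_above_drift X a w k n \<omega>)
    = \<P>(\<omega> in M. no_jump_before X h k \<omega>) * (Fbar M X h * \<P>(\<omega> in M. stays_above_drift X a w k n \<omega>))"
proof -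
  have jump: "Measurable.pred (coord_algebra M X {k}) (\<lambda>\<omega>. X k \<omega> > h)"
    using measurable_coord_algebra_component[of k "{k}" X M] by measurable
  have "\<P>(\<omega> in M. X k \<omega> > h \<and> stays_above_drift X a w k n \<omega>)
      = Fbar M X h * \<P>(\<omega> in M. stays_above_drift X a w k n \<omega>)"
    using assms prob_X_gt[of k h]
    by (subst prob_conj_coord_algebra[OF X_indep _ _ _ jump
        stays_above_drift_measurable_future]) auto
  moreover have "Measurable.pred (coord_algebra M X {k..})
      (\<lambda>\<omega>. X k \<omega> > h \<and> stays_above_drift X a w k n \<omega>)"
  proof -
    have [measurable]: "Measurable.pred (coord_algebra M X {k..}) (\<lambda>\<omega>. X k \<omega> > h)"
      "Measurable.pred (coord_algebra M X {k..}) (stays_above_drift X a w k n)"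
      by (rule measurable_coord_algebra_mono[OF jump]
          measurable_coord_algebra_mono[OF stays_above_drift_measurable_future]; auto)+
    show ?thesis by measurable
  qed
  then have "\<P>(\<omega> in M. no_jump_before X h k \<omega> \<and> X k \<omega> > h \<and> stays_above_drift X a w k n \<omega>)
      = \<P>(\<omega> in M. no_jump_before X h k \<omega>) * \<P>(\<omega> in M. X k \<omega> > h \<and> stays_above_drift X a w k n \<omega>)"
    using assms by (intro prob_conj_coord_algebra[OF X_indep _ _ _
        no_jump_before_measurable_past]) auto
  ultimately show ?thesis by simp
qed

end

context negative_drift_walk begin

lemma prob_stays_above_drift_ge:
  assumes "w > 0"
  shows "1 - real m * second_moment / w\<^sup>2 \<le> \<P>(\<omega> in M. stays_above_drift X a w k (k + m) \<omega>)"
proof -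
  let ?Y = "\<lambda>i \<omega>. X i \<omega> + a"
  have moments: "integrable M (\<lambda>\<omega>. (?Y i \<omega>)\<^sup>2)" "expectation (?Y i) = 0"
    "expectation (\<lambda>\<omega>. (?Y i \<omega>)\<^sup>2) \<le> second_moment" if "i \<in> {k<..k + m}" for i
  proof -
    have "i \<ge> 1" using that by simp
    note ident = expectation_X_eq[OF this, of "\<lambda>z. (z + a)\<^sup>2"]
      expectation_X_eq[OF this, of "\<lambda>z. z + a"]
      integrable_X_iff[OF this, of "\<lambda>z. (z + a)\<^sup>2"]
    have "expectation (\<lambda>\<omega>. (?Y 1 \<omega>)\<^sup>2) = second_moment - a\<^sup>2"
      using integrable_X1 X_square_integrable X_mean
      by (simp add: power2_sum prob_space second_moment_def) (simp add: power2_eq_square)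
    then show "expectation (\<lambda>\<omega>. (?Y i \<omega>)\<^sup>2) \<le> second_moment" using ident by simp
    show "integrable M (\<lambda>\<omega>. (?Y i \<omega>)\<^sup>2)" "expectation (?Y i) = 0"
      using ident integrable_X1 X_square_integrable X_mean by (simp_all add: power2_sum prob_space)
  qed
  have "\<P>(\<omega> in M. \<not> stays_above_drift X a w k (k + m) \<omega>)
      \<le> \<P>(\<omega> in M. \<exists>i\<in>{k<..k + m}. w \<le> \<bar>\<Sum>j\<in>{k<..i}. ?Y j \<omega>\<bar>)"
    by (intro finite_measure_mono) (force simp: stays_above_drift_def, measurable)
  also have "\<dots> \<le> (\<Sum>i\<in>{k<..k + m}. expectation (\<lambda>\<omega>. (?Y i \<omega>)\<^sup>2)) / w\<^sup>2"
  proof (intro Kolmogorov_maximal_inequality moments \<open>w > 0\<close>)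
    show "indep_vars (\<lambda>_. borel) ?Y {k<..k + m}"
      by (rule indep_vars_compose2[OF indep_vars_subset[OF X_indep]]) auto
  qed
  also have "\<dots> \<le> (\<Sum>i\<in>{k<..k + m}. second_moment) / w\<^sup>2"
    by (intro divide_right_mono sum_mono moments) auto
  finally have "\<P>(\<omega> in M. \<not> stays_above_drift X a w k (k + m) \<omega>) \<le> real m * second_moment / w\<^sup>2"
    by simp
  then show ?thesis by (simp add: prob_neg)
qed

lemma prob_first_jump_ge:
  assumes "0 < w" "1 \<le> k" "real m * second_moment / w\<^sup>2 \<le> \<rho>" "\<rho> \<le> 1"
  shows "Fbar M X h * (1 - \<rho>) * (survival k - real k * Fbar M X h)
    \<le> \<P>(\<omega> in M. no_jump_before X h k \<omega> \<and> X k \<omega> > h \<and> stays_above_drift X a w k (k + m) \<omega>)"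
proof -
  have "1 - \<rho> \<le> \<P>(\<omega> in M. stays_above_drift X a w k (k + m) \<omega>)"
    using prob_stays_above_drift_ge[OF \<open>0 < w\<close>, of m k] assms(3) by linarith
  then have "(survival k - real k * Fbar M X h) * (Fbar M X h * (1 - \<rho>))
      \<le> \<P>(\<omega> in M. no_jump_before X h k \<omega>)
        * (Fbar M X h * \<P>(\<omega> in M. stays_above_drift X a w k (k + m) \<omega>))"
    using assms(4) by (intro mult_mono prob_no_jump_before_ge mult_nonneg_nonneg Fbar_nonneg) auto
  then show ?thesis
    using prob_first_jump_eq[OF \<open>1 \<le> k\<close>, of h a w "k + m"] by (simp add: mult.commute)
qed

theorem prob_area_ge:
  assumes "0 < y" "0 < w"
    and fluctuations: "real (nat \<lfloor>(y + w) / a\<rfloor>) * second_moment / w\<^sup>2 \<le> \<rho>" "\<rho> \<le> 1"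
  shows "Fbar M X (y + 2 * w) * (1 - \<rho>) * (\<Sum>k\<in>{1..N}. survival k - real k * Fbar M X (y + 2 * w))
    \<le> area_tail (y\<^sup>2 / (2 * a))"
proof -
  define m where "m = nat \<lfloor>(y + w) / a\<rfloor>"
  let ?h = "y + 2 * w"
  define E where "E k = {\<omega> \<in> space M. no_jump_before X ?h k \<omega> \<and> X k \<omega> > ?h
    \<and> stays_above_drift X a w k (k + m) \<omega>}" for k
  have [measurable]: "E k \<in> events" for k unfolding E_def by measurable
  have "disjoint_family_on E {1..N}"
    unfolding disjoint_family_on_def
  proof (intro ballI impI)
    fix j k assume "j \<in> {1..N}" "k \<in> {1..N}" "j \<noteq> k"
    then have "j \<in> {1..<k} \<or> k \<in> {1..<j}" by auto
    then show "E j \<inter> E k = {}" unfolding E_def no_jump_before_def by fastforce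
  qed
  then have "(\<Sum>k\<in>{1..N}. prob (E k)) = prob (\<Union>k\<in>{1..N}. E k)"
    by (intro finite_measure_finite_Union[symmetric]) auto
  also have "\<dots> \<le> area_tail (y\<^sup>2 / (2 * a))"
  proof (rule finite_measure_mono_AE)
    show "AE \<omega> in M. \<omega> \<in> (\<Union>k\<in>{1..N}. E k) \<longrightarrow> \<omega> \<in> {\<omega> \<in> space M. rw_A X \<omega> > y\<^sup>2 / (2 * a)}"
      using AE_hits
    proof eventually_elim
      case (elim \<omega>)
      from area_gt_of_jump[OF a_pos elim _ _ _ assms(1,2) _ m_def]
      show ?case by (auto simp: E_def no_jump_before_def)
    qed
  qed measurable
  finally have "(\<Sum>k\<in>{1..N}. prob (E k)) \<le> area_tail (y\<^sup>2 / (2 * a))" .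
  moreover have "Fbar M X ?h * (1 - \<rho>) * (\<Sum>k\<in>{1..N}. survival k - real k * Fbar M X ?h)
      \<le> (\<Sum>k\<in>{1..N}. prob (E k))"
    unfolding sum_distrib_left E_def using assms
    by (intro sum_mono prob_first_jump_ge) (auto simp: m_def)
  ultimately show ?thesis by linarith
qed

end

section \<open>Subexponential tails\<close>

locale sublinear_exponent =
  fixes g :: "real \<Rightarrow> real"
  assumes g_ratio: "\<And>x y. 0 < x \<Longrightarrow> x \<le> y \<Longrightarrow> g y / y \<le> g x / x"
    and g_ratio_tendsto: "((\<lambda>x. g x / x) \<longlongrightarrow> 0) at_top"
begin

lemma g_nonneg:
  assumes "0 < x"
  shows "0 \<le> g x"
proof -
  have "0 \<le> g x / x"
  proof (rule tendsto_upperbound[OF g_ratio_tendsto])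
    show "\<forall>\<^sub>F y in at_top. g y / y \<le> g x / x"
      using eventually_ge_at_top[of x] by eventually_elim (use assms g_ratio in auto)
  qed simp
  then show ?thesis using assms by (simp add: zero_le_divide_iff)
qed

lemma g_mult_le: "0 < t \<Longrightarrow> t \<le> y \<Longrightarrow> g y * (t / y) \<le> g t"
  using g_ratio[of t y] by (simp add: field_simps)

lemma g_plus_one_mult_le:
  assumes "0 < t" "t \<le> y"
  shows "(g y + 1) / y * t \<le> g t + 1"
proof -
  have "(g y + 1) / y * t = g y * (t / y) + t / y" by (simp add: distrib_right add_divide_distrib)
  also have "\<dots> \<le> g t + 1" using assms by (intro add_mono g_mult_le) auto
  finally show ?thesis .
qed

lemma g_plus_two_ratio_tendsto_0: "((\<lambda>y. y * ((g y + 2) / y\<^sup>2)) \<longlongrightarrow> 0) at_top"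
proof (rule Lim_transform_eventually)
  show "((\<lambda>y. g y / y + 2 / y) \<longlongrightarrow> 0) at_top"
    by (rule tendsto_add_zero[OF g_ratio_tendsto]) real_asymp
  show "\<forall>\<^sub>F y in at_top. g y / y + 2 / y = y * ((g y + 2) / y\<^sup>2)"
    using eventually_gt_at_top[of 0] by eventually_elim (simp add: field_simps power2_eq_square)
qed

definition log_tilt :: "real \<Rightarrow> real \<Rightarrow> real \<Rightarrow> real" where
  "log_tilt m d y = m * (g y + d * ln y) / y"

lemma log_tilt_mult: "y \<noteq> 0 \<Longrightarrow> log_tilt m d y * y = m * (g y + d * ln y)"
  by (simp add: log_tilt_def)

lemma log_tilt_pos: "1 < y \<Longrightarrow> 0 < m \<Longrightarrow> 0 < d \<Longrightarrow> 0 < log_tilt m d y"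
  using g_nonneg[of y] by (simp add: log_tilt_def add_nonneg_pos)

lemma log_tilt_tendsto_0: "(log_tilt m d \<longlongrightarrow> 0) at_top"
proof -
  have "((\<lambda>y. m * (g y / y) + m * d * (ln y / y)) \<longlongrightarrow> m * 0 + m * d * 0) at_top"
    by (intro tendsto_add tendsto_mult tendsto_const g_ratio_tendsto) real_asymp
  then show ?thesis
    by (simp add: log_tilt_def[abs_def] add_divide_distrib distrib_left mult.assoc)
qed

text \<open>A tilt \<open>l\<close> of steps cut off at \<open>\<eta> * y\<close> may exceed the exponential rate \<open>g\<close> of the tail only by a
  term that the factor \<open>1 / t\<^sup>2\<close> of the tail can absorb.\<close>
definition admissible_tilt :: "real \<Rightarrow> (real \<Rightarrow> real) \<Rightarrow> bool" where
  "admissible_tilt \<eta> l \<longleftrightarrow> 0 < \<eta> \<and> (l \<longlongrightarrow> 0) at_top \<and> (\<forall>\<^sub>F y in at_top. 0 < l y) \<and>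
    (\<forall>\<^sub>F y in at_top. \<forall>t\<ge>1 / l y. t \<le> \<eta> * y \<longrightarrow> l y * t \<le> g t + t / (\<eta> * y) * (ln (\<eta> * y) / 2))"

definition log_rate :: "real \<Rightarrow> real" where
  "log_rate t = g t + 2 * ln t"

lemma exp_minus_log_rate: "0 < t \<Longrightarrow> exp (- log_rate t) = exp (- g t) / t\<^sup>2"
  by (simp add: log_rate_def exp_diff exp_minus exp_double inverse_eq_divide flip: exp_add)

lemma log_rate_at_top: "filterlim log_rate at_top at_top"
proof (rule filterlim_at_top_mono)
  show "filterlim (\<lambda>t::real. 2 * ln t) at_top at_top" by real_asymp
  show "\<forall>\<^sub>F t in at_top. 2 * ln t \<le> log_rate t"
    using eventually_gt_at_top[of 0] by eventually_elim (simp add: log_rate_def g_nonneg)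
qed

lemma log_rate_le_mult:
  assumes "exp 1 \<le> s" "s \<le> t"
  shows "log_rate t \<le> t / s * log_rate s"
proof -
  have "0 < s" using assms(1) exp_gt_zero less_le_trans by blast
  have "1 \<le> ln s" using assms(1) \<open>0 < s\<close> by (simp add: ln_ge_iff)
  have "1 \<le> t / s" using assms(2) \<open>0 < s\<close> by simp
  have "ln t = ln s + ln (t / s)" using assms \<open>0 < s\<close> by (simp add: ln_div)
  also have "\<dots> \<le> ln s + (t / s - 1)"
    using \<open>0 < s\<close> assms(2) by (intro add_left_mono ln_le_minus_one) auto
  also have "\<dots> \<le> ln s + (t / s - 1) * ln s"
    using \<open>1 \<le> ln s\<close> \<open>1 \<le> t / s\<close> by (simp add: mult_le_cancel_left1)
  also have "\<dots> = t / s * ln s" by (simp add: algebra_simps)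
  finally have "ln t \<le> t / s * ln s" .
  moreover have "g t \<le> t / s * g s"
    using g_ratio[of s t] \<open>0 < s\<close> assms(2) by (simp add: field_simps)
  ultimately have "g t + 2 * ln t \<le> t / s * g s + 2 * (t / s * ln s)" by linarith
  then show ?thesis by (simp add: log_rate_def distrib_left mult.left_commute)
qed

end

locale subexponential_walk = negative_drift_walk M X a + sublinear_exponent g
  for M :: "'a measure" and X a g +
  assumes tail: "(\<lambda>x. Fbar M X x) \<sim>[at_top] (\<lambda>x. exp (- g x) / x\<^sup>2)"
begin

lemma Fbar_bounds:
  "\<forall>\<^sub>F t in at_top. exp (- log_rate t) / 2 \<le> Fbar M X t \<and> Fbar M X t \<le> 2 * exp (- log_rate t)"
proof -
  have "\<forall>\<^sub>F t in at_top. norm (Fbar M X t) \<le> 2 * norm (exp (- g t) / t\<^sup>2)"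
    by (rule asymp_equiv_imp_eventually_le[OF tail]) simp
  moreover have "\<forall>\<^sub>F t in at_top. norm (Fbar M X t) \<ge> 1 / 2 * norm (exp (- g t) / t\<^sup>2)"
    by (rule asymp_equiv_imp_eventually_ge[OF tail]) simp
  ultimately show ?thesis
    using eventually_gt_at_top[of 0]
    by eventually_elim (simp add: exp_minus_log_rate Fbar_nonneg)
qed

lemma eventually_Fbar_pos: "\<forall>\<^sub>F t in at_top. 0 < Fbar M X t"
  using Fbar_bounds by eventually_elim (metis exp_gt_zero half_gt_zero less_le_trans)

lemma Fbar_tendsto_0: "((\<lambda>t. Fbar M X t) \<longlongrightarrow> 0) at_top"
proof (rule tendsto_sandwich[OF _ _ tendsto_const])
  show "\<forall>\<^sub>F t in at_top. 0 \<le> Fbar M X t" using Fbar_nonneg by simp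
  show "\<forall>\<^sub>F t in at_top. Fbar M X t \<le> 2 / t\<^sup>2"
    using Fbar_bounds eventually_gt_at_top[of 0]
  proof eventually_elim
    case (elim t)
    have "exp (- g t) / t\<^sup>2 \<le> 1 / t\<^sup>2"
      using g_nonneg[of t] elim by (intro divide_right_mono) auto
    then show ?case using elim by (simp add: exp_minus_log_rate)
  qed
  show "((\<lambda>t::real. 2 / t\<^sup>2) \<longlongrightarrow> 0) at_top" by real_asymp
qed

lemma eventually_exp_mult_Fbar_le:
  "\<forall>\<^sub>F t in at_top. \<forall>l e. l * t \<le> g t + e \<longrightarrow> exp (l * t) * Fbar M X t \<le> 2 * exp e / t\<^sup>2"
  using Fbar_bounds eventually_gt_at_top[of 0]
proof eventually_elim
  case (elim t)
  show ?case
  proof (intro allI impI)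
    fix l e assume "l * t \<le> g t + e"
    have "exp (l * t) * Fbar M X t \<le> exp (l * t) * (2 * (exp (- g t) / t\<^sup>2))"
      using elim by (intro mult_left_mono) (auto simp: exp_minus_log_rate)
    also have "\<dots> = 2 * exp (l * t - g t) / t\<^sup>2"
      by (simp add: exp_diff exp_minus field_simps)
    also have "\<dots> \<le> 2 * exp e / t\<^sup>2"
      using \<open>l * t \<le> g t + e\<close> by (intro divide_right_mono mult_left_mono) auto
    finally show "exp (l * t) * Fbar M X t \<le> 2 * exp e / t\<^sup>2" .
  qed
qed

lemma ln_Fbar_asymp: "(\<lambda>t. - ln (Fbar M X t)) \<sim>[at_top] log_rate"
  unfolding asymp_equiv_altdef
proof (rule landau_o.smallI)
  fix c :: real assume "c > 0"
  have "\<forall>\<^sub>F t in at_top. ln 2 / c \<le> log_rate t"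
    using log_rate_at_top by (simp add: filterlim_at_top)
  with Fbar_bounds
  show "\<forall>\<^sub>F t in at_top. norm (- ln (Fbar M X t) - log_rate t) \<le> c * norm (log_rate t)"
  proof eventually_elim
    case (elim t)
    have bounds: "exp (- log_rate t - ln 2) \<le> Fbar M X t" "Fbar M X t \<le> exp (ln 2 - log_rate t)"
      using elim by (simp_all add: exp_diff exp_minus field_simps)
    then have "0 < Fbar M X t" using exp_gt_zero less_le_trans by blast
    then have "- log_rate t - ln 2 \<le> ln (Fbar M X t)" "ln (Fbar M X t) \<le> ln 2 - log_rate t"
      using bounds by (simp_all add: ln_ge_iff) (metis exp_le_cancel_iff exp_ln)
    moreover have "ln 2 \<le> c * log_rate t" using elim \<open>c > 0\<close> by (simp add: field_simps)
    moreover have "c * log_rate t \<le> c * norm (log_rate t)" using \<open>c > 0\<close> by simp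
    ultimately show ?case by (simp add: abs_le_iff)
  qed
qed

section \<open>The upper bounds\<close>

definition max_length :: "real \<Rightarrow> nat" where
  "max_length y = nat \<lceil>2 * y / a\<rceil>"

lemma max_length_ge: "2 * y / a \<le> real (max_length y)"
  unfolding max_length_def by linarith

definition small_steps_total :: "real \<Rightarrow> real \<Rightarrow> real \<Rightarrow> real \<Rightarrow> real" where
  "small_steps_total b l v y =
    (real (max_length y) + 1) * small_steps_bound (max_length y) b l (y - v)"

lemma max_length_bigo: "(\<lambda>y. real (max_length y) + 1) \<in> O(\<lambda>y. y)"
proof (rule bigoI)
  show "\<forall>\<^sub>F y in at_top. norm (real (max_length y) + 1) \<le> (2 / a + 2) * norm y"
    using eventually_ge_at_top[of 1]
  proof eventually_elim
    case (elim y)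
    have "0 \<le> 2 * y / a" using elim a_pos by simp
    then have "real (max_length y) \<le> 2 * y / a + 1" unfolding max_length_def by linarith
    moreover have "(2 / a + 2) * y = 2 * y / a + 2 * y" by (simp add: algebra_simps)
    ultimately show ?case using elim by simp
  qed
qed

lemma mgf_error_bigo:
  assumes "admissible_tilt \<eta> l"
  shows "(\<lambda>y. mgf_error (\<eta> * y) (l y) (X 1)) \<in> O(\<lambda>y. (l y)\<^sup>2 + l y / sqrt y)"
proof -
  have l_props: "0 < \<eta>" "(l \<longlongrightarrow> 0) at_top" "\<forall>\<^sub>F y in at_top. 0 < l y"
    and tilt: "\<forall>\<^sub>F y in at_top. \<forall>t\<ge>1 / l y. t \<le> \<eta> * y \<longrightarrow>
      l y * t \<le> g t + t / (\<eta> * y) * (ln (\<eta> * y) / 2)"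
    using assms by (simp_all add: admissible_tilt_def)
  obtain t0 where exp_mult_Fbar_le: "\<And>t l e. t0 \<le> t \<Longrightarrow> l * t \<le> g t + e \<Longrightarrow>
      exp (l * t) * Fbar M X t \<le> 2 * exp e / t\<^sup>2"
    using eventually_exp_mult_Fbar_le unfolding eventually_at_top_linorder by blast
  have "\<forall>\<^sub>F y in at_top. l y < 1 / max t0 1"
    using l_props(2) by (intro order_tendstoD) auto
  moreover have "\<forall>\<^sub>F y in at_top. 1 \<le> \<eta> * y"
    using l_props(1) by real_asymp
  ultimately have "\<forall>\<^sub>F y in at_top. norm (mgf_error (\<eta> * y) (l y) (X 1))
      \<le> (second_moment + 18 * exp 1 * 2 * (1 + 1 / sqrt \<eta>)) * norm ((l y)\<^sup>2 + l y / sqrt y)"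
    using l_props(3) tilt eventually_gt_at_top[of 0]
  proof eventually_elim
    case (elim y)
    let ?b = "\<eta> * y"
    have "0 < max t0 1" by simp
    then have "max t0 1 < 1 / l y"
      using elim by (simp only: pos_less_divide_eq mult.commute)
    then have "t0 \<le> 1 / l y" by simp
    have "mgf_error ?b (l y) (X 1)
        \<le> (second_moment + 18 * exp 1 * 2 * (1 + 1 / sqrt \<eta>)) * ((l y)\<^sup>2 + l y / sqrt y)"
      unfolding second_moment_def
    proof (rule mgf_error_le_tilted[OF X_measurable])
      fix t assume "1 / l y \<le> t" "t \<le> ?b"
      then show "exp (l y * t) * \<P>(\<omega> in M. X 1 \<omega> > t) \<le> 2 * exp (t / ?b * (ln ?b / 2)) / t\<^sup>2"
        using elim \<open>t0 \<le> 1 / l y\<close> unfolding Fbar_def[symmetric] by (intro exp_mult_Fbar_le) auto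
    qed (use elim l_props(1) in auto)
    then show ?case using elim mgf_error_nonneg[of ?b "l y" "X 1"] by simp
  qed
  then show ?thesis by (rule bigoI)
qed

lemma max_length_mult_mgf_error_le:
  assumes "admissible_tilt \<eta> l"
  obtains B where "0 < B"
    "\<forall>\<^sub>F y in at_top. real (max_length y) * mgf_error (\<eta> * y) (l y) (X 1) \<le> B * ((l y)\<^sup>2 * y + 1)"
proof -
  have l_pos: "\<forall>\<^sub>F y in at_top. 0 < l y" using assms by (simp add: admissible_tilt_def)
  have "(\<lambda>y. (real (max_length y) + 1) * mgf_error (\<eta> * y) (l y) (X 1))
      \<in> O(\<lambda>y. y * ((l y)\<^sup>2 + l y / sqrt y))"
    by (intro landau_o.big.mult max_length_bigo mgf_error_bigo assms)
  then obtain B where "0 < B" and error: "\<forall>\<^sub>F y in at_top.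
      norm ((real (max_length y) + 1) * mgf_error (\<eta> * y) (l y) (X 1))
      \<le> B * norm (y * ((l y)\<^sup>2 + l y / sqrt y))"
    by (rule landau_o.bigE)
  have "\<forall>\<^sub>F y in at_top. real (max_length y) * mgf_error (\<eta> * y) (l y) (X 1)
      \<le> 2 * B * ((l y)\<^sup>2 * y + 1)"
    using error l_pos eventually_gt_at_top[of 0]
  proof eventually_elim
    case (elim y)
    have "real (max_length y) * mgf_error (\<eta> * y) (l y) (X 1)
        \<le> (real (max_length y) + 1) * mgf_error (\<eta> * y) (l y) (X 1)"
      by (intro mult_right_mono mgf_error_nonneg) auto
    also have "\<dots> \<le> B * (y * ((l y)\<^sup>2 + l y / sqrt y))"
      using elim mgf_error_nonneg[of "\<eta> * y" "l y" "X 1"] by simp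
    also have "y * ((l y)\<^sup>2 + l y / sqrt y) = (l y)\<^sup>2 * y + l y * (y / sqrt y)"
      by (simp add: algebra_simps)
    also have "y / sqrt y = sqrt y" using elim by (simp add: real_div_sqrt)
    also have "(l y)\<^sup>2 * y + l y * sqrt y \<le> (l y)\<^sup>2 * y + ((l y)\<^sup>2 * y + 1)"
      using elim by (intro add_left_mono mult_sqrt_le_square_mult) auto
    also have "B * \<dots> \<le> 2 * B * ((l y)\<^sup>2 * y + 1)" using \<open>0 < B\<close> by (simp add: algebra_simps)
    finally show ?case using \<open>0 < B\<close> by simp
  qed
  then show ?thesis using \<open>0 < B\<close> by (intro that[of "2 * B"]) auto
qed

lemma small_steps_bigo:
  assumes "admissible_tilt \<eta> l"
  obtains B where "0 < B"
    "(\<lambda>y. small_steps_total (\<eta> * y) (l y) (v y) y)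
      \<in> O(\<lambda>y. y * exp (- l y * (y - v y) + B * ((l y)\<^sup>2 * y)))"
proof -
  obtain B where "0 < B" and error:
    "\<forall>\<^sub>F y in at_top. real (max_length y) * mgf_error (\<eta> * y) (l y) (X 1) \<le> B * ((l y)\<^sup>2 * y + 1)"
    by (rule max_length_mult_mgf_error_le[OF assms])
  have "\<forall>\<^sub>F y in at_top. l y < 1"
    using assms by (intro order_tendstoD[of l 0]) (auto simp: admissible_tilt_def)
  with error have "\<forall>\<^sub>F y in at_top. norm (small_steps_bound (max_length y) (\<eta> * y) (l y) (y - v y))
      \<le> exp (a / 2 + B) * norm (exp (- l y * (y - v y) + B * ((l y)\<^sup>2 * y)))"
  proof eventually_elim
    case (elim y)
    have "a * l y / 2 \<le> a / 2" using elim a_pos by simp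
    then show ?case using elim by (simp add: small_steps_bound_def distrib_left flip: exp_add)
  qed
  then have "(\<lambda>y. small_steps_total (\<eta> * y) (l y) (v y) y)
      \<in> O(\<lambda>y. y * exp (- l y * (y - v y) + B * ((l y)\<^sup>2 * y)))"
    unfolding small_steps_total_def by (intro landau_o.big.mult max_length_bigo bigoI)
  with \<open>0 < B\<close> show ?thesis by (rule that)
qed

end

context sublinear_exponent begin

lemma admissible_tiltI:
  assumes "0 < \<eta>" "0 < m" "0 < d"
    and tilt: "\<forall>\<^sub>F y in at_top. \<forall>t>0. t \<le> \<eta> * y \<longrightarrow>
      m * (t / y) * g y + m * d * (t / y) * ln y \<le> g t + t / (\<eta> * y) * (ln (\<eta> * y) / 2)"
  shows "admissible_tilt \<eta> (log_tilt m d)"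
proof -
  let ?l = "log_tilt m d"
  have l_pos: "\<forall>\<^sub>F y in at_top. 0 < ?l y"
    using eventually_gt_at_top[of 1] by eventually_elim (use log_tilt_pos assms in simp)
  with tilt have "\<forall>\<^sub>F y in at_top. \<forall>t\<ge>1 / ?l y. t \<le> \<eta> * y \<longrightarrow>
      ?l y * t \<le> g t + t / (\<eta> * y) * (ln (\<eta> * y) / 2)"
  proof eventually_elim
    case (elim y)
    show ?case
    proof (intro allI impI)
      fix t assume t_range: "1 / ?l y \<le> t" "t \<le> \<eta> * y"
      then have "0 < t" using elim by (meson less_le_trans zero_less_divide_1_iff)
      moreover have "?l y * t = m * (t / y) * g y + m * d * (t / y) * ln y"
        by (simp add: log_tilt_def add_divide_distrib algebra_simps)
      ultimately show "?l y * t \<le> g t + t / (\<eta> * y) * (ln (\<eta> * y) / 2)"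
        using elim t_range by simp
    qed
  qed
  with l_pos log_tilt_tendsto_0 \<open>0 < \<eta>\<close> show ?thesis by (simp add: admissible_tilt_def)
qed

lemma admissible_tilt_1: "admissible_tilt 1 (log_tilt 1 (1 / 2))"
proof (rule admissible_tiltI)
  show "\<forall>\<^sub>F y in at_top. \<forall>t>0. t \<le> 1 * y \<longrightarrow>
      1 * (t / y) * g y + 1 * (1 / 2) * (t / y) * ln y \<le> g t + t / (1 * y) * (ln (1 * y) / 2)"
    using g_mult_le by (auto simp: mult.commute)
qed auto

end

locale subpower_exponent = sublinear_exponent g for g +
  fixes \<gamma> :: real
  assumes \<gamma>_less_1: "\<gamma> < 1"
    and g_power_ratio: "\<And>x y. 0 < x \<Longrightarrow> x \<le> y \<Longrightarrow> g y / y powr \<gamma> \<le> g x / x powr \<gamma>"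
begin

text \<open>Here \<open>g t \<ge> (t / y) powr \<gamma> * g y\<close>, which exceeds \<open>m * (t / y) * g y\<close> when \<open>t / y\<close> is small.\<close>
lemma mult_g_le_of_small_ratio:
  assumes "0 < m" "0 < t" "t \<le> \<eta> * y" "\<eta> \<le> 1" "0 < y" and small: "m * \<eta> powr (1 - \<gamma>) \<le> 1"
  shows "m * (t / y) * g y \<le> g t"
proof -
  have "t / y \<le> \<eta>" "t / y \<le> 1"
    using assms by (auto simp: field_simps intro: order.trans mult_right_mono)
  have "m * (t / y) powr (1 - \<gamma>) \<le> m * \<eta> powr (1 - \<gamma>)"
    using assms \<gamma>_less_1 \<open>t / y \<le> \<eta>\<close> by (intro mult_left_mono powr_mono2) auto
  then have "m * (t / y) powr (1 - \<gamma>) \<le> 1" using small by (rule order.trans)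
  then have "m * (t / y) powr (1 - \<gamma>) * (g y * (t / y) powr \<gamma>) \<le> 1 * (g y * (t / y) powr \<gamma>)"
    using assms by (intro mult_right_mono mult_nonneg_nonneg g_nonneg) auto
  moreover have "t / y = (t / y) powr (1 - \<gamma>) * (t / y) powr \<gamma>"
    using assms by (simp flip: powr_add)
  ultimately have "m * (t / y) * g y \<le> g y * (t / y) powr \<gamma>" by (simp add: mult_ac)
  also have "\<dots> \<le> g t"
    using g_power_ratio[of t y] assms \<open>t / y \<le> 1\<close> by (simp add: powr_divide field_simps)
  finally show ?thesis .
qed

lemma admissible_tilt_multiple:
  assumes "0 < m"
  obtains \<eta> where "\<eta> \<le> 1 / 2" "admissible_tilt \<eta> (log_tilt m 1)"
proof -
  have "\<forall>\<^sub>F \<eta> in at_right 0. m * \<eta> powr (1 - \<gamma>) \<le> 1"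
    using \<gamma>_less_1 by real_asymp
  moreover have "\<forall>\<^sub>F \<eta> in at_right 0. \<eta> * m \<le> 1 / 4" by real_asymp
  moreover have "\<forall>\<^sub>F \<eta> in at_right 0. \<eta> \<le> (1 / 2 :: real)" by real_asymp
  moreover have "\<forall>\<^sub>F \<eta> in at_right 0. 0 < (\<eta> :: real)" by (rule eventually_at_right_less)
  ultimately have "\<forall>\<^sub>F \<eta> in at_right 0. m * \<eta> powr (1 - \<gamma>) \<le> 1 \<and> \<eta> * m \<le> 1 / 4 \<and> \<eta> \<le> 1 / 2 \<and> 0 < \<eta>"
    by eventually_elim blast
  then obtain \<eta> where \<eta>_small: "m * \<eta> powr (1 - \<gamma>) \<le> 1" "\<eta> * m \<le> 1 / 4" "\<eta> \<le> 1 / 2" "0 < \<eta>"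
    using eventually_happens by force
  have "\<forall>\<^sub>F y in at_top. 1 / 4 * ln y \<le> ln (\<eta> * y) / 2" using \<open>0 < \<eta>\<close> by real_asymp
  then have "\<forall>\<^sub>F y in at_top. \<forall>t>0. t \<le> \<eta> * y \<longrightarrow>
      m * (t / y) * g y + m * 1 * (t / y) * ln y \<le> g t + t / (\<eta> * y) * (ln (\<eta> * y) / 2)"
    using eventually_gt_at_top[of 1]
  proof eventually_elim
    case (elim y)
    have "\<eta> * m * ln y \<le> 1 / 4 * ln y" using \<eta>_small elim by (intro mult_right_mono) auto
    then have "\<eta> * m * ln y \<le> ln (\<eta> * y) / 2" using elim by linarith
    then have "m * 1 * (t / y) * ln y \<le> t / (\<eta> * y) * (ln (\<eta> * y) / 2)" if "0 < t" for t
      using that mult_left_mono[of "\<eta> * m * ln y" "ln (\<eta> * y) / 2" "t / (\<eta> * y)"] elim \<eta>_small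
      by (simp add: mult_ac)
    moreover have "m * (t / y) * g y \<le> g t" if "0 < t" "t \<le> \<eta> * y" for t
      using that elim \<eta>_small by (intro mult_g_le_of_small_ratio[OF assms]) auto
    ultimately show ?case by (auto intro: add_mono)
  qed
  then have "admissible_tilt \<eta> (log_tilt m 1)"
    using \<eta>_small assms by (intro admissible_tiltI) auto
  with \<eta>_small show ?thesis by (intro that)
qed

end

context subexponential_walk begin

lemma Fbar_bigo: "(\<lambda>y. Fbar M X y) \<in> O(\<lambda>y. exp (- g y) / y\<^sup>2)"
  by (rule asymp_equiv_imp_bigo[OF tail])

lemma area_tail_bigoI:
  assumes "admissible_tilt \<eta> l"
    and jump: "(\<lambda>y. Fbar M X (c y)) \<in> O(f)"
    and large: "(\<lambda>y. \<P>(\<omega> in M. truncated_sum X {\<eta> * y<..c y} (max_length y) \<omega> > v y)) \<in> O(f)"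
      (is "?large \<in> _")
    and small: "(\<lambda>y. small_steps_total (\<eta> * y) (l y) (v y) y) \<in> O(f)" (is "?small \<in> _")
  shows "(\<lambda>y. area_tail (y\<^sup>2 / (2 * a))) \<in> O(f)"
proof -
  have "0 < \<eta>" and "\<forall>\<^sub>F y in at_top. 0 < l y" using assms(1) by (auto simp: admissible_tilt_def)
  from this(2) have "\<forall>\<^sub>F y in at_top.
      area_tail (y\<^sup>2 / (2 * a)) \<le> mean_tau * Fbar M X (c y) + ?large y + ?small y"
    using eventually_gt_at_top[of 0]
    unfolding small_steps_total_def
    by eventually_elim (use \<open>0 < \<eta>\<close> max_length_ge in \<open>intro prob_area_le, auto\<close>)
  then have "(\<lambda>y. area_tail (y\<^sup>2 / (2 * a)))
      \<in> O(\<lambda>y. mean_tau * Fbar M X (c y) + ?large y + ?small y)"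
    by (intro landau_o.big_mono) (auto elim!: eventually_mono intro: order.trans[OF _ abs_ge_self])
  also have "(\<lambda>y. mean_tau * Fbar M X (c y) + ?large y + ?small y) \<in> O(f)"
    using jump by (intro sum_in_bigo large small) simp
  finally show ?thesis .
qed

text \<open>The summand \<open>ln y / 2\<close> of the tilt pays for half of the factor \<open>y\<close> that comes from the union
  bound over the possible lengths of the excursion.\<close>
lemma tilted_exponent_bigo:
  fixes l :: "real \<Rightarrow> real"
  defines "l \<equiv> log_tilt 1 (1 / 2)"
  assumes "0 < B"
  shows "(\<lambda>y. y * exp (- l y * (y - 0) + B * ((l y)\<^sup>2 * y)))
    \<in> O(\<lambda>y. sqrt y * exp (- g y + 2 * B * ((g y)\<^sup>2 / y)))"
proof (rule bigoI)
  let ?bound = "\<lambda>y. sqrt y * exp (- g y + 2 * B * ((g y)\<^sup>2 / y))"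
  have "\<forall>\<^sub>F y::real in at_top. (ln y)\<^sup>2 / (2 * y) \<le> 1" by real_asymp
  then show "\<forall>\<^sub>F y in at_top. norm (y * exp (- l y * (y - 0) + B * ((l y)\<^sup>2 * y)))
      \<le> exp B * norm (?bound y)"
    using eventually_gt_at_top[of 0]
  proof eventually_elim
    case (elim y)
    have l_mult: "l y * y = g y + ln y / 2"
      using log_tilt_mult[of y 1 "1 / 2"] elim by (simp add: l_def)
    have "(l y)\<^sup>2 * y = (g y + ln y / 2)\<^sup>2 / y"
      unfolding l_mult[symmetric] using elim by (simp add: power2_eq_square)
    also have "\<dots> \<le> (2 * (g y)\<^sup>2 + (ln y)\<^sup>2 / 2) / y"
    proof (rule divide_right_mono)
      have "0 \<le> (g y - ln y / 2)\<^sup>2" by simp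
      then show "(g y + ln y / 2)\<^sup>2 \<le> 2 * (g y)\<^sup>2 + (ln y)\<^sup>2 / 2"
        by (simp add: power2_eq_square algebra_simps)
    qed (use elim in auto)
    also have "\<dots> \<le> 2 * ((g y)\<^sup>2 / y) + 1" using elim by (simp add: add_divide_distrib)
    finally have "B * ((l y)\<^sup>2 * y) \<le> B * (2 * ((g y)\<^sup>2 / y) + 1)"
      using \<open>0 < B\<close> by (intro mult_left_mono) auto
    then have "- l y * (y - 0) + B * ((l y)\<^sup>2 * y) \<le> B + (- g y + 2 * B * ((g y)\<^sup>2 / y)) - ln y / 2"
      using l_mult by (simp add: algebra_simps)
    then have "y * exp (- l y * (y - 0) + B * ((l y)\<^sup>2 * y))
        \<le> y * exp (B + (- g y + 2 * B * ((g y)\<^sup>2 / y)) - ln y / 2)"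
      using elim by (intro mult_left_mono) auto
    also have "\<dots> = exp B * ((y / sqrt y) * exp (- g y + 2 * B * ((g y)\<^sup>2 / y)))"
      unfolding exp_diff exp_half_ln[OF elim(2)] exp_add[of B] by simp
    also have "y / sqrt y = sqrt y" using elim by (simp add: real_div_sqrt)
    finally show ?case using elim by simp
  qed
qed

lemma area_tail_bigo:
  obtains B where "0 < B"
    "(\<lambda>y. area_tail (y\<^sup>2 / (2 * a))) \<in> O(\<lambda>y. sqrt y * exp (- g y + B * ((g y)\<^sup>2 / y)))"
proof -
  let ?l = "log_tilt 1 (1 / 2)"
  obtain B where "0 < B" and small: "(\<lambda>y. small_steps_total (1 * y) (?l y) 0 y)
      \<in> O(\<lambda>y. y * exp (- ?l y * (y - 0) + B * ((?l y)\<^sup>2 * y)))"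
    by (rule small_steps_bigo[OF admissible_tilt_1, of "\<lambda>_. 0"])
  let ?bound = "\<lambda>y. sqrt y * exp (- g y + 2 * B * ((g y)\<^sup>2 / y))"
  have "(\<lambda>y. exp (- g y) / y\<^sup>2) \<in> O(?bound)"
  proof (rule landau_o.big_mono)
    show "\<forall>\<^sub>F y in at_top. norm (exp (- g y) / y\<^sup>2) \<le> norm (?bound y)"
      using eventually_gt_at_top[of 1]
    proof eventually_elim
      case (elim y)
      have "exp (- g y) / y\<^sup>2 \<le> exp (- g y) / 1" using elim by (intro divide_left_mono) auto
      also have "\<dots> \<le> 1 * exp (- g y + 2 * B * ((g y)\<^sup>2 / y))" using elim \<open>0 < B\<close> by simp
      also have "\<dots> \<le> ?bound y" using elim by (intro mult_right_mono) auto
      finally show ?case using elim by simp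
    qed
  qed
  then have jump: "(\<lambda>y. Fbar M X y) \<in> O(?bound)" by (rule landau_o.big_trans[OF Fbar_bigo])
  have large: "(\<lambda>y. \<P>(\<omega> in M. truncated_sum X {1 * y<..y} (max_length y) \<omega> > 0)) \<in> O(?bound)"
    by (simp add: truncated_sum_def truncate_to_def)
  have "(\<lambda>y. area_tail (y\<^sup>2 / (2 * a))) \<in> O(?bound)"
    by (rule area_tail_bigoI[OF admissible_tilt_1 jump large
          landau_o.big_trans[OF small tilted_exponent_bigo[OF \<open>0 < B\<close>]]])
  then show ?thesis using \<open>0 < B\<close> by (intro that[of "2 * B"]) auto
qed

lemma exp_moment_on_large_bigo:
  assumes "0 < \<eta>" "0 \<le> d" "\<eta> \<le> 1 - d"
  shows "(\<lambda>y. exp_moment_on {\<eta> * y<..(1 - d) * y} ((g y + 1) / y) (X 1)) \<in> O(\<lambda>y. (g y + 2) / y\<^sup>2)"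
proof (rule bigoI)
  obtain t0 where exp_mult_Fbar_le: "\<And>t l e. t0 \<le> t \<Longrightarrow> l * t \<le> g t + e \<Longrightarrow>
      exp (l * t) * Fbar M X t \<le> 2 * exp e / t\<^sup>2"
    using eventually_exp_mult_Fbar_le unfolding eventually_at_top_linorder by blast
  show "\<forall>\<^sub>F y in at_top. norm (exp_moment_on {\<eta> * y<..(1 - d) * y} ((g y + 1) / y) (X 1))
      \<le> exp 1 * (2 * exp 1 / \<eta>\<^sup>2) * norm ((g y + 2) / y\<^sup>2)"
    using eventually_gt_at_top[of 0] eventually_ge_at_top[of "t0 / \<eta>"]
  proof eventually_elim
    case (elim y)
    let ?l = "(g y + 1) / y" and ?r = "2 * exp 1 / (\<eta> * y)\<^sup>2"
    have "0 \<le> g y" using elim by (intro g_nonneg)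
    have "\<eta> * y \<le> (1 - d) * y" using assms elim by (intro mult_right_mono) auto
    have "exp_moment_on {\<eta> * y<..(1 - d) * y} ?l (X 1)
        \<le> exp 1 * (?l * ((1 - d) * y - \<eta> * y) + 1) * ?r"
    proof (rule exp_moment_on_le_const[OF X_measurable _ \<open>\<eta> * y \<le> (1 - d) * y\<close>])
      fix t assume t_range: "\<eta> * y \<le> t" "t \<le> (1 - d) * y"
      have "0 < \<eta> * y" using assms elim by simp
      then have "0 < t" using t_range by linarith
      have "(1 - d) * y \<le> 1 * y" using assms elim by (intro mult_right_mono) auto
      then have "t \<le> y" using t_range by simp
      then have "exp (?l * t) * Fbar M X t \<le> 2 * exp 1 / t\<^sup>2"
        using t_range elim assms \<open>0 < t\<close> g_plus_one_mult_le[of t y]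
        by (intro exp_mult_Fbar_le) (auto simp: field_simps)
      also have "\<dots> \<le> ?r"
        using t_range \<open>0 < \<eta> * y\<close> by (intro frac_le power_mono zero_less_power) auto
      finally show "exp (?l * t) * \<P>(\<omega> in M. X 1 \<omega> > t) \<le> ?r" by (simp add: Fbar_def)
    qed (use \<open>0 \<le> g y\<close> elim in auto)
    also have "\<dots> \<le> exp 1 * (?l * y + 1) * ?r"
    proof (intro mult_right_mono mult_left_mono add_right_mono)
      have "0 \<le> d * y + \<eta> * y" using assms elim by simp
      then show "(1 - d) * y - \<eta> * y \<le> y" by (simp add: algebra_simps)
    qed (use \<open>0 \<le> g y\<close> elim in auto)
    also have "\<dots> = exp 1 * (2 * exp 1 / \<eta>\<^sup>2) * ((g y + 2) / y\<^sup>2)"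
      using elim by (simp add: power_mult_distrib)
    finally show ?case
      using exp_moment_on_nonneg[of _ ?l "X 1"] \<open>0 \<le> g y\<close> by simp
  qed
qed

text \<open>No step counted here exceeds \<open>(1 - d) * y\<close>, so at least two are needed; this is the source of
  the square.\<close>
lemma large_steps_bigo:
  assumes "0 < \<eta>" "0 \<le> d" "\<eta> \<le> 1 - d"
  shows "(\<lambda>y. \<P>(\<omega> in M. truncated_sum X {\<eta> * y<..(1 - d) * y} (max_length y) \<omega> > (1 - d) * y))
    \<in> O(\<lambda>y. (y * ((g y + 2) / y\<^sup>2))\<^sup>2 * exp (- (1 - d) * g y))"
proof -
  let ?q = "\<lambda>y. exp_moment_on {\<eta> * y<..(1 - d) * y} ((g y + 1) / y) (X 1)"
  let ?nq = "\<lambda>y. (real (max_length y) + 1) * ?q y"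
  have nq_bigo: "?nq \<in> O(\<lambda>y. y * ((g y + 2) / y\<^sup>2))"
    by (intro landau_o.big.mult max_length_bigo exp_moment_on_large_bigo assms)
  have "(\<lambda>y. y * ((g y + 2) / y\<^sup>2)) \<in> o(\<lambda>_. 1)"
    by (intro smalloI_tendsto) (use g_plus_two_ratio_tendsto_0 in auto)
  with nq_bigo have "?nq \<in> o(\<lambda>_. 1)" by (rule landau_o.big_small_trans)
  then have "(?nq \<longlongrightarrow> 0) at_top" using smalloD_tendsto by fastforce
  then have "\<forall>\<^sub>F y in at_top. ?nq y < 1" by (intro order_tendstoD) auto
  then have "\<forall>\<^sub>F y in at_top.
      norm (\<P>(\<omega> in M. truncated_sum X {\<eta> * y<..(1 - d) * y} (max_length y) \<omega> > (1 - d) * y))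
      \<le> norm ((?nq y)\<^sup>2 * exp (- (1 - d) * g y))"
    using eventually_gt_at_top[of 0]
  proof eventually_elim
    case (elim y)
    have "0 \<le> g y" using elim by (intro g_nonneg)
    have "real (max_length y) * ?q y \<le> ?nq y"
      by (intro mult_right_mono exp_moment_on_nonneg) auto
    then have "\<P>(\<omega> in M. truncated_sum X {\<eta> * y<..(1 - d) * y} (max_length y) \<omega> > (1 - d) * y)
        \<le> (real (max_length y) * ?q y)\<^sup>2 * exp (- ((g y + 1) / y) * ((1 - d) * y))"
      using assms elim \<open>0 \<le> g y\<close> by (intro prob_truncated_sum_gt_le) auto
    also have "\<dots> \<le> (?nq y)\<^sup>2 * exp (- (1 - d) * g y)"
    proof (intro mult_mono power_mono \<open>real (max_length y) * ?q y \<le> ?nq y\<close>)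
      have "(g y + 1) / y * ((1 - d) * y) = (1 - d) * (g y + 1)" using elim by simp
      then show "exp (- ((g y + 1) / y) * ((1 - d) * y)) \<le> exp (- (1 - d) * g y)"
        using assms by (simp add: algebra_simps)
    qed (auto intro: mult_nonneg_nonneg exp_moment_on_nonneg)
    finally show ?case by simp
  qed
  then show ?thesis
    by (rule landau_o.big_trans[OF landau_o.big_mono])
      (intro landau_o.big.mult landau_o.big_power nq_bigo landau_o.big_refl)
qed

lemma multiple_tilt_exponent_bigo:
  fixes l :: "real \<Rightarrow> real" and d :: real
  defines "l \<equiv> log_tilt (4 / d) 1"
  assumes "0 < d"
  shows "(\<lambda>y. y * exp (- l y * (y - (1 - d) * y) + B * ((l y)\<^sup>2 * y))) \<in> O(\<lambda>y. exp (- g y) / y\<^sup>2)"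
proof (rule landau_o.big_mono)
  have "((\<lambda>y. B * (4 / d) * l y) \<longlongrightarrow> B * (4 / d) * 0) at_top"
    unfolding l_def by (intro tendsto_mult tendsto_const log_tilt_tendsto_0)
  then have "\<forall>\<^sub>F y in at_top. B * (4 / d) * l y < 1" by (intro order_tendstoD) auto
  then show "\<forall>\<^sub>F y in at_top. norm (y * exp (- l y * (y - (1 - d) * y) + B * ((l y)\<^sup>2 * y)))
      \<le> norm (exp (- g y) / y\<^sup>2)"
    using eventually_gt_at_top[of 1]
  proof eventually_elim
    case (elim y)
    have "0 \<le> g y" "0 \<le> ln y" using elim g_nonneg by auto
    have l_mult: "l y * y = 4 / d * (g y + ln y)"
      using log_tilt_mult[of y "4 / d" 1] elim by (simp add: l_def)
    have "l y * (y - (1 - d) * y) = d * (l y * y)" by (simp add: algebra_simps)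
    also have "\<dots> = 4 * (g y + ln y)" unfolding l_mult using \<open>0 < d\<close> by simp
    finally have gain: "l y * (y - (1 - d) * y) = 4 * (g y + ln y)" .
    have "B * ((l y)\<^sup>2 * y) = (B * l y) * (l y * y)" by (simp add: power2_eq_square)
    also have "\<dots> = (B * (4 / d) * l y) * (g y + ln y)" unfolding l_mult by simp
    also have "\<dots> \<le> 1 * (g y + ln y)"
      using elim \<open>0 \<le> g y\<close> \<open>0 \<le> ln y\<close> by (intro mult_right_mono) auto
    finally have "- l y * (y - (1 - d) * y) + B * ((l y)\<^sup>2 * y) \<le> - g y - 3 * ln y"
      using gain \<open>0 \<le> g y\<close> by simp
    then have "y * exp (- l y * (y - (1 - d) * y) + B * ((l y)\<^sup>2 * y)) \<le> y * exp (- g y - 3 * ln y)"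
      using elim by (intro mult_left_mono) auto
    also have "\<dots> = y * exp (- g y) / exp (3 * ln y)" by (simp add: exp_diff)
    also have "exp (3 * ln y) = y ^ 3" using elim exp_of_nat_mult[of 3 "ln y"] by simp
    also have "y * exp (- g y) / y ^ 3 = exp (- g y) / y\<^sup>2"
      using elim by (simp add: power3_eq_cube power2_eq_square)
    finally show ?case using elim by simp
  qed
qed

lemma exp_g_mono_bigo:
  assumes "c \<le> c'"
  shows "(\<lambda>y. exp (- c' * g y) / y\<^sup>2) \<in> O(\<lambda>y. exp (- c * g y) / y\<^sup>2)"
proof (rule landau_o.big_mono)
  show "\<forall>\<^sub>F y in at_top. norm (exp (- c' * g y) / y\<^sup>2) \<le> norm (exp (- c * g y) / y\<^sup>2)"
    using eventually_gt_at_top[of 0]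
    by eventually_elim (use assms g_nonneg in \<open>simp add: divide_right_mono mult_right_mono\<close>)
qed

lemma square_g_mult_exp_bigo:
  assumes "0 < d" "d \<le> 1"
  shows "(\<lambda>y. (y * ((g y + 2) / y\<^sup>2))\<^sup>2 * exp (- (1 - d) * g y))
      \<in> O(\<lambda>y. exp (- (1 - 2 * d) * g y) / y\<^sup>2)"
proof (rule bigoI)
  show "\<forall>\<^sub>F y in at_top. norm ((y * ((g y + 2) / y\<^sup>2))\<^sup>2 * exp (- (1 - d) * g y))
      \<le> 4 / d\<^sup>2 * norm (exp (- (1 - 2 * d) * g y) / y\<^sup>2)"
    using eventually_gt_at_top[of 0]
  proof eventually_elim
    case (elim y)
    have "(y * ((g y + 2) / y\<^sup>2))\<^sup>2 * exp (- (1 - d) * g y)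
        = (g y + 2)\<^sup>2 * exp (- (1 - d) * g y) / y\<^sup>2"
      using elim by (simp add: power2_eq_square)
    also have "\<dots> \<le> 4 / d\<^sup>2 * exp (d * g y) * exp (- (1 - d) * g y) / y\<^sup>2"
      using assms elim
      by (intro divide_right_mono mult_right_mono square_plus_two_le_exp g_nonneg) auto
    also have "\<dots> = 4 / d\<^sup>2 * (exp (- (1 - 2 * d) * g y) / y\<^sup>2)"
      by (simp add: mult.assoc algebra_simps flip: exp_add)
    finally show ?case by simp
  qed
qed

lemma Fbar_mult_bigo:
  assumes "0 < c" "c \<le> 1"
  shows "(\<lambda>y. Fbar M X (c * y)) \<in> O(\<lambda>y. exp (- c * g y) / y\<^sup>2)"
proof -
  have "filterlim (\<lambda>y. c * y) at_top at_top" using \<open>0 < c\<close> by real_asymp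
  then have "(\<lambda>y. Fbar M X (c * y)) \<in> O(\<lambda>y. exp (- g (c * y)) / (c * y)\<^sup>2)"
    by (rule landau_o.big.compose[OF Fbar_bigo])
  also have "(\<lambda>y. exp (- g (c * y)) / (c * y)\<^sup>2) \<in> O(\<lambda>y. exp (- c * g y) / y\<^sup>2)"
  proof (rule bigoI)
    show "\<forall>\<^sub>F y in at_top. norm (exp (- g (c * y)) / (c * y)\<^sup>2)
        \<le> 1 / c\<^sup>2 * norm (exp (- c * g y) / y\<^sup>2)"
      using eventually_gt_at_top[of 0]
    proof eventually_elim
      case (elim y)
      have "c * g y \<le> g (c * y)"
        using g_mult_le[of "c * y" y] assms elim by (simp add: mult.commute)
      then have "exp (- g (c * y)) / (c * y)\<^sup>2 \<le> exp (- c * g y) / (c * y)\<^sup>2"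
        by (intro divide_right_mono) auto
      also have "\<dots> = 1 / c\<^sup>2 * (exp (- c * g y) / y\<^sup>2)" by (simp add: power_mult_distrib)
      finally show ?case by simp
    qed
  qed
  finally show ?thesis .
qed

end

locale subpower_walk = subexponential_walk M X a g + subpower_exponent g \<gamma>
  for M :: "'a measure" and X a g \<gamma>
begin

lemma area_tail_bigo_sharp:
  assumes "0 < d" "d \<le> 1 / 2"
  shows "(\<lambda>y. area_tail (y\<^sup>2 / (2 * a))) \<in> O(\<lambda>y. exp (- (1 - 2 * d) * g y) / y\<^sup>2)"
proof -
  let ?bound = "\<lambda>y. exp (- (1 - 2 * d) * g y) / y\<^sup>2"
  let ?l = "log_tilt (4 / d) 1"
  have "0 < 4 / d" using assms by simp
  obtain \<eta> where "\<eta> \<le> 1 / 2" and tilt: "admissible_tilt \<eta> ?l"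
    by (rule admissible_tilt_multiple[OF \<open>0 < 4 / d\<close>])
  then have \<eta>_bounds: "0 < \<eta>" "\<eta> \<le> 1 - d"
    using assms by (auto simp: admissible_tilt_def)
  obtain B where small: "(\<lambda>y. small_steps_total (\<eta> * y) (?l y) ((1 - d) * y) y)
      \<in> O(\<lambda>y. y * exp (- ?l y * (y - (1 - d) * y) + B * ((?l y)\<^sup>2 * y)))"
    by (rule small_steps_bigo[OF tilt, of "\<lambda>y. (1 - d) * y"])
  also have "(\<lambda>y. y * exp (- ?l y * (y - (1 - d) * y) + B * ((?l y)\<^sup>2 * y)))
      \<in> O(\<lambda>y. exp (- g y) / y\<^sup>2)"
    by (rule multiple_tilt_exponent_bigo[OF \<open>0 < d\<close>])
  also have "(\<lambda>y. exp (- g y) / y\<^sup>2) \<in> O(?bound)"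
    using exp_g_mono_bigo[of "1 - 2 * d" 1] assms by simp
  finally have small: "(\<lambda>y. small_steps_total (\<eta> * y) (?l y) ((1 - d) * y) y) \<in> O(?bound)" .
  have large: "(\<lambda>y. \<P>(\<omega> in M. truncated_sum X {\<eta> * y<..(1 - d) * y} (max_length y) \<omega> > (1 - d) * y))
      \<in> O(?bound)"
    using large_steps_bigo[OF \<eta>_bounds(1) _ \<eta>_bounds(2)] square_g_mult_exp_bigo[of d] assms
    by (auto intro: landau_o.big_trans)
  have jump: "(\<lambda>y. Fbar M X ((1 - d) * y)) \<in> O(?bound)"
    using Fbar_mult_bigo[of "1 - d"] exp_g_mono_bigo[of "1 - 2 * d" "1 - d"] assms
    by (auto intro: landau_o.big_trans)
  show ?thesis by (rule area_tail_bigoI[OF tilt jump large small])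
qed

end

context negative_drift_walk begin

abbreviation peak :: "real \<Rightarrow> real" where
  "peak x \<equiv> sqrt (2 * a * x)"

lemma filterlim_peak: "filterlim peak at_top at_top"
  using a_pos by real_asymp

lemma eventually_area_tail_peak:
  assumes "\<forall>\<^sub>F y in at_top. P (area_tail (y\<^sup>2 / (2 * a))) y"
  shows "\<forall>\<^sub>F x in at_top. P (area_tail x) (peak x)"
  using eventually_compose_filterlim[OF assms filterlim_peak] eventually_ge_at_top[of 0]
proof eventually_elim
  case (elim x)
  have "(peak x)\<^sup>2 / (2 * a) = x" using elim a_pos by simp
  then show ?case using elim by simp
qed

end

context subexponential_walk begin

lemma eventually_area_tail_le_sqrt_form:
  obtains C0 D where "0 < D" "\<And>C. C0 \<le> C \<Longrightarrow> \<forall>\<^sub>F y in at_top. area_tail (y\<^sup>2 / (2 * a))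
    \<le> D * sqrt y * exp (- (g y * sqrt (1 - 2 * C * g y / (a * y))))"
proof -
  obtain B where bigo:
        "(\<lambda>y. area_tail (y\<^sup>2 / (2 * a))) \<in> O(\<lambda>y. sqrt y * exp (- g y + B * ((g y)\<^sup>2 / y)))"
    by (rule area_tail_bigo)
  obtain D where "0 < D" and bound: "\<forall>\<^sub>F y in at_top.
      norm (area_tail (y\<^sup>2 / (2 * a))) \<le> D * norm (sqrt y * exp (- g y + B * ((g y)\<^sup>2 / y)))"
    by (rule landau_o.bigE[OF bigo])
  have "\<forall>\<^sub>F y in at_top. area_tail (y\<^sup>2 / (2 * a))
      \<le> D * sqrt y * exp (- (g y * sqrt (1 - 2 * C * g y / (a * y))))" if "B * a \<le> C" for C
  proof -
    have "((\<lambda>y. C / a * (g y / y)) \<longlongrightarrow> C / a * 0) at_top"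
      by (intro tendsto_mult tendsto_const g_ratio_tendsto)
    then have "\<forall>\<^sub>F y in at_top. C / a * (g y / y) < 1" by (intro order_tendstoD) auto
    with bound show ?thesis
      using eventually_gt_at_top[of 0]
    proof eventually_elim
      case (elim y)
      have "C * g y \<le> a * y" using elim a_pos by (simp add: field_simps)
      then have "- g y + B * ((g y)\<^sup>2 / y) \<le> - (g y * sqrt (1 - 2 * C * g y / (a * y)))"
        using elim a_pos that by (intro exponent_le_sqrt_form g_nonneg) auto
      then have "D * sqrt y * exp (- g y + B * ((g y)\<^sup>2 / y))
          \<le> D * sqrt y * exp (- (g y * sqrt (1 - 2 * C * g y / (a * y))))"
        using \<open>0 < D\<close> elim by (intro mult_left_mono) auto
      then show ?case using elim by (simp add: mult.assoc)
    qed
  qed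
  with \<open>0 < D\<close> show ?thesis by (rule that)
qed

theorem area_tail_upper_bound:
  "\<exists>C>0. \<forall>\<^sub>F x in at_top. area_tail x
    \<le> C * x powr (1/4) * exp (- (g (peak x) * sqrt (1 - 2 * C * g (peak x) / (a * peak x))))"
proof -
  obtain C0 D where "0 < D" and bound: "\<And>C. C0 \<le> C \<Longrightarrow> \<forall>\<^sub>F y in at_top. area_tail (y\<^sup>2 / (2 * a))
      \<le> D * sqrt y * exp (- (g y * sqrt (1 - 2 * C * g y / (a * y))))"
    by (rule eventually_area_tail_le_sqrt_form) blast
  define C where "C = max (D * (2 * a) powr (1/4)) C0"
  have "0 < D * (2 * a) powr (1/4)" using \<open>0 < D\<close> a_pos by simp
  then have "0 < C" "D * (2 * a) powr (1/4) \<le> C" "C0 \<le> C" by (auto simp: C_def)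
  let ?le_bound = "\<lambda>p y. p \<le> D * sqrt y * exp (- (g y * sqrt (1 - 2 * C * g y / (a * y))))"
  from eventually_area_tail_peak[where P = ?le_bound, OF bound[OF \<open>C0 \<le> C\<close>]]
  have "\<forall>\<^sub>F x in at_top. area_tail x
    \<le> C * x powr (1/4) * exp (- (g (peak x) * sqrt (1 - 2 * C * g (peak x) / (a * peak x))))"
    using eventually_gt_at_top[of 0]
  proof eventually_elim
    case (elim x)
    have "sqrt (peak x) = (2 * a * x) powr (1/4)"
      using elim a_pos by (simp add: powr_half_sqrt[symmetric] powr_powr)
    also have "\<dots> = (2 * a) powr (1/4) * x powr (1/4)" by (rule powr_mult)
    finally have "D * sqrt (peak x) = D * (2 * a) powr (1/4) * x powr (1/4)" by simp
    also have "\<dots> \<le> C * x powr (1/4)"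
      using \<open>D * (2 * a) powr (1/4) \<le> C\<close> by (intro mult_right_mono) auto
    finally have "D * sqrt (peak x) * exp r \<le> C * x powr (1/4) * exp r" for r
      by (intro mult_right_mono) auto
    then show ?case using elim order.trans by blast
  qed
  with \<open>0 < C\<close> show ?thesis by blast
qed

section \<open>The lower bound\<close>

lemma eventually_area_tail_ratio_gt:
  assumes w_props: "\<forall>\<^sub>F x in at_top. 0 < w x" "((\<lambda>x. (peak x + w x) / (w x)\<^sup>2) \<longlongrightarrow> 0) at_top"
    and z_less: "z < (\<Sum>k\<in>{1..n}. survival k)"
  shows "\<forall>\<^sub>F x in at_top. z < area_tail x / Fbar M X (peak x + 2 * w x)"
proof -
  define h where "h x = peak x + 2 * w x" for x
  define \<rho> where "\<rho> x = second_moment / a * ((peak x + w x) / (w x)\<^sup>2)" for x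
  define r where "r x = (1 - \<rho> x) * (\<Sum>k\<in>{1..n}. survival k - real k * Fbar M X (h x))" for x
  have h_at_top: "filterlim h at_top at_top"
    by (rule filterlim_at_top_mono[OF filterlim_peak])
      (use w_props(1) in \<open>auto simp: h_def elim: eventually_mono\<close>)
  have \<rho>_tendsto: "(\<rho> \<longlongrightarrow> 0) at_top" unfolding \<rho>_def by (rule tendsto_mult_right_zero[OF w_props(2)])
  have "(r \<longlongrightarrow> (1 - 0) * (\<Sum>k\<in>{1..n}. survival k - real k * 0)) at_top"
    unfolding r_def
    by (intro tendsto_mult tendsto_diff tendsto_const tendsto_sum \<rho>_tendsto
        filterlim_compose[OF Fbar_tendsto_0 h_at_top])
  then have "\<forall>\<^sub>F x in at_top. z < r x" using z_less by (intro order_tendstoD) auto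
  moreover have "\<forall>\<^sub>F x in at_top. \<rho> x < 1" using \<rho>_tendsto by (intro order_tendstoD) auto
  moreover have "\<forall>\<^sub>F x in at_top. 0 < Fbar M X (h x)"
    by (rule eventually_compose_filterlim[OF eventually_Fbar_pos h_at_top])
  ultimately show ?thesis
    using w_props(1) eventually_gt_at_top[of 0]
  proof eventually_elim
    case (elim x)
    have "0 < peak x" "(peak x)\<^sup>2 / (2 * a) = x" using elim a_pos by simp_all
    have "real (nat \<lfloor>(peak x + w x) / a\<rfloor>) \<le> (peak x + w x) / a"
      using \<open>0 < peak x\<close> elim a_pos by simp
    then have "real (nat \<lfloor>(peak x + w x) / a\<rfloor>) * second_moment / (w x)\<^sup>2
        \<le> (peak x + w x) / a * second_moment / (w x)\<^sup>2"
      using second_moment_pos by (intro divide_right_mono mult_right_mono) auto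
    also have "\<dots> = \<rho> x" by (simp add: \<rho>_def)
    finally have "Fbar M X (h x) * r x \<le> area_tail x"
      using prob_area_ge[OF \<open>0 < peak x\<close> elim(4), of "\<rho> x" n] elim \<open>(peak x)\<^sup>2 / (2 * a) = x\<close>
      by (simp add: r_def h_def mult.assoc)
    then have "r x \<le> area_tail x / Fbar M X (h x)"
      using elim by (simp add: pos_le_divide_eq mult.commute)
    then show ?case using elim unfolding h_def by linarith
  qed
qed

lemma mean_tau_le_Liminf_area_tail_ratio:
  assumes "\<forall>\<^sub>F x in at_top. 0 < w x" "((\<lambda>x. (peak x + w x) / (w x)\<^sup>2) \<longlongrightarrow> 0) at_top"
  shows "ereal mean_tau \<le> Liminf at_top (\<lambda>x. ereal (area_tail x / Fbar M X (peak x + 2 * w x)))"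
  unfolding le_Liminf_iff
proof (intro allI impI)
  fix z assume "z < ereal mean_tau"
  show "\<forall>\<^sub>F x in at_top. z < ereal (area_tail x / Fbar M X (peak x + 2 * w x))"
  proof (cases z)
    case (real r)
    have "(\<lambda>n. \<Sum>k<n. survival (Suc k)) \<longlonglongrightarrow> mean_tau"
      using survival_sums by (simp add: sums_def)
    then have "\<forall>\<^sub>F n in sequentially. r < (\<Sum>k<n. survival (Suc k))"
      using \<open>z < ereal mean_tau\<close> real by (intro order_tendstoD) auto
    then obtain n where "r < (\<Sum>k<n. survival (Suc k))"
      by (auto simp: eventually_sequentially)
    then have "r < (\<Sum>k\<in>{1..n}. survival k)" by (simp add: sum.atLeast1_atMost_eq)
    from eventually_area_tail_ratio_gt[OF assms this] show ?thesis by (simp add: real)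
  qed (use \<open>z < ereal mean_tau\<close> in auto)
qed

text \<open>Over the \<open>O(sqrt x)\<close> steps that it takes to collect area \<open>x\<close>, the fluctuations of the walk are
  of order \<open>x powr (1/4)\<close>.\<close>
lemma peak_plus_powr_over_square_tendsto_0:
  assumes "0 < c" "0 < e"
  shows "((\<lambda>x. (peak x + c * x powr (1 / 4 + e)) / (c * x powr (1 / 4 + e))\<^sup>2) \<longlongrightarrow> 0) at_top"
proof (rule Lim_transform_eventually)
  show "((\<lambda>x. sqrt (2 * a) / c\<^sup>2 * x powr (- 2 * e) + 1 / c * x powr (- (1 / 4 + e))) \<longlongrightarrow> 0) at_top"
    using assms by (intro tendsto_add_zero tendsto_mult_right_zero tendsto_neg_powr
        filterlim_ident) auto
  show "\<forall>\<^sub>F x in at_top. sqrt (2 * a) / c\<^sup>2 * x powr (- 2 * e) + 1 / c * x powr (- (1 / 4 + e))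
      = (peak x + c * x powr (1 / 4 + e)) / (c * x powr (1 / 4 + e))\<^sup>2"
    using eventually_gt_at_top[of 0]
  proof eventually_elim
    case (elim x)
    define v where "v = x powr (1 / 4 + e)"
    have "0 < v" using elim by (simp add: v_def)
    have "sqrt x = x powr (- 2 * e) * v\<^sup>2"
      using elim by (simp add: v_def powr_half_sqrt[symmetric] power2_eq_square flip: powr_add)
    then have peak_eq: "peak x = sqrt (2 * a) * x powr (- 2 * e) * v\<^sup>2"
      by (simp add: real_sqrt_mult)
    have "x powr (- (1 / 4 + e)) = 1 / v" by (simp only: v_def powr_minus_divide)
    then show ?case
      unfolding peak_eq v_def[symmetric] using \<open>0 < v\<close> \<open>0 < c\<close>
      by (simp add: field_simps power2_eq_square)
  qed
qed

theorem area_tail_lower_bound: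
  assumes "0 < C" "0 < e"
  shows "ereal mean_tau
    \<le> Liminf at_top (\<lambda>x. ereal (area_tail x / Fbar M X (peak x + C * x powr (1 / 4 + e))))"
proof -
  have "\<forall>\<^sub>F x in at_top. 0 < C / 2 * x powr (1 / 4 + e)"
    using eventually_gt_at_top[of 0] by eventually_elim (use \<open>0 < C\<close> in simp)
  from mean_tau_le_Liminf_area_tail_ratio[OF this peak_plus_powr_over_square_tendsto_0] assms
  show ?thesis by simp
qed

section \<open>Logarithmic asymptotics\<close>

lemma log_rate_peak_at_top: "filterlim (\<lambda>x. log_rate (peak x)) at_top at_top"
  by (rule filterlim_compose[OF log_rate_at_top filterlim_peak])

lemma filterlim_peak_plus_powr: "filterlim (\<lambda>x. peak x + x powr (3 / 8)) at_top at_top"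
  by (rule filterlim_at_top_mono[OF filterlim_peak]) simp

lemma eventually_minus_ln_area_tail_le:
  "\<forall>\<^sub>F x in at_top. 0 < area_tail x \<and>
    - ln (area_tail x) \<le> ln 2 - ln (Fbar M X (peak x + x powr (3 / 8)))"
proof -
  have "\<forall>\<^sub>F x in at_top.
      1 / 2 < area_tail x / Fbar M X (peak x + 2 * (1 / 2 * x powr (1 / 4 + 1 / 8)))"
  proof (rule eventually_area_tail_ratio_gt)
    show "\<forall>\<^sub>F x::real in at_top. 0 < 1 / 2 * x powr (1 / 4 + 1 / 8)" by real_asymp
    show "((\<lambda>x. (peak x + 1 / 2 * x powr (1 / 4 + 1 / 8)) / (1 / 2 * x powr (1 / 4 + 1 / 8))\<^sup>2)
        \<longlongrightarrow> 0) at_top"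
      by (rule peak_plus_powr_over_square_tendsto_0) auto
    show "1 / 2 < (\<Sum>k\<in>{1..1}. survival k)" by (simp add: survival_1[simplified])
  qed
  moreover have "\<forall>\<^sub>F x in at_top. 0 < Fbar M X (peak x + x powr (3 / 8))"
    by (rule eventually_compose_filterlim[OF eventually_Fbar_pos filterlim_peak_plus_powr])
  ultimately show ?thesis
  proof eventually_elim
    case (elim x)
    let ?F = "Fbar M X (peak x + x powr (3 / 8))"
    have half: "?F / 2 < area_tail x" using elim by (simp add: field_simps)
    then have "0 < area_tail x" using elim by linarith
    have "ln ?F - ln 2 = ln (?F / 2)" using elim by (simp add: ln_div)
    also have "\<dots> \<le> ln (area_tail x)"
      using half elim \<open>0 < area_tail x\<close> by (subst ln_le_cancel_iff) auto
    finally show ?case using \<open>0 < area_tail x\<close> by simp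
  qed
qed

lemma eventually_minus_ln_Fbar_shift_le:
  assumes "0 < e"
  shows "\<forall>\<^sub>F x in at_top. - ln (Fbar M X (peak x + x powr (3 / 8)))
      \<le> (1 + e) * ((1 + e) * log_rate (peak x))"
proof -
  define h where "h x = peak x + x powr (3 / 8)" for x
  have h_at_top: "filterlim h at_top at_top"
    unfolding h_def by (rule filterlim_peak_plus_powr)
  have "\<forall>\<^sub>F x in at_top. norm (- ln (Fbar M X (h x))) \<le> (1 + e) * norm (log_rate (h x))"
    using assms by (intro asymp_equiv_imp_eventually_le[OF
        asymp_equiv_compose'[OF ln_Fbar_asymp h_at_top]]) auto
  moreover have "\<forall>\<^sub>F x in at_top. exp 1 \<le> peak x" "\<forall>\<^sub>F x in at_top. h x \<le> (1 + e) * peak x"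
    unfolding h_def using a_pos assms by real_asymp+
  moreover have "\<forall>\<^sub>F x in at_top. 0 \<le> log_rate (h x)" "\<forall>\<^sub>F x in at_top. 0 \<le> log_rate (peak x)"
    using log_rate_peak_at_top filterlim_compose[OF log_rate_at_top h_at_top]
    by (simp_all add: filterlim_at_top)
  ultimately have "\<forall>\<^sub>F x in at_top. - ln (Fbar M X (h x)) \<le> (1 + e) * ((1 + e) * log_rate (peak x))"
  proof eventually_elim
    case (elim x)
    have "0 < peak x" using elim(2) exp_gt_zero less_le_trans by blast
    have "log_rate (h x) \<le> h x / peak x * log_rate (peak x)"
      using elim by (intro log_rate_le_mult) (auto simp: h_def)
    also have "\<dots> \<le> (1 + e) * log_rate (peak x)"
      using elim \<open>0 < peak x\<close> by (intro mult_right_mono) (auto simp: field_simps)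
    finally have "(1 + e) * log_rate (h x) \<le> (1 + e) * ((1 + e) * log_rate (peak x))"
      using assms by (intro mult_left_mono) auto
    then show ?case using elim by simp
  qed
  then show ?thesis by (simp only: h_def)
qed

lemma eventually_ln_area_tail_lower:
  assumes "0 < d"
  shows "\<forall>\<^sub>F x in at_top. 0 < area_tail x \<and> - ln (area_tail x) \<le> (1 + d) * log_rate (peak x)"
proof -
  define e where "e = min 1 (d / 4)"
  have e_bounds: "0 < e" "e \<le> 1" "4 * e \<le> d" using assms by (auto simp: e_def)
  have "\<forall>\<^sub>F x in at_top. ln 2 / e \<le> log_rate (peak x)" "\<forall>\<^sub>F x in at_top. 0 \<le> log_rate (peak x)"
    using log_rate_peak_at_top by (simp_all add: filterlim_at_top)
  with eventually_minus_ln_area_tail_le eventually_minus_ln_Fbar_shift_le[OF e_bounds(1)]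
  show ?thesis
  proof eventually_elim
    case (elim x)
    let ?L = "log_rate (peak x)"
    have "ln 2 \<le> e * ?L" using elim e_bounds by (simp add: field_simps)
    then have "- ln (area_tail x) \<le> (e + (1 + e) * (1 + e)) * ?L"
      using elim by (simp add: algebra_simps)
    also have "\<dots> \<le> (1 + d) * ?L"
    proof (rule mult_right_mono)
      have "e * e \<le> 1 * e" using e_bounds by (intro mult_right_mono) auto
      moreover have "e + (1 + e) * (1 + e) = 1 + 3 * e + e * e" by (simp add: algebra_simps)
      ultimately show "e + (1 + e) * (1 + e) \<le> 1 + d" using e_bounds by linarith
    qed (use elim in auto)
    finally show ?case using elim by simp
  qed
qed

end

context subpower_walk begin

lemma eventually_ln_area_tail_upper:
  assumes "0 < d"
  shows "\<forall>\<^sub>F x in at_top. (1 - d) * log_rate (peak x) \<le> - ln (area_tail x)"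
proof -
  define e where "e = min (1 / 2) (d / 4)"
  have e_bounds: "0 < e" "e \<le> 1 / 2" "4 * e \<le> d" using assms by (auto simp: e_def)
  obtain C where "0 < C" and bound: "\<forall>\<^sub>F y in at_top.
      norm (area_tail (y\<^sup>2 / (2 * a))) \<le> C * norm (exp (- (1 - 2 * e) * g y) / y\<^sup>2)"
    using landau_o.bigE[OF area_tail_bigo_sharp[OF e_bounds(1,2)]] by blast
  let ?le_bound = "\<lambda>p y. norm p \<le> C * norm (exp (- (1 - 2 * e) * g y) / y\<^sup>2)"
  note bound = eventually_area_tail_peak[where P = ?le_bound, OF bound]
  have "\<forall>\<^sub>F x in at_top. 1 < peak x" using a_pos by real_asymp
  moreover have "\<forall>\<^sub>F x in at_top. ln C / e \<le> log_rate (peak x)"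
    "\<forall>\<^sub>F x in at_top. 0 \<le> log_rate (peak x)"
    using log_rate_peak_at_top by (simp_all add: filterlim_at_top)
  ultimately show ?thesis
    using bound eventually_ln_area_tail_lower[OF \<open>0 < d\<close>]
  proof eventually_elim
    case (elim x)
    let ?y = "peak x" let ?L = "log_rate ?y"
    have "area_tail x \<le> C * (exp (- (1 - 2 * e) * g ?y) / ?y\<^sup>2)" using elim by simp
    also have "exp (- (1 - 2 * e) * g ?y) / ?y\<^sup>2 = exp (- (1 - 2 * e) * g ?y - 2 * ln ?y)"
      using elim by (simp add: exp_diff exp_double)
    also have "\<dots> \<le> exp (- (1 - 2 * e) * ?L)"
      using elim e_bounds by (simp add: log_rate_def algebra_simps)
    also have "C * exp (- (1 - 2 * e) * ?L) = exp (ln C + - (1 - 2 * e) * ?L)"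
      using \<open>0 < C\<close> by (simp only: exp_add exp_ln)
    finally have "area_tail x \<le> exp (ln C + - (1 - 2 * e) * ?L)" using \<open>0 < C\<close> by simp
    moreover have "exp (ln (area_tail x)) = area_tail x" using elim by simp
    ultimately have "ln (area_tail x) \<le> ln C + - (1 - 2 * e) * ?L"
      by (subst exp_le_cancel_iff[symmetric]) (simp only:)
    moreover have "ln C \<le> e * ?L" using elim e_bounds by (simp add: field_simps)
    moreover have "3 * e * ?L \<le> d * ?L" using elim e_bounds by (intro mult_right_mono) auto
    ultimately show ?case by (simp add: algebra_simps)
  qed
qed

lemma ln_area_tail_asymp: "(\<lambda>x. - ln (area_tail x)) \<sim>[at_top] (\<lambda>x. log_rate (peak x))"
  unfolding asymp_equiv_altdef
proof (rule landau_o.smallI)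
  fix c :: real assume "c > 0"
  have "\<forall>\<^sub>F x in at_top. 0 \<le> log_rate (peak x)"
    using log_rate_peak_at_top by (simp add: filterlim_at_top)
  with eventually_ln_area_tail_lower[OF \<open>c > 0\<close>] eventually_ln_area_tail_upper[OF \<open>c > 0\<close>]
  show "\<forall>\<^sub>F x in at_top. norm (- ln (area_tail x) - log_rate (peak x))
      \<le> c * norm (log_rate (peak x))"
    by eventually_elim (simp add: abs_le_iff algebra_simps)
qed

theorem ln_area_tail_ratio_tendsto_1:
  "((\<lambda>x. ln (area_tail x) / ln (Fbar M X (peak x))) \<longlongrightarrow> 1) at_top"
proof -
  have Fbar: "(\<lambda>x. - ln (Fbar M X (peak x))) \<sim>[at_top] (\<lambda>x. log_rate (peak x))"
    by (rule asymp_equiv_compose'[OF ln_Fbar_asymp filterlim_peak])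
  with ln_area_tail_asymp have "(\<lambda>x. - ln (area_tail x)) \<sim>[at_top] (\<lambda>x. - ln (Fbar M X (peak x)))"
    using asymp_equiv_trans asymp_equiv_symI by blast
  moreover have "\<forall>\<^sub>F x in at_top. - ln (Fbar M X (peak x)) \<noteq> 0"
  proof -
    have "\<forall>\<^sub>F x in at_top. 0 < log_rate (peak x)"
      using log_rate_peak_at_top by (simp add: filterlim_at_top_dense)
    with asymp_equiv_eventually_zeros[OF Fbar] show ?thesis by eventually_elim auto
  qed
  ultimately have "((\<lambda>x. - ln (area_tail x) / - ln (Fbar M X (peak x))) \<longlongrightarrow> 1) at_top"
    by (intro asymp_equivD_strong) (auto elim: eventually_mono)
  then show ?thesis by simp
qed

end

theorem theorem1:
  fixes M :: "'a measure" and X :: "nat \<Rightarrow> 'a \<Rightarrow> real"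
    and a :: real and g :: "real \<Rightarrow> real"
  assumes "prob_space M"
    and "\<And>k. X k \<in> borel_measurable M"
    and "prob_space.indep_vars M (\<lambda>_. borel) X {1..}"
    and "\<And>k. k \<ge> 1 \<Longrightarrow> distr M borel (X k) = distr M borel (X 1)"
    and "a > 0"
    and "integrable M (\<lambda>\<omega>. (X 1 \<omega>)\<^sup>2)"
    and "prob_space.expectation M (X 1) = - a"
    and "(\<lambda>x. Fbar M X x) \<sim>[at_top] (\<lambda>x. exp (- g x) / x\<^sup>2)"
    and "\<exists>g'. (\<forall>x>0. (g has_real_derivative g' x) (at x)) \<and> continuous_on {0<..} g'"
    and "\<exists>x0. \<forall>x y. x0 \<le> x \<longrightarrow> x \<le> y \<longrightarrow> g x \<le> g y"
    and "\<And>x y. 0 < x \<Longrightarrow> x \<le> y \<Longrightarrow> g y / y \<le> g x / x"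
    and "((\<lambda>x. g x / x) \<longlongrightarrow> 0) at_top"
  shows
    "(\<exists>C>0. \<forall>\<^sub>F x in at_top.
        measure M {\<omega> \<in> space M. rw_A X \<omega> > x}
          \<le> C * x powr (1/4) *
             exp (- (g (sqrt (2*a*x)) *
                     sqrt (1 - 2 * C * g (sqrt (2*a*x)) / (a * sqrt (2*a*x))))))
     \<and> (\<forall>\<epsilon>>0. \<exists>C>0.
          Liminf at_top (\<lambda>x. ereal (measure M {\<omega> \<in> space M. rw_A X \<omega> > x}
                     / Fbar M X (sqrt (2*a*x) + C * x powr (1/4 + \<epsilon>))))
            \<ge> ereal (prob_space.expectation M (\<lambda>\<omega>. real (rw_tau X \<omega>))))
     \<and> ((\<exists>\<gamma>0. 0 < \<gamma>0 \<and> \<gamma>0 < 1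
            \<and> (\<forall>x y. 0 < x \<longrightarrow> x \<le> y \<longrightarrow> g y / y powr \<gamma>0 \<le> g x / x powr \<gamma>0)
            \<and> ((\<lambda>x. g x / x powr \<gamma>0) \<longlongrightarrow> 0) at_top)
        \<longrightarrow> ((\<lambda>x. ln (measure M {\<omega> \<in> space M. rw_A X \<omega> > x})
                   / ln (Fbar M X (sqrt (2*a*x)))) \<longlongrightarrow> 1) at_top)"
proof -
  interpret prob_space M by fact
  interpret subexponential_walk M X a g
    by unfold_locales (fact assms)+
  show ?thesis
  proof (intro conjI allI impI)
    show "\<exists>C>0. ereal (expectation (\<lambda>\<omega>. real (rw_tau X \<omega>))) \<le>
        Liminf at_top (\<lambda>x. ereal (area_tail x / Fbar M X (peak x + C * x powr (1/4 + \<epsilon>))))"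
      if "\<epsilon> > 0" for \<epsilon>
      using area_tail_lower_bound[OF zero_less_one that] unfolding mean_tau_def
      by (intro exI[of _ 1]) simp
  next
    assume "\<exists>\<gamma>0. 0 < \<gamma>0 \<and> \<gamma>0 < 1
      \<and> (\<forall>x y. 0 < x \<longrightarrow> x \<le> y \<longrightarrow> g y / y powr \<gamma>0 \<le> g x / x powr \<gamma>0)
      \<and> ((\<lambda>x. g x / x powr \<gamma>0) \<longlongrightarrow> 0) at_top"
    then obtain \<gamma>0 where "\<gamma>0 < 1"
      and "\<And>x y. 0 < x \<Longrightarrow> x \<le> y \<Longrightarrow> g y / y powr \<gamma>0 \<le> g x / x powr \<gamma>0"
      by blast
    then interpret subpower_walk M X a g \<gamma>0 by unfold_locales
    show "((\<lambda>x. ln (area_tail x) / ln (Fbar M X (peak x))) \<longlongrightarrow> 1) at_top"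
      by (rule ln_area_tail_ratio_tendsto_1)
  qed (rule area_tail_upper_bound)
qed

end
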